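(* Let $p\ge1$, let $m_1,\ldots,m_p$ be positive integers, and let $\Gamma\subset N_{\mathbb R}=\mathbb R^{m_1}\times\cdots\times\mathbb R^{m_p}$ be a $d$-dimensional tropical variety. Let $\underline\Lambda=\Lambda_1,\ldots,\Lambda_p$, where each $\Lambda_i\subset\mathbb R^{m_i}$ is a positive tropical divisor. Let $\sigma_1,\ldots,\sigma_k$ be the facets of $\Gamma$. For every $\mathbf n=(n_1,\ldots,n_p)\in\mathbb N^p$ with $|\mathbf n|=d$, we have $\deg^{\mathbf n}_{\underline\Lambda}(\Gamma)>0$ if and only if there exists a facet $\sigma_j$ such that $$\sum_{i\in I}n_i\le\dim\left(\Pi_I(\sigma_j)\right)\quad\text{for every }I\subseteq[p].$$
   Context: Notation. $\mathbb N=\{0,1,2,\ldots\}$, $[p]=\{1,\ldots,p\}$, $N=\mathbb Z^{m_1+\cdots+m_p}$, $N_{\mathbb R}=N\otimes\mathbb R$. For $I\subseteq[p]$, $\Pi_I:N_{\mathbb R}\to\prod_{i\in I}\mathbb R^{m_i}$ is the natural projection (to a point if $I=\varnothing$), and $\Pi_i=\Pi_{\{i\}}$. $|\mathbf n|=n_1+\cdots+n_p$. Tropical varieties. A tropical variety of dimension $d$ in $N_{\mathbb R}$ is a finite rational polyhedral complex $\Gamma$, pure of dimension $d$ (in particular nonempty), with positive integer weights $\omega_\Gamma$ on its facets ($d$-dimensional cells), balanced: for every $(d-1)$-dimensional cell $\tau$, $\sum_{\sigma\supset\tau}\omega_\Gamma(\sigma)\mathbf v_{\sigma/\tau}=0$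 in $N_{\mathbb R}/(N_\tau)_{\mathbb R}$, the sum being over facets $\sigma\supset\tau$, where $N_\tau$ and $(N_\tau)_{\mathbb R}$ are the lattice and linear space parallel to $\tau$ and $\mathbf v_{\sigma/\tau}$ is the primitive integer generator of $\sigma$ modulo $\tau$. One works up to refinement. A tropical divisor has codimension $1$; a tropical curve has dimension $1$. The stable intersection $\Gamma\cap_{\mathrm{st}}\Gamma'$ is the limit as $\varepsilon\to0^+$ of $\Gamma\cap(\Gamma'+\varepsilon\mathbf v)$ for generic $\mathbf v\in N_{\mathbb R}$ (a transverse intersection), with weight $\omega_\Gamma(\sigma)\omega_{\Gamma'}(\sigma')[N:N_\sigma+N_{\sigma'}]$ on the facet $\sigma\cap(\sigma'+\varepsilon\mathbf v)$ (weights of facets with the same limit are added); it is empty or its codimension is the sum of the codimensions. The degree of a $0$-dimensional tropical variety is the sum of its weights ($0$ if empty). A tropical divisor $\Lambda_i\subset\mathbb R^{m_i}$ is positive if $\deg(\Lambda_i\cap_{\mathrm{st}}C)>0$ for every tropical curve $C\subset\mathbb R^{m_i}$. For $|\mathbf n|=d=\dim\Gamma$, the tropical multidegree is $\deg^{\mathbf n}_{\underline\Lambda}(\Gamma)=\deg(\Gamma\cap_{\mathrm{st}}(\Pi_1^{-1}(\Lambda_1))^{n_1}\cap_{\mathrm{st}}\cdots\cap_{\mathrm{st}}(\Pi_p^{-1}(\Lambda_p))^{n_p})$, where the power $n_i$ means $n_i$-fold stable self-intersection. *)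

theory Defs
  imports "HOL-Analysis.Analysis"
begin

text \<open>
  The spaces \<open>\<real>\<^sup>m\<^sup>1, \<dots>, \<real>\<^sup>m\<^sup>p\<close> of different dimensions have to live in one type. Coordinates
  of the product are indexed by a finite type \<^typ>\<open>'n\<close>, and a factor is the coordinate subspace
  belonging to a set \<open>J\<close> of coordinates (all other coordinates being zero); \<open>J = UNIV\<close> gives the
  whole product. Hence all ambient-dependent notions carry the parameter \<open>J\<close>.
\<close>

definition coord_space :: "'n::finite set \<Rightarrow> (real^'n) set" where
  "coord_space J = {x. \<forall>j. j \<notin> J \<longrightarrow> x $ j = 0}"

definition coord_lattice :: "'n::finite set \<Rightarrow> (real^'n) set" where
  "coord_lattice J = {x \<in> coord_space J. \<forall>j. x $ j \<in> \<int>}"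

definition coord_proj :: "'n::finite set \<Rightarrow> real^'n \<Rightarrow> real^'n" where
  "coord_proj J x = (\<chi> j. if j \<in> J then x $ j else 0)"


subsection \<open>Rational polyhedral complexes\<close>

text \<open>Rationality concerns the slopes only: the normals are integral, the constants are real.\<close>

definition rational_polyhedron :: "'n::finite set \<Rightarrow> (real^'n) set \<Rightarrow> bool" where
  "rational_polyhedron J P \<longleftrightarrow>
     (\<exists>F :: ((real^'n) \<times> real) set. finite F \<and> (\<forall>(a, c) \<in> F. \<forall>j. a $ j \<in> \<int>) \<and>
        P = {x \<in> coord_space J. \<forall>(a, c) \<in> F. a \<bullet> x \<le> c})"

text \<open>
  Cells are nonempty, so that a complex of dimension 0 has no cells of dimension \<open>-1\<close>
  (recall \<open>aff_dim {} = -1\<close> and that the empty set is a face in the sense of \<open>face_of\<close>).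
\<close>

definition rational_polyhedral_complex :: "'n::finite set \<Rightarrow> (real^'n) set set \<Rightarrow> bool" where
  "rational_polyhedral_complex J \<C> \<longleftrightarrow>
     finite \<C> \<and>
     (\<forall>\<sigma>\<in>\<C>. \<sigma> \<noteq> {} \<and> rational_polyhedron J \<sigma>) \<and>
     (\<forall>\<sigma>\<in>\<C>. \<forall>F. F face_of \<sigma> \<and> F \<noteq> {} \<longrightarrow> F \<in> \<C>) \<and>
     (\<forall>\<sigma>\<in>\<C>. \<forall>\<sigma>'\<in>\<C>. \<sigma> \<inter> \<sigma>' face_of \<sigma> \<and> \<sigma> \<inter> \<sigma>' face_of \<sigma>')"

definition pure_of_dim :: "nat \<Rightarrow> (real^'n::finite) set set \<Rightarrow> bool" where
  "pure_of_dim d \<C> \<longleftrightarrow>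
     \<C> \<noteq> {} \<and> (\<forall>\<tau>\<in>\<C>. \<exists>\<sigma>\<in>\<C>. \<tau> \<subseteq> \<sigma> \<and> aff_dim \<sigma> = int d)"

definition parallel_space :: "(real^'n::finite) set \<Rightarrow> (real^'n) set" where
  "parallel_space \<sigma> = span {x - y | x y. x \<in> \<sigma> \<and> y \<in> \<sigma>}"

definition parallel_lattice :: "(real^'n::finite) set \<Rightarrow> (real^'n) set" where
  "parallel_lattice \<sigma> = {x \<in> parallel_space \<sigma>. \<forall>j. x $ j \<in> \<int>}"

text \<open>
  \<open>v\<close> represents the primitive generator of \<open>\<sigma>\<close> modulo its face \<open>\<tau>\<close> of codimension 1: its class
  generates \<open>N\<^sub>\<sigma> / N\<^sub>\<tau>\<close>, and it points from \<open>\<tau>\<close> into \<open>\<sigma>\<close>. It is unique modulo \<open>N\<^sub>\<tau>\<close>.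
\<close>

definition primitive_generator ::
    "(real^'n::finite) set \<Rightarrow> (real^'n) set \<Rightarrow> real^'n \<Rightarrow> bool" where
  "primitive_generator \<sigma> \<tau> v \<longleftrightarrow>
     parallel_lattice \<sigma> = {z + of_int k *\<^sub>R v | z k. z \<in> parallel_lattice \<tau>} \<and>
     (\<exists>x\<in>\<tau>. \<exists>t>0. x + t *\<^sub>R v \<in> \<sigma>)"


subsection \<open>Tropical varieties\<close>

record 'a weighted_complex =
  cells :: "'a set set"
  weight :: "'a set \<Rightarrow> nat"

text \<open>Only the weights of facets, the cells of top dimension, are ever used.\<close>

definition facets :: "(real^'n::finite) weighted_complex \<Rightarrow> (real^'n) set set" where
  "facets \<Gamma> = {\<sigma> \<in> cells \<Gamma>. \<forall>\<tau>\<in>cells \<Gamma>. aff_dim \<tau> \<le> aff_dim \<sigma>}"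

definition balanced :: "nat \<Rightarrow> (real^'n::finite) weighted_complex \<Rightarrow> bool" where
  "balanced d \<Gamma> \<longleftrightarrow>
     (\<forall>\<tau>\<in>cells \<Gamma>. aff_dim \<tau> = int d - 1 \<longrightarrow>
        (\<exists>v. (\<forall>\<sigma>\<in>facets \<Gamma>. \<tau> \<subseteq> \<sigma> \<longrightarrow> primitive_generator \<sigma> \<tau> (v \<sigma>)) \<and>
             (\<Sum>\<sigma> | \<sigma> \<in> facets \<Gamma> \<and> \<tau> \<subseteq> \<sigma>. real (weight \<Gamma> \<sigma>) *\<^sub>R v \<sigma>) \<in> parallel_space \<tau>))"

definition tropical_variety ::
    "'n::finite set \<Rightarrow> nat \<Rightarrow> (real^'n) weighted_complex \<Rightarrow> bool" where
  "tropical_variety J d \<Gamma> \<longleftrightarrow>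
     rational_polyhedral_complex J (cells \<Gamma>) \<and> pure_of_dim d (cells \<Gamma>) \<and>
     (\<forall>\<sigma>\<in>facets \<Gamma>. 0 < weight \<Gamma> \<sigma>) \<and> balanced d \<Gamma>"

definition tropical_divisor :: "'n::finite set \<Rightarrow> (real^'n) weighted_complex \<Rightarrow> bool" where
  "tropical_divisor J \<Lambda> \<longleftrightarrow> (\<exists>d. Suc d = card J \<and> tropical_variety J d \<Lambda>)"

definition tropical_curve :: "'n::finite set \<Rightarrow> (real^'n) weighted_complex \<Rightarrow> bool" where
  "tropical_curve J C \<longleftrightarrow> tropical_variety J 1 C"


subsection \<open>Stable intersection\<close>

text \<open>
  The limit of \<open>P \<epsilon>\<close> for \<open>\<epsilon> \<rightarrow> 0+\<close>, as the set of limits of points of the \<open>P \<epsilon>\<close> (lower Kuratowski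
  limit). For the families \<open>\<sigma> \<inter> (\<sigma>' + \<epsilon>v)\<close> below, with \<open>\<sigma>\<close>, \<open>\<sigma>'\<close> polyhedra, it agrees with
  the upper limit; it is empty if the members are empty for small \<open>\<epsilon>\<close>.
\<close>

definition set_limit :: "(real \<Rightarrow> 'a::metric_space set) \<Rightarrow> 'a set" where
  "set_limit P = {x. \<forall>e>0. \<forall>\<^sub>F \<epsilon> in at_right 0. P \<epsilon> \<inter> ball x e \<noteq> {}}"

definition displaced_limit ::
    "real^'n \<Rightarrow> (real^'n::finite) set \<Rightarrow> (real^'n) set \<Rightarrow> (real^'n) set" where
  "displaced_limit v \<sigma> \<sigma>' = set_limit (\<lambda>\<epsilon>. \<sigma> \<inter> (\<lambda>x. x + \<epsilon> *\<^sub>R v) ` \<sigma>')"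

text \<open>
  Generic means: outside finitely many proper linear subspaces. If \<open>v\<close> is generic and
  \<open>\<sigma>\<close>, \<open>\<sigma>'\<close> do not span the ambient space together, then \<open>\<sigma> \<inter> (\<sigma>' + \<epsilon>v)\<close> is nonempty for at
  most one \<open>\<epsilon>\<close>; so for all small \<open>\<epsilon> > 0\<close> the complexes meet transversally.
\<close>

definition generic_displacement ::
    "'n::finite set \<Rightarrow> (real^'n) weighted_complex \<Rightarrow> (real^'n) weighted_complex \<Rightarrow> real^'n \<Rightarrow> bool"
  where
  "generic_displacement J \<Gamma> \<Gamma>' v \<longleftrightarrow> v \<in> coord_space J \<and>
     (\<forall>\<sigma>\<in>cells \<Gamma>. \<forall>\<sigma>'\<in>cells \<Gamma>'.
        span (parallel_space \<sigma> \<union> parallel_space \<sigma>') \<noteq> coord_space J \<longrightarrow>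
        v \<notin> span (parallel_space \<sigma> \<union> parallel_space \<sigma>'))"

text \<open>The index \<open>[A : B]\<close> of additive subgroups \<open>B \<subseteq> A\<close>.\<close>

definition subgroup_index :: "'a::ab_group_add set \<Rightarrow> 'a set \<Rightarrow> nat" where
  "subgroup_index A B = card (A // {(x, y). x \<in> A \<and> y \<in> A \<and> y - x \<in> B})"

definition cell_index ::
    "'n::finite set \<Rightarrow> (real^'n) set \<Rightarrow> (real^'n) set \<Rightarrow> nat" where
  "cell_index J \<sigma> \<sigma>' =
     subgroup_index (coord_lattice J)
       {x + y | x y. x \<in> parallel_lattice \<sigma> \<and> y \<in> parallel_lattice \<sigma>'}"

definition displaced_intersection ::
    "'n::finite set \<Rightarrow> real^'n \<Rightarrow> (real^'n) weighted_complex \<Rightarrow> (real^'n) weighted_complex \<Rightarrow>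
     (real^'n) weighted_complex" where
  "displaced_intersection J v \<Gamma> \<Gamma>' =
     \<lparr> cells = {L. L \<noteq> {} \<and> (\<exists>\<sigma>\<in>cells \<Gamma>. \<exists>\<sigma>'\<in>cells \<Gamma>'. L = displaced_limit v \<sigma> \<sigma>')},
       weight = (\<lambda>L. \<Sum>(\<sigma>, \<sigma>') \<in> {(\<sigma>, \<sigma>') \<in> facets \<Gamma> \<times> facets \<Gamma>'. displaced_limit v \<sigma> \<sigma>' = L}.
                     weight \<Gamma> \<sigma> * weight \<Gamma>' \<sigma>' * cell_index J \<sigma> \<sigma>') \<rparr>"

text \<open>For tropical varieties the cells and the facet weights do not depend on the generic \<open>v\<close>.\<close>

definition stable_intersection ::
    "'n::finite set \<Rightarrow> (real^'n) weighted_complex \<Rightarrow> (real^'n) weighted_complex \<Rightarrow>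
     (real^'n) weighted_complex" where
  "stable_intersection J \<Gamma> \<Gamma>' =
     displaced_intersection J (SOME v. generic_displacement J \<Gamma> \<Gamma>' v) \<Gamma> \<Gamma>'"

definition whole_space :: "'n::finite set \<Rightarrow> (real^'n) weighted_complex" where
  "whole_space J = \<lparr> cells = {coord_space J}, weight = (\<lambda>_. 1) \<rparr>"

text \<open>The empty power is the ambient space, the neutral element for stable intersection.\<close>

primrec stable_power ::
    "'n::finite set \<Rightarrow> (real^'n) weighted_complex \<Rightarrow> nat \<Rightarrow> (real^'n) weighted_complex" where
  "stable_power J \<Gamma> 0 = whole_space J"
| "stable_power J \<Gamma> (Suc k) = stable_intersection J (stable_power J \<Gamma> k) \<Gamma>"

text \<open>Meaningful for complexes which are empty or 0-dimensional.\<close>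

definition tropical_degree :: "(real^'n::finite) weighted_complex \<Rightarrow> nat" where
  "tropical_degree \<Gamma> = (\<Sum>\<sigma>\<in>facets \<Gamma>. weight \<Gamma> \<sigma>)"

definition positive_divisor :: "'n::finite set \<Rightarrow> (real^'n) weighted_complex \<Rightarrow> bool" where
  "positive_divisor J \<Lambda> \<longleftrightarrow> tropical_divisor J \<Lambda> \<and>
     (\<forall>C. tropical_curve J C \<longrightarrow> 0 < tropical_degree (stable_intersection J \<Lambda> C))"


subsection \<open>Multidegrees\<close>

text \<open>
  A map \<open>b\<close> from coordinates to indices of factors describes the product decomposition:
  \<open>blocks b {i}\<close> are the coordinates of the \<open>i\<close>-th factor, and \<open>coord_proj (blocks b I)\<close> is \<open>\<Pi>\<^sub>I\<close>.
\<close>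

definition blocks :: "('n::finite \<Rightarrow> nat) \<Rightarrow> nat set \<Rightarrow> 'n set" where
  "blocks b I = {j. b j \<in> I}"

text \<open>
  The preimage of \<open>\<Lambda>\<close> under the projection to \<open>coord_space J\<close>; the cell \<open>\<lambda>\<close> of \<open>\<Lambda>\<close> is recovered
  from its preimage as the image under the projection.
\<close>

definition proj_preimage ::
    "'n::finite set \<Rightarrow> (real^'n) weighted_complex \<Rightarrow> (real^'n) weighted_complex" where
  "proj_preimage J \<Lambda> =
     \<lparr> cells = (\<lambda>\<sigma>. coord_proj J -` \<sigma>) ` cells \<Lambda>,
       weight = (\<lambda>\<sigma>. weight \<Lambda> (coord_proj J ` \<sigma>)) \<rparr>"

definition tropical_multidegree ::
    "nat \<Rightarrow> ('n::finite \<Rightarrow> nat) \<Rightarrow> (nat \<Rightarrow> (real^'n) weighted_complex) \<Rightarrow> (nat \<Rightarrow> nat) \<Rightarrow>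
     (real^'n) weighted_complex \<Rightarrow> nat" where
  "tropical_multidegree p b \<Lambda> n \<Gamma> =
     tropical_degree
       (foldl (\<lambda>\<Delta> i. stable_intersection UNIV \<Delta>
                       (stable_power UNIV (proj_preimage (blocks b {i}) (\<Lambda> i)) (n i)))
          \<Gamma> [1..<Suc p])"

end

theory Submission
  imports Defs
begin

text \<open>
  The multidegree is a sum of positive terms, so the question is whether the iterated stable
  intersection of \<open>\<Gamma>\<close> with the preimages of the divisors is nonempty
  (\<open>tropical_degree_pos_iff\<close>). The reason for the dimension inequalities is transversality. Let \<open>L\<close>
  be the linear space parallel to a facet \<open>\<sigma>\<close> of \<open>\<Gamma>\<close>, of dimension \<open>d\<close>. Choose \<open>n\<^sub>i\<close> facets of
  \<open>\<Lambda>\<^sub>i\<close> for each \<open>i\<close>, with normals \<open>a\<^sub>i\<^sub>j\<close>. Their preimages are transversal to \<open>\<sigma>\<close> if and only if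
  the \<open>d\<close> functionals \<open>a\<^sub>i\<^sub>j\<close> are linearly independent on \<open>L\<close>.

  If the intersection is nonempty, a point of it comes with such a choice, since the displacements
  that define stable intersections are generic. The functionals with \<open>i \<in> I\<close> factor through the
  projection to the factors in \<open>I\<close>, so the image of \<open>\<sigma>\<close> has at least the dimension \<open>\<Sum>\<^sub>i\<^sub>\<in>\<^sub>I n\<^sub>i\<close>
  (\<open>exists_facet_if_iterated_nonempty\<close>).

  Conversely, positivity of \<open>\<Lambda>\<^sub>i\<close>, tested on rational lines, says that its facet normals span
  \<open>\<real>\<^sup>m\<^sup>i\<close> (\<open>positive_divisor_facets_separate\<close>). The inequalities are then exactly the condition of
  Rado's theorem on independent transversals (\<open>rado_linear_functionals\<close>), which yields
  functionals \<open>a\<^sub>i\<^sub>j\<close> as above. The facets chosen in this way may be far away from \<open>\<sigma>\<close>, so it only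
  follows that suitable translates of \<open>\<Gamma>\<close> and of \<open>d\<close> divisors meet. To get rid of the translations,
  consider all of them at once, as the points of one vector space. Those for which some cells of
  full dimension meet transversally form a closed polyhedral set with interior points. Balancing
  implies that one does not leave this set when crossing one of its walls, so its frontier has
  codimension at least two, and it is the whole space (\<open>transversal_meeting_covers\<close>). This is the
  translation invariance of intersection numbers, reduced to the part that concerns positivity: of
  the balancing condition it uses only that positive multiples of the generators around a wall
  sum up to a vector parallel to the wall.

  So all translates of \<open>\<Gamma>\<close> and of the divisors meet, also in cells of full dimension. This property
  is preserved when two members of such a family are replaced by their stable intersection
  (\<open>covering_stable_intersection\<close>), hence it passes to the iterated stable intersection.
\<close>

section \<open>Parallel spaces and rationality\<close>

lemma subspace_parallel_space [simp]: "subspace (parallel_space \<sigma>)"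
  by (simp add: parallel_space_def)

lemma zero_in_parallel_space [simp]: "0 \<in> parallel_space \<sigma>"
  by (rule subspace_0[OF subspace_parallel_space])

lemma diff_in_parallel_space: "x \<in> \<sigma> \<Longrightarrow> y \<in> \<sigma> \<Longrightarrow> x - y \<in> parallel_space \<sigma>"
  unfolding parallel_space_def by (rule span_base) auto

lemma parallel_space_mono: "\<sigma> \<subseteq> \<sigma>' \<Longrightarrow> parallel_space \<sigma> \<subseteq> parallel_space \<sigma>'"
  unfolding parallel_space_def by (rule span_mono) auto

lemma parallel_space_subset_subspace:
  assumes "subspace K" "\<And>x y. x \<in> \<sigma> \<Longrightarrow> y \<in> \<sigma> \<Longrightarrow> x - y \<in> K"
  shows "parallel_space \<sigma> \<subseteq> K"
  unfolding parallel_space_def using assms by (intro span_minimal) auto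

lemma parallel_space_UNIV [simp]: "parallel_space UNIV = UNIV"
  using diff_in_parallel_space[of _ UNIV 0] by auto

lemma parallel_space_eq_span_translate:
  assumes "a \<in> \<sigma>"
  shows "parallel_space \<sigma> = span ((+) (- a) ` \<sigma>)"
proof
  have "x - y \<in> span ((+) (- a) ` \<sigma>)" if "x \<in> \<sigma>" "y \<in> \<sigma>" for x y
  proof -
    have "(- a + x) - (- a + y) \<in> span ((+) (- a) ` \<sigma>)"
      using that by (intro span_diff span_base) auto
    then show ?thesis by simp
  qed
  then show "parallel_space \<sigma> \<subseteq> span ((+) (- a) ` \<sigma>)"
    by (intro parallel_space_subset_subspace) auto
  show "span ((+) (- a) ` \<sigma>) \<subseteq> parallel_space \<sigma>"
    unfolding parallel_space_def using assms by (intro span_mono) (force simp: algebra_simps)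
qed

lemma aff_dim_eq_dim_parallel_space:
  assumes "\<sigma> \<noteq> {}"
  shows "aff_dim \<sigma> = int (dim (parallel_space \<sigma>))"
proof -
  obtain a where a: "a \<in> \<sigma>" using assms by auto
  then have "aff_dim \<sigma> = int (dim ((+) (- a) ` \<sigma>))"
    by (intro aff_dim_eq_dim) (simp add: hull_inc)
  then show ?thesis
    using parallel_space_eq_span_translate[OF a] by simp
qed

lemma affine_hull_eq_translate_parallel_space:
  assumes "a \<in> \<sigma>"
  shows "affine hull \<sigma> = (+) a ` parallel_space \<sigma>"
proof -
  have "(+) (- a) ` \<sigma> = insert 0 ((+) (- a) ` (\<sigma> - {a}))" using assms by (auto simp: image_iff)
  then show ?thesis
    using affine_hull_span2[OF assms] parallel_space_eq_span_translate[OF assms] by simp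
qed

lemma rel_interior_absorbs_parallel_space:
  assumes "x \<in> rel_interior \<sigma>"
  obtains e where "e > 0" "\<And>w. w \<in> parallel_space \<sigma> \<Longrightarrow> norm w < e \<Longrightarrow> x + w \<in> \<sigma>"
proof -
  obtain e where e: "e > 0" "ball x e \<inter> affine hull \<sigma> \<subseteq> \<sigma>" and x: "x \<in> \<sigma>"
    using assms by (auto simp: mem_rel_interior_ball)
  have "x + w \<in> \<sigma>" if "w \<in> parallel_space \<sigma>" "norm w < e" for w
  proof -
    have "x + w \<in> affine hull \<sigma>"
      using affine_hull_eq_translate_parallel_space[OF x] that by auto
    moreover have "x + w \<in> ball x e" using that by (simp add: dist_norm)
    ultimately show ?thesis using e by auto
  qed
  then show ?thesis using that e(1) by blast
qed

lemma parallel_space_linear_image: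
  assumes "linear f"
  shows "parallel_space (f ` \<sigma>) = f ` parallel_space \<sigma>"
proof -
  have "{x - y | x y. x \<in> f ` \<sigma> \<and> y \<in> f ` \<sigma>} = f ` {x - y | x y. x \<in> \<sigma> \<and> y \<in> \<sigma>}"
  proof (intro set_eqI iffI)
    fix z assume "z \<in> {x - y | x y. x \<in> f ` \<sigma> \<and> y \<in> f ` \<sigma>}"
    then obtain x y where "x \<in> \<sigma>" "y \<in> \<sigma>" "z = f (x - y)"
      using linear_diff[OF assms] by auto
    then show "z \<in> f ` {x - y | x y. x \<in> \<sigma> \<and> y \<in> \<sigma>}" by blast
  next
    fix z assume "z \<in> f ` {x - y | x y. x \<in> \<sigma> \<and> y \<in> \<sigma>}"
    then obtain x y where "x \<in> \<sigma>" "y \<in> \<sigma>" "z = f x - f y"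
      using linear_diff[OF assms] by auto
    then show "z \<in> {x - y | x y. x \<in> f ` \<sigma> \<and> y \<in> f ` \<sigma>}" by blast
  qed
  then show ?thesis
    unfolding parallel_space_def using linear_span_image[OF assms] by simp
qed

lemma inner_eq_0_parallel_space:
  assumes "\<And>x. x \<in> \<sigma> \<Longrightarrow> a \<bullet> x = c" "u \<in> parallel_space \<sigma>"
  shows "a \<bullet> u = 0"
proof -
  have "parallel_space \<sigma> \<subseteq> {u. a \<bullet> u = 0}"
    by (rule parallel_space_subset_subspace[OF subspace_hyperplane]) (auto simp: inner_diff_right assms)
  then show ?thesis using assms(2) by auto
qed

definition rational_subspace :: "(real^'n::finite) set \<Rightarrow> bool" where
  "rational_subspace L \<longleftrightarrow>
     (\<exists>F. finite F \<and> (\<forall>a\<in>F. \<forall>j. a $ j \<in> \<int>) \<and> L = {x. \<forall>a\<in>F. a \<bullet> x = 0})"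

lemma rational_subspace_INT:
  assumes "finite A" "\<And>s. s \<in> A \<Longrightarrow> rational_subspace (L s)"
  shows "rational_subspace (\<Inter>s\<in>A. L s)"
proof -
  have "\<forall>s\<in>A. \<exists>F. finite F \<and> (\<forall>a\<in>F. \<forall>j. a $ j \<in> \<int>) \<and> L s = {x. \<forall>a\<in>F. a \<bullet> x = 0}"
    using assms(2) unfolding rational_subspace_def by blast
  from bchoice[OF this] obtain F where F: "\<forall>s\<in>A. finite (F s) \<and>
      (\<forall>a\<in>F s. \<forall>j. a $ j \<in> \<int>) \<and> L s = {x. \<forall>a\<in>F s. a \<bullet> x = 0}" by blast
  show ?thesis
    unfolding rational_subspace_def
    by (rule exI[of _ "\<Union>s\<in>A. F s"]) (use F assms(1) in auto)
qed

lemma rational_subspace_Int: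
  "rational_subspace L \<Longrightarrow> rational_subspace K \<Longrightarrow> rational_subspace (L \<inter> K)"
  using rational_subspace_INT[of "{L, K}" "\<lambda>x. x"] by auto

lemma rational_subspace_coord_space: "rational_subspace (coord_space J)"
proof -
  have "\<forall>a\<in>(\<lambda>j. axis j (1::real)) ` (- J). \<forall>j. a $ j \<in> \<int>" by (auto simp: axis_def)
  moreover have "coord_space J = {x. \<forall>a\<in>(\<lambda>j. axis j 1) ` (- J). a \<bullet> x = 0}"
    unfolding coord_space_def by (auto simp: inner_axis')
  ultimately show ?thesis
    unfolding rational_subspace_def by (intro exI[of _ "(\<lambda>j. axis j 1) ` (- J)"]) simp
qed

lemma integral_inner: 
  fixes a b :: "real^'n::finite"
  assumes "\<forall>j. a $ j \<in> \<int>" "\<forall>j. b $ j \<in> \<int>" shows "a \<bullet> b \<in> \<int>"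
  unfolding inner_vec_def using assms by (auto intro!: Ints_sum Ints_mult)

text \<open>
  Imposing one more integral equation \<open>a \<bullet> x = 0\<close> keeps a spanning set of integral vectors: fix
  one of them, \<open>w\<close>, with \<open>a \<bullet> w \<noteq> 0\<close>, and replace each \<open>u\<close> by \<open>(a \<bullet> w) u - (a \<bullet> u) w\<close>.
\<close>

lemma span_integral_hyperplane:
  fixes a :: "real^'n::finite"
  assumes B: "\<forall>u\<in>B. \<forall>j. u $ j \<in> \<int>" and a: "\<forall>j. a $ j \<in> \<int>"
  shows "\<exists>B'. (\<forall>u\<in>B'. \<forall>j. u $ j \<in> \<int>) \<and> span B' = span B \<inter> {x. a \<bullet> x = 0}"
proof (cases "\<forall>u\<in>B. a \<bullet> u = 0")
  case True
  then have "span B \<subseteq> {x. a \<bullet> x = 0}"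
    by (intro span_minimal) (auto simp: subspace_hyperplane)
  then show ?thesis using B by (intro exI[of _ B]) auto
next
  case False
  then obtain w where w: "w \<in> B" "a \<bullet> w \<noteq> 0" by auto
  let ?g = "\<lambda>u. (a \<bullet> w) *\<^sub>R u - (a \<bullet> u) *\<^sub>R w"
  have lin: "linear ?g"
    by (intro linearI) (auto simp: inner_add_right algebra_simps)
  have "span (?g ` B) = ?g ` span B" by (rule linear_span_image[OF lin])
  also have "\<dots> = span B \<inter> {x. a \<bullet> x = 0}"
  proof (intro set_eqI iffI)
    fix y assume "y \<in> ?g ` span B"
    then obtain u where u: "u \<in> span B" "y = ?g u" by blast
    have "?g u \<in> span B"
      using u w by (intro span_diff span_scale) (auto intro: span_base)
    then show "y \<in> span B \<inter> {x. a \<bullet> x = 0}"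
      using u by (simp add: inner_diff_right)
  next
    fix y assume y: "y \<in> span B \<inter> {x. a \<bullet> x = 0}"
    then have "y = ?g ((1 / (a \<bullet> w)) *\<^sub>R y)" using w by simp
    moreover have "(1 / (a \<bullet> w)) *\<^sub>R y \<in> span B" using y by (auto intro: span_scale)
    ultimately show "y \<in> ?g ` span B" by blast
  qed
  finally have "span (?g ` B) = span B \<inter> {x. a \<bullet> x = 0}" .
  moreover have "\<forall>u\<in>?g ` B. \<forall>j. u $ j \<in> \<int>"
  proof (intro ballI allI)
    fix z j assume "z \<in> ?g ` B"
    then obtain u where u: "u \<in> B" "z = ?g u" by blast
    have "a \<bullet> w \<in> \<int>" "a \<bullet> u \<in> \<int>" using B a w u by (auto intro!: integral_inner)
    then show "z $ j \<in> \<int>" using u B w by (auto intro!: Ints_diff Ints_mult)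
  qed
  ultimately show ?thesis by blast
qed

lemma rational_subspace_span_integral:
  fixes L :: "(real^'n::finite) set"
  assumes "rational_subspace L"
  shows "span {x \<in> L. \<forall>j. x $ j \<in> \<int>} = L"
proof -
  obtain F where F: "finite F" "\<forall>a\<in>F. \<forall>j. a $ j \<in> \<int>" "L = {x. \<forall>a\<in>F. a \<bullet> x = 0}"
    using assms unfolding rational_subspace_def by auto
  have "\<exists>B. (\<forall>u\<in>B. \<forall>j. u $ j \<in> \<int>) \<and> span B = {x. \<forall>a\<in>F. a \<bullet> x = 0}"
    using F(1,2)
  proof (induction F)
    case empty
    have "\<forall>u\<in>Basis. \<forall>j. (u::real^'n) $ j \<in> \<int>"
      by (auto simp: Basis_vec_def axis_def)
    then show ?case by (intro exI[of _ Basis]) auto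
  next
    case (insert a F)
    then obtain B where B: "\<forall>u\<in>B. \<forall>j. u $ j \<in> \<int>" "span B = {x. \<forall>a\<in>F. a \<bullet> x = 0}" by auto
    moreover have "{x. \<forall>b\<in>insert a F. b \<bullet> x = 0} = {x. \<forall>a\<in>F. a \<bullet> x = 0} \<inter> {x. a \<bullet> x = 0}" by auto
    ultimately show ?case using span_integral_hyperplane[of B a] insert.prems by auto
  qed
  then obtain B where B: "\<forall>u\<in>B. \<forall>j. u $ j \<in> \<int>" "span B = L" using F(3) by auto
  have "B \<subseteq> {x \<in> L. \<forall>j. x $ j \<in> \<int>}" using B span_base by auto
  then have "L \<subseteq> span {x \<in> L. \<forall>j. x $ j \<in> \<int>}" using B(2) span_mono by blast
  moreover have "subspace L" using B(2) subspace_span by blast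
  ultimately show ?thesis by (intro antisym span_minimal) auto
qed

lemma rational_polyhedron_UNIV:
  assumes "rational_polyhedron J P"
  shows "rational_polyhedron UNIV P"
proof -
  obtain F where F: "finite F" "\<forall>(a, c) \<in> F. \<forall>j. a $ j \<in> \<int>"
      "P = {x \<in> coord_space J. \<forall>(a, c) \<in> F. a \<bullet> x \<le> c}"
    using assms unfolding rational_polyhedron_def by auto
  let ?G = "(\<lambda>j. (axis j 1, 0)) ` (- J) \<union> (\<lambda>j. (axis j (- 1), 0)) ` (- J)"
  have "P = {x \<in> coord_space UNIV. \<forall>(a, c) \<in> F \<union> ?G. a \<bullet> x \<le> c}"
    unfolding F(3) coord_space_def
    by (fastforce simp: inner_axis' ball_Un intro: antisym)
  moreover have "\<forall>(a, c) \<in> F \<union> ?G. \<forall>j. a $ j \<in> \<int>"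
    using F(2) by (auto simp: axis_def)
  ultimately show ?thesis
    unfolding rational_polyhedron_def using F(1) by (intro exI[of _ "F \<union> ?G"]) auto
qed

lemma rational_polyhedron_UNIV_iff:
  "rational_polyhedron UNIV P \<longleftrightarrow>
     (\<exists>F. finite F \<and> (\<forall>(a, c) \<in> F. \<forall>j. a $ j \<in> \<int>) \<and> P = {x. \<forall>(a, c) \<in> F. a \<bullet> x \<le> c})"
  unfolding rational_polyhedron_def coord_space_def by auto

lemma rational_polyhedron_Int:
  assumes "rational_polyhedron UNIV P" "rational_polyhedron UNIV Q"
  shows "rational_polyhedron UNIV (P \<inter> Q)"
proof -
  obtain F G where "finite F" "\<forall>(a, c) \<in> F. \<forall>j. a $ j \<in> \<int>" "P = {x. \<forall>(a, c) \<in> F. a \<bullet> x \<le> c}"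
    "finite G" "\<forall>(a, c) \<in> G. \<forall>j. a $ j \<in> \<int>" "Q = {x. \<forall>(a, c) \<in> G. a \<bullet> x \<le> c}"
    using assms unfolding rational_polyhedron_UNIV_iff by auto
  then show ?thesis unfolding rational_polyhedron_UNIV_iff
    by (intro exI[of _ "F \<union> G"]) auto
qed

lemma polyhedron_halfspaces:
  fixes F :: "('a::euclidean_space \<times> real) set"
  assumes "finite F"
  shows "polyhedron {x. \<forall>(a, c) \<in> F. a \<bullet> x \<le> c}"
proof -
  have "{x. \<forall>(a, c) \<in> F. a \<bullet> x \<le> c} = (\<Inter>(a, c) \<in> F. {x. a \<bullet> x \<le> c})" by auto
  also have "polyhedron \<dots>"
    using assms by (intro polyhedron_Inter) (auto simp: polyhedron_halfspace_le)
  finally show ?thesis .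
qed

lemma rational_polyhedron_imp_polyhedron:
  assumes "rational_polyhedron J P" shows "polyhedron P"
  using rational_polyhedron_UNIV[OF assms] polyhedron_halfspaces
  unfolding rational_polyhedron_UNIV_iff by blast

text \<open>
  At a relatively interior point an inequality is either strict or an equation on the whole
  polyhedron, so the parallel space is cut out by those normals whose inequality is an equation.
\<close>

lemma rational_subspace_parallel_space:
  fixes P :: "(real^'n::finite) set"
  assumes "rational_polyhedron J P" "P \<noteq> {}"
  shows "rational_subspace (parallel_space P)"
proof -
  obtain F where F: "finite F" "\<forall>(a, c) \<in> F. \<forall>j. a $ j \<in> \<int>" "P = {x. \<forall>(a, c) \<in> F. a \<bullet> x \<le> c}"
    using rational_polyhedron_UNIV[OF assms(1)] unfolding rational_polyhedron_UNIV_iff by auto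
  have "polyhedron P" by (rule rational_polyhedron_imp_polyhedron[OF assms(1)])
  then have cv: "convex P" by (rule polyhedron_imp_convex)
  obtain x where x: "x \<in> rel_interior P" using cv assms(2) rel_interior_eq_empty by blast
  then have xP: "x \<in> P" using rel_interior_subset by blast
  let ?E = "{(a, c) \<in> F. a \<bullet> x = c}"
  have tight: "a \<bullet> z = c" if "(a, c) \<in> F" "a \<bullet> x = c" "z \<in> P" for a c z
  proof -
    have "P \<inter> {x. a \<bullet> x = c} face_of P"
      using that(1) F(3) by (intro face_of_Int_supporting_hyperplane_le cv) auto
    then have "P \<subseteq> P \<inter> {x. a \<bullet> x = c}"
      by (rule subset_of_face_of) (use x xP that in auto)
    then show ?thesis using that(3) by auto
  qed
  have "parallel_space P = {u. \<forall>a\<in>fst ` ?E. a \<bullet> u = 0}"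
  proof (intro set_eqI iffI)
    fix u assume u: "u \<in> parallel_space P"
    show "u \<in> {u. \<forall>a\<in>fst ` ?E. a \<bullet> u = 0}"
      using tight inner_eq_0_parallel_space[OF _ u] by fastforce
  next
    fix u assume u: "u \<in> {u. \<forall>a\<in>fst ` ?E. a \<bullet> u = 0}"
    have "\<forall>\<^sub>F t in at_right 0. \<forall>p\<in>F. fst p \<bullet> (x + t *\<^sub>R u) \<le> snd p"
      unfolding eventually_ball_finite_distrib[OF F(1)]
    proof
      fix p assume p: "p \<in> F"
      obtain a c where ac: "p = (a, c)" by (cases p)
      show "\<forall>\<^sub>F t in at_right 0. fst p \<bullet> (x + t *\<^sub>R u) \<le> snd p"
      proof (cases "a \<bullet> x = c")
        case True
        then have "a \<bullet> u = 0" using u p ac by force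
        then show ?thesis using True ac by (simp add: inner_add_right)
      next
        case False
        then have lt: "a \<bullet> x < c" using xP F(3) p ac by fastforce
        have "((\<lambda>t. a \<bullet> (x + t *\<^sub>R u)) \<longlongrightarrow> a \<bullet> (x + 0 *\<^sub>R u)) (at_right 0)"
          by (intro tendsto_intros)
        then have "\<forall>\<^sub>F t in at_right 0. a \<bullet> (x + t *\<^sub>R u) < c"
          using lt by (intro order_tendstoD) auto
        then show ?thesis using ac by (auto elim: eventually_mono)
      qed
    qed
    moreover have "\<forall>\<^sub>F t in at_right (0::real). t > 0" by (simp add: eventually_at_right_less)
    ultimately have "\<forall>\<^sub>F t in at_right 0. t > 0 \<and> x + t *\<^sub>R u \<in> P"
      by eventually_elim (use F(3) in auto)
    then obtain t where t: "t > 0" "x + t *\<^sub>R u \<in> P"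
      using eventually_happens trivial_limit_at_right_real by blast
    then have "t *\<^sub>R u \<in> parallel_space P" using diff_in_parallel_space[OF t(2) xP] by simp
    then have "(1 / t) *\<^sub>R (t *\<^sub>R u) \<in> parallel_space P"
      by (rule subspace_scale[OF subspace_parallel_space])
    moreover have "(1 / t) *\<^sub>R (t *\<^sub>R u) = u" using t by simp
    ultimately show "u \<in> parallel_space P" by metis
  qed
  moreover have "finite (fst ` ?E)" using F(1) by (auto intro: finite_subset[of _ F])
  ultimately show ?thesis unfolding rational_subspace_def
    using F(2) by (intro exI[of _ "fst ` ?E"]) auto
qed

lemma span_parallel_lattice:
  assumes "rational_polyhedron J P" "P \<noteq> {}"
  shows "span (parallel_lattice P) = parallel_space P"
  unfolding parallel_lattice_def
  by (rule rational_subspace_span_integral[OF rational_subspace_parallel_space[OF assms]])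

section \<open>Polyhedra\<close>

lemma polyhedron_iff_halfspaces:
  fixes S :: "'a::euclidean_space set"
  shows "polyhedron S \<longleftrightarrow> (\<exists>F. finite F \<and> S = {x. \<forall>(a, c) \<in> F. a \<bullet> x \<le> c})"
proof
  assume "polyhedron S"
  then obtain F where F: "finite F" "S = \<Inter>F" "\<forall>h\<in>F. \<exists>a b. a \<noteq> 0 \<and> h = {x. a \<bullet> x \<le> b}"
    unfolding polyhedron_def by blast
  have "\<forall>h\<in>F. \<exists>p. h = {x. fst p \<bullet> x \<le> snd p}" using F(3) by fastforce
  from bchoice[OF this] obtain f where f: "\<forall>h\<in>F. h = {x. fst (f h) \<bullet> x \<le> snd (f h)}" by blast
  have "S = {x. \<forall>h\<in>F. fst (f h) \<bullet> x \<le> snd (f h)}" using F(2) f by blast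
  also have "\<dots> = {x. \<forall>(a, c) \<in> f ` F. a \<bullet> x \<le> c}" by (auto simp: split_beta)
  finally show "\<exists>F. finite F \<and> S = {x. \<forall>(a, c) \<in> F. a \<bullet> x \<le> c}" using F(1) by blast
next
  assume "\<exists>F. finite F \<and> S = {x. \<forall>(a, c) \<in> F. a \<bullet> x \<le> c}"
  then show "polyhedron S" using polyhedron_halfspaces by blast
qed

lemma polyhedron_linear_vimage:
  fixes f :: "'a::euclidean_space \<Rightarrow> 'b::euclidean_space"
  assumes "linear f" "polyhedron S"
  shows "polyhedron (f -` S)"
proof -
  obtain F where F: "finite F" "S = {x. \<forall>(a, c) \<in> F. a \<bullet> x \<le> c}"
    using assms(2) unfolding polyhedron_iff_halfspaces by blast
  have adj: "adjoint f a \<bullet> x = a \<bullet> f x" for a x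
    using adjoint_works[OF assms(1), of x a] by (simp add: inner_commute)
  have "f -` S = {x. \<forall>(a, c) \<in> (\<lambda>(a, c). (adjoint f a, c)) ` F. a \<bullet> x \<le> c}"
    unfolding F(2) by (auto simp: adj split_beta)
  then show ?thesis using polyhedron_halfspaces[OF finite_imageI[OF F(1)]] by simp
qed

text \<open>
  Fourier-Motzkin elimination of \<open>t\<close> from \<open>x - t w \<in> S\<close>: the inequalities with \<open>a \<bullet> w > 0\<close> bound
  \<open>t\<close> from below, those with \<open>a \<bullet> w < 0\<close> from above, and \<open>t\<close> exists when each lower bound is at
  most each upper bound.
\<close>

lemma polyhedron_add_line:
  fixes S :: "'a::euclidean_space set"
  assumes "polyhedron S"
  shows "polyhedron {x. \<exists>t::real. x - t *\<^sub>R w \<in> S}"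
proof -
  obtain F where F: "finite F" "S = {x. \<forall>(a, c) \<in> F. a \<bullet> x \<le> c}"
    using assms unfolding polyhedron_iff_halfspaces by blast
  define Z where "Z = {p \<in> F. fst p \<bullet> w = 0}"
  define P where "P = {p \<in> F. fst p \<bullet> w > 0}"
  define N where "N = {p \<in> F. fst p \<bullet> w < 0}"
  have F_eq: "F = Z \<union> P \<union> N" unfolding Z_def P_def N_def by auto
  have fin: "finite Z" "finite P" "finite N" using F(1) unfolding Z_def P_def N_def by auto
  define bd where "bd = (\<lambda>p (x::'a). (fst p \<bullet> x - snd p) / (fst p \<bullet> w))"
  have P_iff: "fst p \<bullet> (x - t *\<^sub>R w) \<le> snd p \<longleftrightarrow> bd p x \<le> t" if "p \<in> P" for p x t
    using that unfolding P_def bd_def by (auto simp: inner_diff_right field_simps)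
  have N_iff: "fst p \<bullet> (x - t *\<^sub>R w) \<le> snd p \<longleftrightarrow> t \<le> bd p x" if "p \<in> N" for p x t
    using that unfolding N_def bd_def by (auto simp: inner_diff_right field_simps)
  have Z_iff: "fst p \<bullet> (x - t *\<^sub>R w) \<le> snd p \<longleftrightarrow> fst p \<bullet> x \<le> snd p" if "p \<in> Z" for p x t
    using that unfolding Z_def by (auto simp: inner_diff_right)
  have S_iff: "x - t *\<^sub>R w \<in> S \<longleftrightarrow> (\<forall>p\<in>Z. fst p \<bullet> x \<le> snd p) \<and> (\<forall>p\<in>P. bd p x \<le> t) \<and> (\<forall>q\<in>N. t \<le> bd q x)"
    for x t
  proof -
    have "x - t *\<^sub>R w \<in> S \<longleftrightarrow> (\<forall>p\<in>Z \<union> P \<union> N. fst p \<bullet> (x - t *\<^sub>R w) \<le> snd p)"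
      unfolding F(2) F_eq[symmetric] by (auto simp: split_beta)
    then show ?thesis using P_iff N_iff Z_iff by (auto simp: ball_Un)
  qed
  have ex_between: "(\<exists>t. (\<forall>p\<in>P. bd p x \<le> t) \<and> (\<forall>q\<in>N. t \<le> bd q x)) \<longleftrightarrow> (\<forall>p\<in>P. \<forall>q\<in>N. bd p x \<le> bd q x)" for x
  proof
    assume *: "\<forall>p\<in>P. \<forall>q\<in>N. bd p x \<le> bd q x"
    show "\<exists>t. (\<forall>p\<in>P. bd p x \<le> t) \<and> (\<forall>q\<in>N. t \<le> bd q x)"
    proof (cases "P = {}")
      case True
      show ?thesis
      proof (cases "N = {}")
        case False
        then show ?thesis using True fin
          by (intro exI[of _ "Min ((\<lambda>q. bd q x) ` N)"]) auto
      qed (use True in auto)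
    next
      case False
      then show ?thesis using * fin
        by (intro exI[of _ "Max ((\<lambda>q. bd q x) ` P)"]) auto
    qed
  qed force
  have ineq: "{x. bd p x \<le> bd q x} =
      {x. ((1 / (fst p \<bullet> w)) *\<^sub>R fst p - (1 / (fst q \<bullet> w)) *\<^sub>R fst q) \<bullet> x
            \<le> snd p / (fst p \<bullet> w) - snd q / (fst q \<bullet> w)}" for p q
    unfolding bd_def by (auto simp: inner_diff_left diff_divide_distrib)
  have "{x. \<exists>t::real. x - t *\<^sub>R w \<in> S} =
     (\<Inter>p\<in>Z. {x. fst p \<bullet> x \<le> snd p}) \<inter> (\<Inter>p\<in>P. \<Inter>q\<in>N. {x. bd p x \<le> bd q x})"
    unfolding S_iff using ex_between by auto
  also have "polyhedron \<dots>"
    unfolding ineq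
    by (intro polyhedron_Int polyhedron_Inter) (use fin in \<open>auto simp: polyhedron_halfspace_le\<close>)
  finally show ?thesis .
qed

lemma polyhedron_add_subspace:
  fixes S :: "'a::euclidean_space set"
  assumes "polyhedron S" "subspace K"
  shows "polyhedron {x. \<exists>k\<in>K. x - k \<in> S}"
proof -
  obtain B where B: "finite B" "span B = K"
    using basis_exists[of K] assms(2) by (metis independent_imp_finite span_subspace)
  have "polyhedron {x. \<exists>k\<in>span B. x - k \<in> S}"
    using B(1) assms(1)
  proof (induction B arbitrary: S)
    case (insert w B)
    have "{x. \<exists>k\<in>span (insert w B). x - k \<in> S} = {x. \<exists>t. x - t *\<^sub>R w \<in> {x. \<exists>k\<in>span B. x - k \<in> S}}"
    proof (intro set_eqI iffI; clarsimp)
      fix x k assume k: "k \<in> span (insert w B)" "x - k \<in> S"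
      then obtain t where "k - t *\<^sub>R w \<in> span B" by (auto simp: span_insert)
      moreover have "x - t *\<^sub>R w - (k - t *\<^sub>R w) \<in> S" using k by simp
      ultimately show "\<exists>t. \<exists>k\<in>span B. x - t *\<^sub>R w - k \<in> S" by blast
    next
      fix x t k assume k: "k \<in> span B" "x - t *\<^sub>R w - k \<in> S"
      then have "k + t *\<^sub>R w \<in> span (insert w B)" 
        by (metis add_diff_cancel_right' span_breakdown_eq)
      moreover have "x - (k + t *\<^sub>R w) \<in> S" using k by (simp add: algebra_simps)
      ultimately show "\<exists>k\<in>span (insert w B). x - k \<in> S" by blast
    qed
    then show ?case using polyhedron_add_line[OF insert.IH[OF insert.prems]] by simp
  qed simp
  then show ?thesis using B(2) by simp
qed

lemma polyhedron_locally_conic: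
  fixes P :: "'a::euclidean_space set"
  assumes "polyhedron P" "y \<in> P"
  obtains r where "r > 0"
    "\<And>z t. norm z < r \<Longrightarrow> t > 0 \<Longrightarrow> y + t *\<^sub>R z \<in> P \<Longrightarrow> y + z \<in> P"
proof -
  obtain F where F: "finite F" "P = {x. \<forall>(a, c) \<in> F. a \<bullet> x \<le> c}"
    using assms(1) unfolding polyhedron_iff_halfspaces by blast
  have "\<forall>\<^sub>F z in nhds 0. \<forall>p\<in>F. fst p \<bullet> y < snd p \<longrightarrow> fst p \<bullet> (y + z) < snd p"
    unfolding eventually_ball_finite_distrib[OF F(1)]
  proof
    fix p assume "p \<in> F"
    show "\<forall>\<^sub>F z in nhds 0. fst p \<bullet> y < snd p \<longrightarrow> fst p \<bullet> (y + z) < snd p"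
    proof (cases "fst p \<bullet> y < snd p")
      case True
      have "((\<lambda>z. fst p \<bullet> (y + z)) \<longlongrightarrow> fst p \<bullet> (y + 0)) (nhds 0)"
        by (intro tendsto_intros filterlim_ident)
      then show ?thesis using order_tendstoD(2) True by (auto elim!: eventually_mono)
    qed simp
  qed
  then obtain r where r: "r > 0"
    "\<And>z p. norm z < r \<Longrightarrow> p \<in> F \<Longrightarrow> fst p \<bullet> y < snd p \<Longrightarrow> fst p \<bullet> (y + z) < snd p"
    unfolding eventually_nhds_metric by (auto simp: dist_norm)
  have "y + z \<in> P" if z: "norm z < r" "t > 0" "y + t *\<^sub>R z \<in> P" for z t
  proof -
    have "fst p \<bullet> (y + z) \<le> snd p" if p: "p \<in> F" for p
    proof (cases "fst p \<bullet> y < snd p")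
      case True
      then show ?thesis using r(2)[OF z(1) p] by simp
    next
      case False
      then have eq: "fst p \<bullet> y = snd p" using assms(2) p unfolding F(2) by (force simp: split_beta)
      have "fst p \<bullet> (y + t *\<^sub>R z) \<le> snd p" using z(3) p unfolding F(2) by (force simp: split_beta)
      then have "t * (fst p \<bullet> z) \<le> 0" using eq by (simp add: inner_add_right)
      then have "fst p \<bullet> z \<le> 0" using z(2) by (simp add: mult_le_0_iff)
      then show ?thesis using eq by (simp add: inner_add_right)
    qed
    then show ?thesis unfolding F(2) by (auto simp: split_beta)
  qed
  then show ?thesis using that r(1) by blast
qed

text \<open>
  Near each of its points a polyhedron is a cone. So if from \<open>y\<close> one can start in every direction
  within a polyhedron that contains \<open>y\<close>, and finitely many polyhedra suffice, the lengths of these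
  starts are bounded away from 0.
\<close>

lemma interior_finite_Union_polyhedra:
  fixes \<P> :: "'a::euclidean_space set set"
  assumes "finite \<P>" "\<And>P. P \<in> \<P> \<Longrightarrow> polyhedron P"
    and "\<And>z. \<exists>P\<in>\<P>. y \<in> P \<and> (\<exists>t>0. y + t *\<^sub>R z \<in> P)"
  shows "y \<in> interior (\<Union>\<P>)"
proof -
  have "\<forall>P\<in>\<P>. \<exists>r>0. y \<in> P \<longrightarrow> (\<forall>z t. norm z < r \<longrightarrow> t > 0 \<longrightarrow> y + t *\<^sub>R z \<in> P \<longrightarrow> y + z \<in> P)"
  proof
    fix P assume P: "P \<in> \<P>"
    show "\<exists>r>0. y \<in> P \<longrightarrow> (\<forall>z t. norm z < r \<longrightarrow> t > 0 \<longrightarrow> y + t *\<^sub>R z \<in> P \<longrightarrow> y + z \<in> P)"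
    proof (cases "y \<in> P")
      case True
      then show ?thesis using polyhedron_locally_conic[OF assms(2)[OF P] True] by metis
    qed (auto intro: exI[of _ 1])
  qed
  from bchoice[OF this] obtain r where r: "\<forall>P\<in>\<P>. r P > 0 \<and>
      (y \<in> P \<longrightarrow> (\<forall>z t. norm z < r P \<longrightarrow> t > 0 \<longrightarrow> y + t *\<^sub>R z \<in> P \<longrightarrow> y + z \<in> P))" by blast
  define e where "e = Min (r ` \<P>)"
  have ne: "\<P> \<noteq> {}" using assms(3) by blast
  have e: "e > 0" using r assms(1) ne unfolding e_def by auto
  have "ball y e \<subseteq> \<Union>\<P>"
  proof
    fix x assume x: "x \<in> ball y e"
    obtain P t where P: "P \<in> \<P>" "y \<in> P" "t > 0" "y + t *\<^sub>R (x - y) \<in> P" using assms(3) by blast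
    have "e \<le> r P" unfolding e_def using assms(1) P(1) by auto
    then have "norm (x - y) < r P" using x by (simp add: dist_norm norm_minus_commute)
    then have "y + (x - y) \<in> P" using r P by blast
    then show "x \<in> \<Union>\<P>" using P(1) by auto
  qed
  then show ?thesis using e centre_in_ball interior_maximal open_ball by blast
qed

text \<open>The face in question is the intersection of all faces that contain \<open>x\<close>.\<close>

lemma exists_face_rel_interior:
  fixes P :: "'a::euclidean_space set"
  assumes "polyhedron P" "x \<in> P"
  obtains F where "F face_of P" "x \<in> rel_interior F"
proof -
  define \<F> where "\<F> = {F. F face_of P \<and> x \<in> F}"
  have cv: "convex P" using assms(1) by (rule polyhedron_imp_convex)
  have "P \<in> \<F>" unfolding \<F>_def using assms(2) face_of_refl[OF cv] by auto
  then have F: "\<Inter>\<F> face_of P" by (intro face_of_Inter) (auto simp: \<F>_def)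
  have xF: "x \<in> \<Inter>\<F>" by (auto simp: \<F>_def)
  have Fp: "polyhedron (\<Inter>\<F>)" using face_of_polyhedron_polyhedron[OF assms(1) F] .
  have "x \<in> rel_interior (\<Inter>\<F>)"
  proof (rule ccontr)
    assume "x \<notin> rel_interior (\<Inter>\<F>)"
    then have "x \<in> rel_frontier (\<Inter>\<F>)"
      using xF polyhedron_imp_closed[OF Fp] by (simp add: rel_frontier_def)
    then obtain G where G: "G face_of \<Inter>\<F>" "G \<noteq> \<Inter>\<F>" "x \<in> G"
      using rel_frontier_of_polyhedron_alt[OF Fp] by auto
    then have "G \<in> \<F>" unfolding \<F>_def using face_of_trans[OF G(1) F] by auto
    then show False using G face_of_imp_subset[OF G(1)] by blast
  qed
  then show ?thesis using that F by blast
qed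

lemma negligible_lower_aff_dim:
  fixes S :: "'a::euclidean_space set"
  assumes "aff_dim S < int DIM('a)"
  shows "negligible (affine hull S)"
proof -
  obtain a b where ab: "a \<noteq> 0" "S \<subseteq> {x. a \<bullet> x = b}"
    using aff_lowdim_subset_hyperplane[OF assms] by blast
  then have "affine hull S \<subseteq> {x. a \<bullet> x = b}" by (intro hull_minimal affine_hyperplane)
  then show ?thesis using negligible_hyperplane ab(1) negligible_subset by blast
qed

text \<open>
  Sets of codimension two do not separate: a generic segment from the interior of \<open>U\<close> to a point
  outside \<open>U\<close> would have to cross the frontier.
\<close>

lemma closed_eq_UNIV_if_frontier_codim_2:
  fixes U :: "'a::euclidean_space set"
  assumes U: "closed U" "interior U \<noteq> {}" and fin: "finite \<B>" and fr: "frontier U \<subseteq> \<Union>\<B>"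
    and dim: "\<And>B. B \<in> \<B> \<Longrightarrow> aff_dim B + 2 \<le> int DIM('a)"
  shows "U = UNIV"
proof (rule ccontr)
  assume "U \<noteq> UNIV"
  then have ne: "- U \<noteq> {}" by auto
  have avoid: "\<not> S \<subseteq> (\<Union>B\<in>\<B>. affine hull (A B))"
    if "open S" "S \<noteq> {}" "\<And>B. B \<in> \<B> \<Longrightarrow> aff_dim (A B) < int DIM('a)" for S :: "'a set" and A
  proof
    assume "S \<subseteq> (\<Union>B\<in>\<B>. affine hull (A B))"
    moreover have "negligible (\<Union>B\<in>\<B>. affine hull (A B))"
      using that(3) fin by (intro negligible_Union) (auto intro: negligible_lower_aff_dim)
    ultimately have "negligible S" using negligible_subset by blast
    then show False using open_not_negligible[OF that(1,2)] by blast
  qed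
  have "\<not> - U \<subseteq> (\<Union>B\<in>\<B>. affine hull B)"
    using avoid[of "- U" "\<lambda>B. B"] U(1) ne dim by force
  then obtain q where q: "q \<notin> U" "\<And>B. B \<in> \<B> \<Longrightarrow> q \<notin> affine hull B" by auto
  have "\<not> interior U \<subseteq> (\<Union>B\<in>\<B>. affine hull (insert q B))"
  proof (rule avoid)
    fix B assume "B \<in> \<B>"
    then show "aff_dim (insert q B) < int DIM('a)"
      using dim[of B] aff_dim_insert[of q B] by auto
  qed (use U in auto)
  then obtain p where p: "p \<in> interior U" "\<And>B. B \<in> \<B> \<Longrightarrow> p \<notin> affine hull (insert q B)" by auto
  have "closed_segment q p \<inter> frontier U \<noteq> {}"
    by (rule connected_Int_frontier)
       (use p(1) q(1) interior_subset in \<open>auto intro: ends_in_segment\<close>)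
  then obtain r B where r: "r \<in> closed_segment q p" "r \<in> B" "B \<in> \<B>" using fr by blast
  then obtain t where t: "r = (1 - t) *\<^sub>R q + t *\<^sub>R p" "0 \<le> t" "t \<le> 1" by (auto simp: in_segment)
  have "r \<noteq> q" using q(2)[OF r(3)] r(2) hull_inc by metis
  then have t0: "t \<noteq> 0" using t by auto
  have "(1 - 1 / t) *\<^sub>R q + (1 / t) *\<^sub>R r \<in> affine hull (insert q B)"
    by (rule mem_affine[OF affine_affine_hull]) (use r in \<open>auto intro: hull_inc\<close>)
  moreover have "(1 - 1 / t) *\<^sub>R q + (1 / t) *\<^sub>R r = p"
    unfolding t(1) using t0 by (simp add: algebra_simps flip: scaleR_add_left)
  ultimately show False using p(2)[OF r(3)] by simp
qed

section \<open>Stable intersection\<close>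

lemma displaced_limit_meets:
  assumes "displaced_limit v \<sigma> \<sigma>' \<noteq> {}"
  shows "\<forall>\<^sub>F t in at_right 0. \<exists>x\<in>\<sigma>. x - t *\<^sub>R v \<in> \<sigma>'"
proof -
  obtain x where "\<forall>e>0. \<forall>\<^sub>F t in at_right 0. \<sigma> \<inter> (\<lambda>x. x + t *\<^sub>R v) ` \<sigma>' \<inter> ball x e \<noteq> {}"
    using assms unfolding displaced_limit_def set_limit_def by auto
  then have "\<forall>\<^sub>F t in at_right 0. \<sigma> \<inter> (\<lambda>x. x + t *\<^sub>R v) ` \<sigma>' \<inter> ball x 1 \<noteq> {}" by simp
  then show ?thesis by eventually_elim force
qed

text \<open>
  By convexity, moving from a common point of \<open>\<sigma>\<close> and \<open>\<sigma>'\<close> towards a common point of \<open>\<sigma>\<close> and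
  \<open>\<sigma>' + t v\<close> passes through all \<open>\<sigma> \<inter> (\<sigma>' + \<epsilon> v)\<close> with \<open>\<epsilon> \<le> t\<close>. So a single coincidence decides
  the limit.
\<close>

lemma displaced_limit_eq_Int:
  assumes "closed \<sigma>" "closed \<sigma>'" "convex \<sigma>" "convex \<sigma>'"
    and t: "t > 0" "x \<in> \<sigma>" "x - t *\<^sub>R v \<in> \<sigma>'"
  shows "displaced_limit v \<sigma> \<sigma>' = \<sigma> \<inter> \<sigma>'"
proof
  show "displaced_limit v \<sigma> \<sigma>' \<subseteq> \<sigma> \<inter> \<sigma>'"
  proof
    fix y assume "y \<in> displaced_limit v \<sigma> \<sigma>'"
    then have y: "\<forall>\<^sub>F t in at_right 0. \<sigma> \<inter> (\<lambda>x. x + t *\<^sub>R v) ` \<sigma>' \<inter> ball y e \<noteq> {}" if "e > 0" for e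
      using that unfolding displaced_limit_def set_limit_def by auto
    have near: "\<exists>z\<in>\<sigma>. \<exists>z'\<in>\<sigma>'. dist z y < e \<and> dist z' y < e" if e: "e > 0" for e
    proof -
      have "((\<lambda>t. norm (t *\<^sub>R v)) \<longlongrightarrow> norm (0 *\<^sub>R v)) (at_right 0)" by (intro tendsto_intros)
      then have "\<forall>\<^sub>F t in at_right 0. norm (t *\<^sub>R v) < e / 2"
        using e by (intro order_tendstoD) auto
      moreover have "\<forall>\<^sub>F t in at_right 0. \<sigma> \<inter> (\<lambda>x. x + t *\<^sub>R v) ` \<sigma>' \<inter> ball y (e / 2) \<noteq> {}"
        using y[of "e / 2"] e by simp
      ultimately have "\<forall>\<^sub>F t in at_right 0. norm (t *\<^sub>R v) < e / 2 \<and>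
          \<sigma> \<inter> (\<lambda>x. x + t *\<^sub>R v) ` \<sigma>' \<inter> ball y (e / 2) \<noteq> {}" by eventually_elim simp
      then obtain t where t: "norm (t *\<^sub>R v) < e / 2"
          "\<sigma> \<inter> (\<lambda>x. x + t *\<^sub>R v) ` \<sigma>' \<inter> ball y (e / 2) \<noteq> {}"
        using eventually_happens trivial_limit_at_right_real by blast
      then obtain z where z: "z + t *\<^sub>R v \<in> \<sigma>" "z \<in> \<sigma>'" "dist (z + t *\<^sub>R v) y < e / 2"
        by (auto simp: dist_commute)
      have "dist z (z + t *\<^sub>R v) < e / 2" using t(1) by (simp add: dist_norm)
      then have "dist z y < e" using z(3) dist_triangle_half_r dist_commute by metis
      then show ?thesis using z e by (intro bexI[of _ "z + t *\<^sub>R v"] bexI[of _ z]) auto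
    qed
    have "y \<in> closure \<sigma>" "y \<in> closure \<sigma>'"
      unfolding closure_approachable using near by blast+
    then show "y \<in> \<sigma> \<inter> \<sigma>'" using assms by simp
  qed
  show "\<sigma> \<inter> \<sigma>' \<subseteq> displaced_limit v \<sigma> \<sigma>'"
  proof
    fix y assume y: "y \<in> \<sigma> \<inter> \<sigma>'"
    let ?p = "\<lambda>s. y + (s / t) *\<^sub>R (x - y)"
    have mem: "?p s \<in> \<sigma> \<inter> (\<lambda>x. x + s *\<^sub>R v) ` \<sigma>'" if s: "0 < s" "s < t" for s
    proof -
      have "?p s = (1 - s / t) *\<^sub>R y + (s / t) *\<^sub>R x" by (simp add: algebra_simps)
      then have "?p s \<in> \<sigma>" using s y t by (simp add: convexD_alt[OF assms(3)])
      moreover have "?p s - s *\<^sub>R v = (1 - s / t) *\<^sub>R y + (s / t) *\<^sub>R (x - t *\<^sub>R v)"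
        using s by (simp add: algebra_simps)
      then have "?p s - s *\<^sub>R v \<in> \<sigma>'" using s y t by (simp add: convexD_alt[OF assms(4)])
      ultimately show ?thesis by (auto intro!: image_eqI[of _ _ "?p s - s *\<^sub>R v"])
    qed
    have "\<forall>\<^sub>F s in at_right 0. \<sigma> \<inter> (\<lambda>x. x + s *\<^sub>R v) ` \<sigma>' \<inter> ball y e \<noteq> {}" if "e > 0" for e
    proof -
      have "((\<lambda>s. ?p s) \<longlongrightarrow> ?p 0) (at_right 0)" by (intro tendsto_intros) (use t in auto)
      then have "\<forall>\<^sub>F s in at_right 0. dist (?p s) y < e" using tendstoD[OF _ that] by fastforce
      moreover have "\<forall>\<^sub>F s in at_right 0. 0 < s \<and> s < t"
        using t(1) eventually_at_right_field by blast
      ultimately show ?thesis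
      proof eventually_elim
        case (elim s)
        then have "?p s \<in> ball y e" by (simp add: dist_commute)
        then show ?case using mem[of s] elim by blast
      qed
    qed
    then show "y \<in> displaced_limit v \<sigma> \<sigma>'" unfolding displaced_limit_def set_limit_def by blast
  qed
qed

text \<open>
  Common points of \<open>\<sigma>\<close> and \<open>\<sigma>' + \<epsilon> v\<close> for two different values of \<open>\<epsilon>\<close> express \<open>v\<close> as a
  combination of vectors parallel to \<open>\<sigma>\<close> and to \<open>\<sigma>'\<close>. For generic \<open>v\<close> this forces transversality.
\<close>

lemma displaced_limit_nonempty:
  assumes "closed \<sigma>" "closed \<sigma>'" "convex \<sigma>" "convex \<sigma>'" "displaced_limit v \<sigma> \<sigma>' \<noteq> {}"
  shows "displaced_limit v \<sigma> \<sigma>' = \<sigma> \<inter> \<sigma>'" and "v \<in> span (parallel_space \<sigma> \<union> parallel_space \<sigma>')"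
proof -
  have ev: "\<forall>\<^sub>F t in at_right 0. \<exists>x\<in>\<sigma>. x - t *\<^sub>R v \<in> \<sigma>'" by (rule displaced_limit_meets[OF assms(5)])
  then obtain T where T: "T > 0" "\<And>t. 0 < t \<Longrightarrow> t < T \<Longrightarrow> \<exists>x\<in>\<sigma>. x - t *\<^sub>R v \<in> \<sigma>'"
    unfolding eventually_at_right_field by auto
  obtain x where x: "x \<in> \<sigma>" "x - (T / 2) *\<^sub>R v \<in> \<sigma>'" using T(2)[of "T / 2"] T(1) by auto
  obtain y where y: "y \<in> \<sigma>" "y - (T / 4) *\<^sub>R v \<in> \<sigma>'" using T(2)[of "T / 4"] T(1) by auto
  show "displaced_limit v \<sigma> \<sigma>' = \<sigma> \<inter> \<sigma>'"
    using displaced_limit_eq_Int[OF assms(1-4) _ x] T(1) by simp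
  let ?S = "span (parallel_space \<sigma> \<union> parallel_space \<sigma>')"
  have "x - y \<in> ?S" "(x - (T / 2) *\<^sub>R v) - (y - (T / 4) *\<^sub>R v) \<in> ?S"
    using x y by (auto intro!: span_base diff_in_parallel_space)
  then have "(x - y) - ((x - (T / 2) *\<^sub>R v) - (y - (T / 4) *\<^sub>R v)) \<in> ?S" by (rule span_diff)
  moreover have "(x - y) - ((x - (T / 2) *\<^sub>R v) - (y - (T / 4) *\<^sub>R v)) = (T / 4) *\<^sub>R v"
    by (simp add: algebra_simps flip: scaleR_add_left)
  ultimately have "(4 / T) *\<^sub>R ((T / 4) *\<^sub>R v) \<in> ?S" by (metis span_scale)
  then show "v \<in> ?S" using T(1) by simp
qed

text \<open>
  A vector \<open>v\<close> that avoids all but one subspace \<open>W\<close> is moved in a direction \<open>w \<notin> W\<close>: each of the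
  other subspaces contains \<open>v + t w\<close> for at most one \<open>t\<close>.
\<close>

lemma subspace_avoid_finite_subspaces:
  fixes S :: "'a::real_vector set"
  assumes "subspace S" "finite \<W>" "\<And>W. W \<in> \<W> \<Longrightarrow> subspace W \<and> \<not> S \<subseteq> W"
  shows "\<exists>v\<in>S. \<forall>W\<in>\<W>. v \<notin> W"
  using assms(2,3)
proof (induction \<W>)
  case empty
  then show ?case using subspace_0[OF assms(1)] by auto
next
  case (insert W \<W>)
  then obtain v where v: "v \<in> S" "\<forall>W\<in>\<W>. v \<notin> W" by auto
  obtain w where w: "w \<in> S" "w \<notin> W" using insert.prems by auto
  show ?case
  proof (cases "v \<in> W")
    case False
    then show ?thesis using v by auto
  next
    case True
    let ?bad = "\<lambda>W. {t. t \<noteq> 0 \<and> v + t *\<^sub>R w \<in> W}"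
    have "finite (?bad V)" if V: "V \<in> \<W>" for V
    proof -
      have "subspace V" using insert.prems V by auto
      have eq: "s = t" if "s \<in> ?bad V" "t \<in> ?bad V" for s t
      proof (rule ccontr)
        assume "s \<noteq> t"
        have "t *\<^sub>R (v + s *\<^sub>R w) - s *\<^sub>R (v + t *\<^sub>R w) \<in> V"
          using that by (intro subspace_diff subspace_scale \<open>subspace V\<close>) auto
        then have "(t - s) *\<^sub>R v \<in> V" by (simp add: algebra_simps)
        then have "(1 / (t - s)) *\<^sub>R ((t - s) *\<^sub>R v) \<in> V" by (rule subspace_scale[OF \<open>subspace V\<close>])
        then show False using \<open>s \<noteq> t\<close> v(2) V by simp
      qed
      show ?thesis
      proof (cases "?bad V = {}")
        case False
        then obtain s where "s \<in> ?bad V" by blast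
        then have "?bad V \<subseteq> {s}" using eq by blast
        then show ?thesis by (rule finite_subset) simp
      qed (simp only: finite.emptyI)
    qed
    then have "finite (insert 0 (\<Union>V\<in>\<W>. ?bad V))" using insert.hyps by auto
    then obtain t :: real where t: "t \<notin> insert 0 (\<Union>V\<in>\<W>. ?bad V)"
      using ex_new_if_finite[OF infinite_UNIV_char_0] by blast
    have "v + t *\<^sub>R w \<notin> W"
    proof
      assume *: "v + t *\<^sub>R w \<in> W"
      have W: "subspace W" using insert.prems by auto
      have "(v + t *\<^sub>R w) - v \<in> W" by (rule subspace_diff[OF W * True])
      then have "t *\<^sub>R w \<in> W" by simp
      then have "(1 / t) *\<^sub>R (t *\<^sub>R w) \<in> W" by (rule subspace_scale[OF W])
      then show False using t w by simp
    qed
    moreover have "v + t *\<^sub>R w \<in> S" using v w by (intro subspace_add[OF assms(1)] subspace_scale[OF assms(1)])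
    ultimately show ?thesis using t by auto
  qed
qed

lemma subspace_coord_space: "subspace (coord_space J)"
  unfolding coord_space_def subspace_def by auto

lemma coord_space_UNIV [simp]: "coord_space UNIV = UNIV"
  unfolding coord_space_def by auto

lemma generic_displacement_some:
  assumes "finite (cells X)" "finite (cells Y)"
    and "\<And>\<sigma>. \<sigma> \<in> cells X \<Longrightarrow> \<sigma> \<subseteq> coord_space J" "\<And>\<sigma>. \<sigma> \<in> cells Y \<Longrightarrow> \<sigma> \<subseteq> coord_space J"
  shows "generic_displacement J X Y (SOME v. generic_displacement J X Y v)"
proof (rule someI_ex)
  have par: "parallel_space \<sigma> \<subseteq> coord_space J" if "\<sigma> \<subseteq> coord_space J" for \<sigma>
    using that subspace_coord_space[of J]
    by (intro parallel_space_subset_subspace) (auto intro: subspace_diff)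
  let ?\<W> = "{W \<in> (\<lambda>(\<sigma>, \<sigma>'). span (parallel_space \<sigma> \<union> parallel_space \<sigma>')) ` (cells X \<times> cells Y).
              W \<noteq> coord_space J}"
  have "\<exists>v\<in>coord_space J. \<forall>W\<in>?\<W>. v \<notin> W"
  proof (rule subspace_avoid_finite_subspaces)
    show "finite ?\<W>" using assms(1,2) by simp
    fix W assume W: "W \<in> ?\<W>"
    then obtain \<sigma> \<sigma>' where \<sigma>: "\<sigma> \<in> cells X" "\<sigma>' \<in> cells Y"
        "W = span (parallel_space \<sigma> \<union> parallel_space \<sigma>')" by auto
    moreover have "span (parallel_space \<sigma> \<union> parallel_space \<sigma>') \<subseteq> coord_space J"
      using par assms(3,4) \<sigma>(1,2) by (intro span_minimal subspace_coord_space) blast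
    ultimately show "subspace W \<and> \<not> coord_space J \<subseteq> W" using W by auto
  qed (rule subspace_coord_space)
  then show "\<exists>v. generic_displacement J X Y v"
    unfolding generic_displacement_def by blast
qed

lemma stable_intersection_cells:
  assumes "finite (cells X)" "finite (cells Y)"
    and X: "\<And>\<sigma>. \<sigma> \<in> cells X \<Longrightarrow> rational_polyhedron J \<sigma>"
    and Y: "\<And>\<sigma>. \<sigma> \<in> cells Y \<Longrightarrow> rational_polyhedron J \<sigma>"
    and \<sigma>: "\<sigma> \<in> cells X" "\<sigma>' \<in> cells Y"
      "displaced_limit (SOME v. generic_displacement J X Y v) \<sigma> \<sigma>' \<noteq> {}"
  shows "displaced_limit (SOME v. generic_displacement J X Y v) \<sigma> \<sigma>' = \<sigma> \<inter> \<sigma>'"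
    and "span (parallel_space \<sigma> \<union> parallel_space \<sigma>') = coord_space J"
proof -
  have sub: "\<sigma> \<subseteq> coord_space J" if "rational_polyhedron J \<sigma>" for \<sigma>
    using that unfolding rational_polyhedron_def by auto
  let ?v = "SOME v. generic_displacement J X Y v"
  have gen: "generic_displacement J X Y ?v"
    by (intro generic_displacement_some assms(1,2) sub X Y)
  have poly: "polyhedron \<sigma>" "polyhedron \<sigma>'"
    using X Y \<sigma> rational_polyhedron_imp_polyhedron by blast+
  note * = displaced_limit_nonempty[OF polyhedron_imp_closed[OF poly(1)] polyhedron_imp_closed[OF poly(2)]
      polyhedron_imp_convex[OF poly(1)] polyhedron_imp_convex[OF poly(2)] \<sigma>(3)]
  show "displaced_limit ?v \<sigma> \<sigma>' = \<sigma> \<inter> \<sigma>'" by (rule *)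
  show "span (parallel_space \<sigma> \<union> parallel_space \<sigma>') = coord_space J"
    using gen *(2) \<sigma>(1,2) unfolding generic_displacement_def by blast
qed

lemma stable_intersection_cellE:
  assumes "finite (cells X)" "finite (cells Y)"
    and X: "\<And>\<sigma>. \<sigma> \<in> cells X \<Longrightarrow> rational_polyhedron J \<sigma>"
    and Y: "\<And>\<sigma>. \<sigma> \<in> cells Y \<Longrightarrow> rational_polyhedron J \<sigma>"
    and L: "L \<in> cells (stable_intersection J X Y)"
  obtains \<sigma> \<sigma>' where "\<sigma> \<in> cells X" "\<sigma>' \<in> cells Y" "L = \<sigma> \<inter> \<sigma>'" "L \<noteq> {}"
    "L = displaced_limit (SOME v. generic_displacement J X Y v) \<sigma> \<sigma>'"
    "span (parallel_space \<sigma> \<union> parallel_space \<sigma>') = coord_space J"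
proof -
  obtain \<sigma> \<sigma>' where \<sigma>: "\<sigma> \<in> cells X" "\<sigma>' \<in> cells Y" "L \<noteq> {}"
      "L = displaced_limit (SOME v. generic_displacement J X Y v) \<sigma> \<sigma>'"
    using L unfolding stable_intersection_def displaced_intersection_def by auto
  note * = stable_intersection_cells[OF assms(1-4) \<sigma>(1,2) \<sigma>(3)[unfolded \<sigma>(4)]]
  show ?thesis by (rule that[OF \<sigma>(1,2) _ \<sigma>(3,4) *(2)]) (use \<sigma>(4) *(1) in simp)
qed

lemma finite_cells_stable_intersection:
  assumes "finite (cells X)" "finite (cells Y)"
  shows "finite (cells (stable_intersection J X Y))"
proof -
  let ?v = "SOME v. generic_displacement J X Y v"
  have "cells (stable_intersection J X Y) \<subseteq> (\<lambda>(\<sigma>, \<sigma>'). displaced_limit ?v \<sigma> \<sigma>') ` (cells X \<times> cells Y)"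
    unfolding stable_intersection_def displaced_intersection_def by auto
  then show ?thesis using assms finite_subset by blast
qed

lemma finite_bounded_integral:
  "finite {x :: real^'n::finite. (\<forall>j. x $ j \<in> \<int>) \<and> norm x \<le> R}"
proof -
  have "{x :: real^'n. (\<forall>j. x $ j \<in> \<int>) \<and> norm x \<le> R}
      \<subseteq> (\<lambda>f. \<chi> j. real_of_int (f j)) ` (UNIV \<rightarrow>\<^sub>E {- \<lceil>R\<rceil>..\<lceil>R\<rceil>})"
  proof
    fix x :: "real^'n" assume x: "x \<in> {x. (\<forall>j. x $ j \<in> \<int>) \<and> norm x \<le> R}"
    have "\<lfloor>x $ j\<rfloor> \<in> {- \<lceil>R\<rceil>..\<lceil>R\<rceil>}" for j
    proof -
      have "\<bar>x $ j\<bar> \<le> R" using x component_le_norm_cart[of x j] by simp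
      then show ?thesis by (simp add: abs_le_iff) linarith
    qed
    moreover have "x = (\<chi> j. real_of_int \<lfloor>x $ j\<rfloor>)" using x by (simp add: vec_eq_iff of_int_floor_cancel)
    ultimately show "x \<in> (\<lambda>f. \<chi> j. real_of_int (f j)) ` (UNIV \<rightarrow>\<^sub>E {- \<lceil>R\<rceil>..\<lceil>R\<rceil>})"
      by (intro image_eqI[of _ _ "\<lambda>j. \<lfloor>x $ j\<rfloor>"]) auto
  qed
  moreover have "finite (UNIV \<rightarrow>\<^sub>E {- \<lceil>R\<rceil>..\<lceil>R\<rceil>} :: ('n \<Rightarrow> int) set)"
    by (intro finite_PiE) auto
  ultimately show ?thesis using finite_subset by blast
qed

text \<open>
  A spanning subgroup \<open>M\<close> of the lattice has finite index because each coset has a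
  representative in the bounded parallelepiped spanned by a basis taken from \<open>M\<close>.
\<close>

lemma subgroup_index_pos:
  fixes M :: "(real^'n::finite) set"
  assumes sub: "M \<subseteq> coord_lattice UNIV" and span: "span M = UNIV"
    and add: "\<And>x y. x \<in> M \<Longrightarrow> y \<in> M \<Longrightarrow> x + y \<in> M" and neg: "\<And>x. x \<in> M \<Longrightarrow> - x \<in> M" and 0: "0 \<in> M"
  shows "0 < subgroup_index (coord_lattice UNIV) M"
proof -
  let ?A = "coord_lattice (UNIV :: 'n set)"
  let ?r = "{(x, y). x \<in> ?A \<and> y \<in> ?A \<and> y - x \<in> M}"
  obtain B where B: "B \<subseteq> M" "independent B" "M \<subseteq> span B"
    using maximal_independent_subset by blast
  have spanB: "span B = UNIV" using span_mono[OF B(3)] span by (simp only: span_span) blast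
  have finB: "finite B" using B(2) independent_imp_finite by blast
  define R where "R = (\<Sum>w\<in>B. norm w)"
  have A_diff: "x - y \<in> ?A" if "x \<in> ?A" "y \<in> ?A" for x y
    using that unfolding coord_lattice_def by auto
  have nat_mult: "real k *\<^sub>R w \<in> M" if "w \<in> M" for w and k :: nat
    by (induction k) (auto simp: 0 scaleR_left_distrib intro: add that)
  have int_mult: "of_int k *\<^sub>R w \<in> M" if "w \<in> M" for w and k :: int
    using nat_mult[OF that, of "nat k"] neg[OF nat_mult[OF that, of "nat (- k)"]]
    by (cases "k \<ge> 0") auto
  have sumM: "(\<Sum>w\<in>C. f w) \<in> M" if "finite C" "\<And>w. w \<in> C \<Longrightarrow> f w \<in> M" for f :: "_ \<Rightarrow> real^'n" and C :: "(real^'n) set"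
    using that by (induction C) (auto simp: 0 add)
  have rep: "\<exists>z\<in>?A. norm z \<le> R \<and> x - z \<in> M" if x: "x \<in> ?A" for x
  proof -
    have "x \<in> span B" using spanB by simp
    then obtain c where c: "x = (\<Sum>w\<in>B. c w *\<^sub>R w)" using span_finite[OF finB] by auto
    let ?m = "\<Sum>w\<in>B. of_int \<lfloor>c w\<rfloor> *\<^sub>R w"
    have m: "?m \<in> M" using B(1) by (intro sumM finB int_mult) auto
    have "x - ?m = (\<Sum>w\<in>B. (c w - of_int \<lfloor>c w\<rfloor>) *\<^sub>R w)"
      unfolding c by (simp add: sum_subtractf scaleR_diff_left)
    also have "norm \<dots> \<le> (\<Sum>w\<in>B. norm ((c w - of_int \<lfloor>c w\<rfloor>) *\<^sub>R w))" by (rule norm_sum)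
    also have "\<dots> \<le> R" unfolding R_def
    proof (rule sum_mono)
      fix w
      have "\<bar>c w - of_int \<lfloor>c w\<rfloor>\<bar> \<le> 1" by linarith
      then have "\<bar>c w - of_int \<lfloor>c w\<rfloor>\<bar> * norm w \<le> 1 * norm w" by (intro mult_right_mono) auto
      then show "norm ((c w - of_int \<lfloor>c w\<rfloor>) *\<^sub>R w) \<le> norm w" by simp
    qed
    finally have "norm (x - ?m) \<le> R" .
    then show ?thesis using m A_diff[OF x] sub by (intro bexI[of _ "x - ?m"]) auto
  qed
  have "equiv ?A ?r"
  proof (rule equivI)
    show "refl_on ?A ?r" using 0 by (auto simp: refl_on_def)
    show "sym ?r" unfolding sym_def using neg by fastforce
    show "trans ?r" unfolding trans_def
    proof clarify
      fix x y z assume "y - x \<in> M" "z - y \<in> M"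
      then show "z - x \<in> M" using add[of "z - y" "y - x"] by simp
    qed
  qed auto
  then have "?A // ?r \<subseteq> (\<lambda>z. ?r `` {z}) ` {z. (\<forall>j. z $ j \<in> \<int>) \<and> norm z \<le> R}"
  proof -
    assume eq: "equiv ?A ?r"
    show ?thesis
    proof
      fix X assume "X \<in> ?A // ?r"
      then obtain x where x: "x \<in> ?A" "X = ?r `` {x}" by (auto elim: quotientE)
      obtain z where z: "z \<in> ?A" "norm z \<le> R" "x - z \<in> M" using rep[OF x(1)] by auto
      then have "(z, x) \<in> ?r" using x(1) by auto
      then have "X = ?r `` {z}" using equiv_class_eq[OF eq, of z x] x(2) by blast
      then show "X \<in> (\<lambda>z. ?r `` {z}) ` {z. (\<forall>j. z $ j \<in> \<int>) \<and> norm z \<le> R}"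
        using z unfolding coord_lattice_def by auto
    qed
  qed
  then have "finite (?A // ?r)" using finite_bounded_integral finite_subset by blast
  moreover have "0 \<in> ?A" using sub 0 by auto
  then have "?A // ?r \<noteq> {}" by (auto simp: quotient_def)
  ultimately show ?thesis unfolding subgroup_index_def by (simp add: card_gt_0_iff)
qed

lemma cell_index_pos:
  assumes "rational_polyhedron J \<sigma>" "rational_polyhedron J' \<sigma>'" "\<sigma> \<noteq> {}" "\<sigma>' \<noteq> {}"
    and "span (parallel_space \<sigma> \<union> parallel_space \<sigma>') = UNIV"
  shows "0 < cell_index UNIV \<sigma> \<sigma>'"
  unfolding cell_index_def
proof (rule subgroup_index_pos)
  have lat: "0 \<in> parallel_lattice \<sigma>" "x \<in> parallel_lattice \<sigma> \<Longrightarrow> y \<in> parallel_lattice \<sigma> \<Longrightarrow> x + y \<in> parallel_lattice \<sigma>"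
    "x \<in> parallel_lattice \<sigma> \<Longrightarrow> - x \<in> parallel_lattice \<sigma>" for x y and \<sigma> :: "(real^'n) set"
    unfolding parallel_lattice_def
    using subspace_0[OF subspace_parallel_space, of \<sigma>] subspace_add[OF subspace_parallel_space, of x \<sigma> y]
      subspace_neg[OF subspace_parallel_space, of x \<sigma>] by auto
  let ?M = "{x + y | x y. x \<in> parallel_lattice \<sigma> \<and> y \<in> parallel_lattice \<sigma>'}"
  show "?M \<subseteq> coord_lattice UNIV"
    unfolding coord_lattice_def parallel_lattice_def by auto
  have "parallel_lattice \<sigma> \<subseteq> ?M" "parallel_lattice \<sigma>' \<subseteq> ?M"
    using lat(1) by force+
  then have "parallel_space \<sigma> \<union> parallel_space \<sigma>' \<subseteq> span ?M"
    using span_mono span_parallel_lattice[OF assms(1,3)] span_parallel_lattice[OF assms(2,4)] by blast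
  then have "span (parallel_space \<sigma> \<union> parallel_space \<sigma>') \<subseteq> span ?M"
    by (intro span_minimal) auto
  then show "span ?M = UNIV" using assms(5) by auto
  show "x + y \<in> ?M" if xy: "x \<in> ?M" "y \<in> ?M" for x y
  proof -
    obtain a b c d where *: "x = a + b" "y = c + d" "a \<in> parallel_lattice \<sigma>" "b \<in> parallel_lattice \<sigma>'"
      "c \<in> parallel_lattice \<sigma>" "d \<in> parallel_lattice \<sigma>'" using xy by blast
    then have "x + y = (a + c) + (b + d)" by simp
    then show ?thesis using * lat(2) by blast
  qed
  show "- x \<in> ?M" if x: "x \<in> ?M" for x
  proof -
    obtain a b where *: "x = a + b" "a \<in> parallel_lattice \<sigma>" "b \<in> parallel_lattice \<sigma>'" using x by blast
    then have "- x = - a + - b" by simp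
    then show ?thesis using * lat(3) by blast
  qed
  show "0 \<in> ?M" using lat(1) by force
qed

section \<open>Translations with a common point\<close>

text \<open>
  The translations by \<open>y\<close> for which the sets \<open>c s + y\<^sub>s\<close> have a common point. All sets are translated
  independently, so these \<open>y\<close> form a subset of one vector space, in which it makes sense to speak of
  generic translations. The set is the sum of the diagonal and of the product of the \<open>- c s\<close>. Applied
  to linear spaces it describes transversality: they are transversal if it is everything.
\<close>

definition meeting :: "('k::finite \<Rightarrow> (real^'n::finite) set) \<Rightarrow> (real^'n^'k) set" where
  "meeting c = {y. \<exists>x. \<forall>s. x - y $ s \<in> c s}"

lemma meeting_mono: "(\<And>s. c s \<subseteq> c' s) \<Longrightarrow> meeting c \<subseteq> meeting c'"
  unfolding meeting_def by blast

lemma meeting_eq_diagonal_plus: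
  "meeting c = {y. \<exists>k\<in>range (\<lambda>x. \<chi> s. x). y - k \<in> (\<Inter>s. (\<lambda>z. - (z $ s)) -` c s)}"
  unfolding meeting_def by (auto simp: algebra_simps)

lemma linear_diagonal: "linear (\<lambda>x :: real^'n::finite. (\<chi> s. x) :: real^'n^'k::finite)"
  by (intro linearI) (auto simp: vec_eq_iff)

lemma polyhedron_meeting:
  fixes c :: "'k::finite \<Rightarrow> (real^'n::finite) set"
  assumes "\<And>s. polyhedron (c s)"
  shows "polyhedron (meeting c)"
  unfolding meeting_eq_diagonal_plus
proof (rule polyhedron_add_subspace)
  have lin: "linear (\<lambda>z :: real^'n^'k. - (z $ s))" for s
    by (intro linearI) auto
  show "polyhedron (\<Inter>s. (\<lambda>z. - (z $ s)) -` c s)"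
    using polyhedron_linear_vimage[OF lin assms] by (intro polyhedron_Inter) auto
  show "subspace (range (\<lambda>x :: real^'n. (\<chi> s. x) :: real^'n^'k))"
    by (rule linear_subspace_image[OF linear_diagonal subspace_UNIV])
qed

lemma subspace_meeting:
  assumes "\<And>s. subspace (K s)"
  shows "subspace (meeting K)"
proof (rule subspaceI)
  show "0 \<in> meeting K" unfolding meeting_def using subspace_0[OF assms] by (auto intro: exI[of _ 0])
next
  fix y z assume "y \<in> meeting K" "z \<in> meeting K"
  then obtain a b where ab: "\<And>s. a - y $ s \<in> K s" "\<And>s. b - z $ s \<in> K s" unfolding meeting_def by auto
  have "(a + b) - (y + z) $ s \<in> K s" for s
    using subspace_add[OF assms ab(1)[of s] ab(2)[of s]] by (simp add: algebra_simps)
  then show "y + z \<in> meeting K" unfolding meeting_def by blast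
next
  fix t y assume "y \<in> meeting K"
  then obtain a where a: "\<And>s. a - y $ s \<in> K s" unfolding meeting_def by auto
  have "t *\<^sub>R a - (t *\<^sub>R y) $ s \<in> K s" for s
    using subspace_scale[OF assms a[of s], of t] by (simp add: algebra_simps)
  then show "t *\<^sub>R y \<in> meeting K" unfolding meeting_def by blast
qed

lemma diff_in_meeting:
  assumes "y \<in> meeting c" "z \<in> meeting c"
  shows "y - z \<in> meeting (\<lambda>s. parallel_space (c s))"
proof -
  obtain a b where ab: "\<And>s. a - y $ s \<in> c s" "\<And>s. b - z $ s \<in> c s"
    using assms unfolding meeting_def by auto
  have "(a - b) - (y - z) $ s \<in> parallel_space (c s)" for s
    using diff_in_parallel_space[OF ab(1)[of s] ab(2)[of s]] by (simp add: algebra_simps)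
  then show ?thesis unfolding meeting_def by blast
qed

lemma dim_sum_le:
  fixes A B :: "'a::euclidean_space set"
  assumes "subspace A" "subspace B"
  shows "dim {x + y | x y. x \<in> A \<and> y \<in> B} \<le> dim A + dim B"
  using dim_sums_Int[OF assms] by linarith

lemma dim_product_le:
  fixes K :: "'k::finite \<Rightarrow> (real^'n::finite) set"
  assumes K: "\<And>s. subspace (K s)"
  shows "dim {w :: real^'n^'k. \<forall>s. w $ s \<in> K s} \<le> (\<Sum>s\<in>UNIV. dim (K s))"
proof -
  define W where "W S = {w :: real^'n^'k. (\<forall>s. w $ s \<in> K s) \<and> (\<forall>s. s \<notin> S \<longrightarrow> w $ s = 0)}" for S
  have W: "subspace (W S)" for S
    unfolding W_def using K by (auto simp: subspace_def)
  have lin: "linear (axis s :: real^'n \<Rightarrow> real^'n^'k)" for s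
    by (intro linearI) (auto simp: vec_eq_iff axis_def)
  have "dim (W S) \<le> (\<Sum>s\<in>S. dim (K s))" if "finite S" for S
    using that
  proof (induction S)
    case empty
    have "W {} \<subseteq> {0}" unfolding W_def by (auto simp: vec_eq_iff)
    then have "dim (W {}) \<le> dim {0 :: real^'n^'k}" by (rule dim_subset)
    then show ?case by simp
  next
    case (insert s S)
    have "W (insert s S) \<subseteq> {x + y | x y. x \<in> axis s ` K s \<and> y \<in> W S}"
    proof
      fix w assume w: "w \<in> W (insert s S)"
      let ?y = "(\<chi> t. if t = s then 0 else w $ t) :: real^'n^'k"
      have "w = axis s (w $ s) + ?y" by (auto simp: vec_eq_iff axis_def)
      moreover have "axis s (w $ s) \<in> axis s ` K s" using w unfolding W_def by auto
      moreover have "?y \<in> W S" using w subspace_0[OF K] insert.hyps unfolding W_def by auto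
      ultimately show "w \<in> {x + y | x y. x \<in> axis s ` K s \<and> y \<in> W S}" by blast
    qed
    then have "dim (W (insert s S)) \<le> dim {x + y | x y. x \<in> axis s ` K s \<and> y \<in> W S}"
      by (rule dim_subset)
    also have "\<dots> \<le> dim ((axis s :: _ \<Rightarrow> real^'n^'k) ` K s) + dim (W S)"
      by (intro dim_sum_le linear_subspace_image lin K W)
    also have "\<dots> \<le> dim (K s) + (\<Sum>s\<in>S. dim (K s))"
      using insert.IH dim_image_le[OF lin, of s "K s"] by (intro add_mono)
    finally show ?case using insert.hyps by simp
  qed
  from this[of UNIV] show ?thesis unfolding W_def by simp
qed

lemma dim_meeting_le:
  fixes K :: "'k::finite \<Rightarrow> (real^'n::finite) set"
  assumes K: "\<And>s. subspace (K s)"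
  shows "dim (meeting K) \<le> CARD('n) + (\<Sum>s\<in>UNIV. dim (K s))"
proof -
  let ?D = "range (\<lambda>x :: real^'n. (\<chi> s. x) :: real^'n^'k)"
  let ?W = "{w :: real^'n^'k. \<forall>s. w $ s \<in> K s}"
  have W: "subspace ?W" using K by (auto simp: subspace_def)
  have "meeting K \<subseteq> {x + y | x y. x \<in> ?D \<and> y \<in> ?W}"
  proof
    fix y assume "y \<in> meeting K"
    then obtain x where x: "\<And>s. x - y $ s \<in> K s" unfolding meeting_def by auto
    have "y = (\<chi> s. x) + (\<chi> s. y $ s - x)" by (simp add: vec_eq_iff)
    moreover have "(\<chi> s. y $ s - x) \<in> ?W"
      using subspace_neg[OF K x] by simp
    ultimately show "y \<in> {x + y | x y. x \<in> ?D \<and> y \<in> ?W}" by blast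
  qed
  then have "dim (meeting K) \<le> dim {x + y | x y. x \<in> ?D \<and> y \<in> ?W}" by (rule dim_subset)
  also have "\<dots> \<le> dim ?D + dim ?W"
    by (rule dim_sum_le[OF linear_subspace_image[OF linear_diagonal subspace_UNIV] W])
  also have "dim ?D \<le> CARD('n)"
    using dim_image_le[OF linear_diagonal, of UNIV] by simp
  also have "dim ?W \<le> (\<Sum>s\<in>UNIV. dim (K s))" by (rule dim_product_le[OF K])
  finally show ?thesis by simp
qed

lemma aff_dim_meeting_le:
  fixes c :: "'k::finite \<Rightarrow> (real^'n::finite) set"
  shows "aff_dim (meeting c) \<le> int (dim (meeting (\<lambda>s. parallel_space (c s))))"
proof (cases "meeting c = {}")
  case False
  then obtain y where y: "y \<in> meeting c" by blast
  have "meeting c \<subseteq> (+) y ` meeting (\<lambda>s. parallel_space (c s))"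
  proof
    fix z assume "z \<in> meeting c"
    from diff_in_meeting[OF this y] show "z \<in> (+) y ` meeting (\<lambda>s. parallel_space (c s))"
      by (intro image_eqI[of _ _ "z - y"]) auto
  qed
  from aff_dim_subset[OF this] show ?thesis
    by (simp add: aff_dim_translation_eq aff_dim_subspace subspace_meeting)
qed simp

lemma dim_meeting_parallel_le:
  fixes c :: "'k::finite \<Rightarrow> (real^'n::finite) set"
  assumes "\<And>s. c s \<noteq> {}"
  shows "int (dim (meeting (\<lambda>s. parallel_space (c s)))) \<le> int CARD('n) + (\<Sum>s\<in>UNIV. aff_dim (c s))"
  using dim_meeting_le[of "\<lambda>s. parallel_space (c s)"] 
  by (simp add: aff_dim_eq_dim_parallel_space[OF assms] flip: of_nat_sum)

lemma finite_choice_functions: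
  assumes "\<And>s :: 'k::finite. finite (X s)"
  shows "finite {c. \<forall>s. c s \<in> X s}"
proof -
  have "{c. \<forall>s. c s \<in> X s} = PiE UNIV X" by (auto simp: PiE_def)
  then show ?thesis using assms by (simp add: finite_PiE)
qed

section \<open>Weakly balanced complexes\<close>

text \<open>
  All that is used of the balancing condition: a linear functional which is constant on a cell
  \<open>\<tau>\<close> of codimension 1, but not on all facets around \<open>\<tau>\<close>, takes smaller (and, by symmetry, larger)
  values on some of them. The weights enter through their positivity only.
\<close>

definition weakly_balanced_complex :: "int \<Rightarrow> (real^'n::finite) set set \<Rightarrow> bool" where
  "weakly_balanced_complex e \<C> \<longleftrightarrow>
     finite \<C> \<and> (\<forall>\<sigma>\<in>\<C>. polyhedron \<sigma> \<and> \<sigma> \<noteq> {} \<and> aff_dim \<sigma> \<le> e) \<and>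
     (\<forall>\<sigma>\<in>\<C>. \<forall>F. F face_of \<sigma> \<and> F \<noteq> {} \<longrightarrow> F \<in> \<C>) \<and>
     (\<forall>\<tau>\<in>\<C>. \<forall>\<sigma>\<in>\<C>. \<tau> \<subseteq> \<sigma> \<and> aff_dim \<tau> = e - 1 \<and> aff_dim \<sigma> = e \<longrightarrow>
        (\<forall>a c. (\<forall>x\<in>\<tau>. a \<bullet> x = c) \<and> (\<exists>y\<in>\<sigma>. a \<bullet> y \<noteq> c) \<longrightarrow>
           (\<exists>\<sigma>'\<in>\<C>. \<tau> \<subseteq> \<sigma>' \<and> aff_dim \<sigma>' = e \<and> (\<exists>y\<in>\<sigma>'. a \<bullet> y < c))))"

lemma eventually_at_right_rel_interior:
  assumes "x \<in> rel_interior F" "w \<in> parallel_space F"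
  shows "\<forall>\<^sub>F t in at_right 0. x + t *\<^sub>R w \<in> F"
proof -
  obtain e where e: "e > 0" "\<And>w. w \<in> parallel_space F \<Longrightarrow> norm w < e \<Longrightarrow> x + w \<in> F"
    using rel_interior_absorbs_parallel_space[OF assms(1)] by blast
  have "((\<lambda>t. norm (t *\<^sub>R w)) \<longlongrightarrow> norm (0 *\<^sub>R w)) (at_right 0)" by (intro tendsto_intros)
  then have "\<forall>\<^sub>F t in at_right 0. norm (t *\<^sub>R w) < e" using e(1) by (intro order_tendstoD) auto
  then show ?thesis
  proof eventually_elim
    case (elim t)
    show ?case by (rule e(2)[OF subspace_scale[OF subspace_parallel_space assms(2)] elim])
  qed
qed

text \<open>
  The displacement is the average of one by \<open>2 w\<close>, which stays in \<open>F\<close>, and one towards \<open>y\<close>, which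
  stays in \<open>G\<close>.
\<close>

lemma eventually_at_right_into_larger:
  assumes "convex G" "F \<subseteq> G" "x \<in> rel_interior F" "w \<in> parallel_space F" "y \<in> G" "r > 0"
  shows "\<forall>\<^sub>F t in at_right 0. x + t *\<^sub>R (w + r *\<^sub>R (y - x)) \<in> G"
proof -
  have x: "x \<in> G" using assms(2,3) rel_interior_subset by blast
  have "(2::real) *\<^sub>R w \<in> parallel_space F" by (rule subspace_scale[OF subspace_parallel_space assms(4)])
  then have "\<forall>\<^sub>F t in at_right 0. x + t *\<^sub>R (2 *\<^sub>R w) \<in> F"
    by (rule eventually_at_right_rel_interior[OF assms(3)])
  moreover have "\<forall>\<^sub>F t in at_right 0. 0 < t \<and> t < 1 / (2 * r)"
    unfolding eventually_at_right_field using assms(6) by (intro exI[of _ "1 / (2 * r)"]) auto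
  ultimately show ?thesis
  proof eventually_elim
    case (elim t)
    have "(2 * t * r) \<le> 1" using elim assms(6) by (simp add: field_simps)
    then have "(1 - 2 * t * r) *\<^sub>R x + (2 * t * r) *\<^sub>R y \<in> G"
      using elim assms(6) by (intro convexD_alt[OF assms(1) x assms(5)]) auto
    then have "(1 / 2) *\<^sub>R (x + t *\<^sub>R (2 *\<^sub>R w)) + (1 / 2) *\<^sub>R ((1 - 2 * t * r) *\<^sub>R x + (2 * t * r) *\<^sub>R y) \<in> G"
      by (rule convexD[OF assms(1) subsetD[OF assms(2) elim(1)]]) simp_all
    moreover have "(1 / 2) *\<^sub>R (x + t *\<^sub>R (2 *\<^sub>R w)) + (1 / 2) *\<^sub>R ((1 - 2 * t * r) *\<^sub>R x + (2 * t * r) *\<^sub>R y)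
        = x + t *\<^sub>R (w + r *\<^sub>R (y - x))"
    proof -
      have "x = (1 / 2) *\<^sub>R x + (1 / 2) *\<^sub>R x" by (simp flip: scaleR_add_left)
      then show ?thesis by (simp add: scaleR_add_right scaleR_diff_right scaleR_diff_left) 
    qed
    ultimately show ?case by simp
  qed
qed

lemma meeting_moves:
  fixes y z :: "real^'n::finite^'k::finite"
  assumes "\<And>s. \<forall>\<^sub>F t in at_right 0. (x - y $ s) + t *\<^sub>R (\<delta> - z $ s) \<in> c s"
  shows "\<exists>t>0. y + t *\<^sub>R z \<in> meeting c"
proof -
  have "\<forall>\<^sub>F t in at_right 0. \<forall>s. (x - y $ s) + t *\<^sub>R (\<delta> - z $ s) \<in> c s"
    using assms by (simp add: eventually_all_finite)
  moreover have "\<forall>\<^sub>F t in at_right (0::real). t > 0" by (simp add: eventually_at_right_less)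
  ultimately have "\<forall>\<^sub>F t in at_right 0. t > 0 \<and> (\<forall>s. (x - y $ s) + t *\<^sub>R (\<delta> - z $ s) \<in> c s)"
    by eventually_elim simp
  then obtain t where t: "t > 0" "\<And>s. (x - y $ s) + t *\<^sub>R (\<delta> - z $ s) \<in> c s"
    using eventually_happens trivial_limit_at_right_real by blast
  have "(x + t *\<^sub>R \<delta>) - (y + t *\<^sub>R z) $ s \<in> c s" for s
    using t(2)[of s] by (simp add: algebra_simps)
  then show ?thesis unfolding meeting_def using t(1) by blast
qed

text \<open>
  The numerical condition says that the codimensions of the members add up to the dimension of the
  ambient space, so that transversal common points are isolated.
\<close>

locale weakly_balanced_family =
  fixes X :: "'k::finite \<Rightarrow> (real^'n::finite) set set" and e :: "'k \<Rightarrow> int"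
  assumes wb: "\<And>s. weakly_balanced_complex (e s) (X s)"
    and codim: "(\<Sum>s\<in>UNIV. e s) + int CARD('n) = int (CARD('k) * CARD('n))"
begin

definition transversal :: "('k \<Rightarrow> (real^'n) set) set" where
  "transversal = {c. (\<forall>s. c s \<in> X s \<and> aff_dim (c s) = e s) \<and> meeting (\<lambda>s. parallel_space (c s)) = UNIV}"

lemma cell: "\<sigma> \<in> X s \<Longrightarrow> polyhedron \<sigma>" "\<sigma> \<in> X s \<Longrightarrow> \<sigma> \<noteq> {}" "\<sigma> \<in> X s \<Longrightarrow> aff_dim \<sigma> \<le> e s"
proof -
  have "\<forall>\<sigma>\<in>X s. polyhedron \<sigma> \<and> \<sigma> \<noteq> {} \<and> aff_dim \<sigma> \<le> e s"
    using wb[of s] unfolding weakly_balanced_complex_def by (elim conjE)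
  then show "\<sigma> \<in> X s \<Longrightarrow> polyhedron \<sigma>" "\<sigma> \<in> X s \<Longrightarrow> \<sigma> \<noteq> {}" "\<sigma> \<in> X s \<Longrightarrow> aff_dim \<sigma> \<le> e s"
    by simp_all
qed

lemma finite_X: "finite (X s)"
  using wb[of s] unfolding weakly_balanced_complex_def by (elim conjE)

lemma face: "\<sigma> \<in> X s \<Longrightarrow> F face_of \<sigma> \<Longrightarrow> F \<noteq> {} \<Longrightarrow> F \<in> X s"
proof -
  have "\<forall>\<sigma>\<in>X s. \<forall>F. F face_of \<sigma> \<and> F \<noteq> {} \<longrightarrow> F \<in> X s"
    using wb[of s] unfolding weakly_balanced_complex_def by (elim conjE)
  then show "\<sigma> \<in> X s \<Longrightarrow> F face_of \<sigma> \<Longrightarrow> F \<noteq> {} \<Longrightarrow> F \<in> X s" by simp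
qed

lemma crossing:
  assumes "\<tau> \<in> X s" "\<sigma> \<in> X s" "\<tau> \<subseteq> \<sigma>" "aff_dim \<tau> = e s - 1" "aff_dim \<sigma> = e s"
    and "\<And>x. x \<in> \<tau> \<Longrightarrow> a \<bullet> x = c" "y \<in> \<sigma>" "a \<bullet> y \<noteq> c"
  obtains \<sigma>' y' where "\<sigma>' \<in> X s" "\<tau> \<subseteq> \<sigma>'" "aff_dim \<sigma>' = e s" "y' \<in> \<sigma>'" "a \<bullet> y' < c"
proof -
  have "\<exists>\<sigma>'\<in>X s. \<tau> \<subseteq> \<sigma>' \<and> aff_dim \<sigma>' = e s \<and> (\<exists>y\<in>\<sigma>'. a \<bullet> y < c)"
  proof -
    have "\<forall>\<tau>\<in>X s. \<forall>\<sigma>\<in>X s. \<tau> \<subseteq> \<sigma> \<and> aff_dim \<tau> = e s - 1 \<and> aff_dim \<sigma> = e s \<longrightarrow>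
        (\<forall>a c. (\<forall>x\<in>\<tau>. a \<bullet> x = c) \<and> (\<exists>y\<in>\<sigma>. a \<bullet> y \<noteq> c) \<longrightarrow>
           (\<exists>\<sigma>'\<in>X s. \<tau> \<subseteq> \<sigma>' \<and> aff_dim \<sigma>' = e s \<and> (\<exists>y\<in>\<sigma>'. a \<bullet> y < c)))"
      using wb[of s] unfolding weakly_balanced_complex_def by (elim conjE)
    from this[rule_format, OF assms(1,2), of a c] show ?thesis using assms(3-8) by blast
  qed
  then show ?thesis using that by blast
qed

text \<open>
  Away from codimension two, a point common to the translates lies in the relative interior of
  all the cells, or on a wall: one cell is replaced by a face of codimension 1. On each side of
  the hyperplane spanned by the wall, balancing provides a facet that can replace the cell.
\<close>

lemma leave_in_every_direction:
  assumes c: "c \<in> transversal" and f: "\<And>s. f s face_of c s" "\<And>s. x - y $ s \<in> rel_interior (f s)"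
    and dim: "int (CARD('k) * CARD('n)) - 1 \<le> int (dim (meeting (\<lambda>s. parallel_space (f s))))"
  shows "\<exists>c'\<in>transversal. y \<in> meeting c' \<and> (\<exists>t>0. y + t *\<^sub>R z \<in> meeting c')"
proof -
  have cX: "\<And>s. c s \<in> X s" "\<And>s. aff_dim (c s) = e s" and cU: "meeting (\<lambda>s. parallel_space (c s)) = UNIV"
    using c unfolding transversal_def by auto
  have fne: "f s \<noteq> {}" for s using f(2)[of s] rel_interior_subset by fastforce
  have fc: "f s \<subseteq> c s" for s using face_of_imp_subset[OF f(1)] .
  have xf: "x - y $ s \<in> f s" for s using f(2) rel_interior_subset by blast
  have y: "y \<in> meeting c" unfolding meeting_def using xf fc by blast
  have fX: "f s \<in> X s" for s by (rule face[OF cX(1) f(1) fne])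
  have fdim: "aff_dim (f s) < e s" if "f s \<noteq> c s" for s
    using face_of_aff_dim_lt[OF polyhedron_imp_convex[OF cell(1)[OF cX(1)]] f(1) that] cX(2) by simp
  define H where "H = meeting (\<lambda>s. parallel_space (f s))"
  have H: "subspace H" unfolding H_def by (intro subspace_meeting subspace_parallel_space)
  have dimH: "int (dim H) \<le> int CARD('n) + (\<Sum>s\<in>UNIV. aff_dim (f s))"
    unfolding H_def by (rule dim_meeting_parallel_le[OF fne])
  have stay: ?thesis if z: "z \<in> H"
  proof -
    obtain \<delta> where \<delta>: "\<And>s. \<delta> - z $ s \<in> parallel_space (f s)"
      using z unfolding H_def meeting_def by auto
    have "\<forall>\<^sub>F t in at_right 0. (x - y $ s) + t *\<^sub>R (\<delta> - z $ s) \<in> c s" for s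
      using eventually_at_right_rel_interior[OF f(2) \<delta>, of s] by eventually_elim (use fc in auto)
    from meeting_moves[OF this] show ?thesis using c y by blast
  qed
  show ?thesis
  proof (cases "\<forall>s. f s = c s")
    case True
    then have "H = UNIV" using cU unfolding H_def by simp
    then show ?thesis using stay by simp
  next
    case False
    then obtain r where r: "f r \<noteq> c r" by blast
    \<comment> \<open>Counting dimensions: exactly one slot is deficient, and by one dimension only.\<close>
    define def where "def s = e s - aff_dim (f s)" for s
    have def0: "0 \<le> def s" for s unfolding def_def using cell(3)[OF fX] by simp
    have sum_def: "(\<Sum>s\<in>UNIV. def s) \<le> 1"
      using dim dimH codim unfolding def_def H_def by (simp add: sum_subtractf)
    have sum_r: "(\<Sum>s\<in>UNIV. def s) = def r + (\<Sum>s\<in>UNIV - {r}. def s)" by (simp add: sum.remove)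
    have def_r: "def r \<ge> 1" using fdim[OF r] unfolding def_def by simp
    have others: "f s = c s" if "s \<noteq> r" for s
    proof (rule ccontr)
      assume "f s \<noteq> c s"
      then have "def s \<ge> 1" using fdim unfolding def_def by fastforce
      moreover have "def s \<le> (\<Sum>s\<in>UNIV - {r}. def s)"
        using that def0 by (intro member_le_sum) auto
      ultimately show False using sum_def sum_r def_r by linarith
    qed
    have "(\<Sum>s\<in>UNIV - {r}. def s) \<ge> 0" using def0 by (intro sum_nonneg) auto
    then have def_r1: "def r = 1" "(\<Sum>s\<in>UNIV. def s) = 1" using sum_def sum_r def_r by linarith+
    then have "int (dim H) = int (CARD('k) * CARD('n)) - 1"
      using dimH codim dim unfolding def_def H_def by (simp add: sum_subtractf)
    then have "int (dim H + 1) = int (CARD('k) * CARD('n))" by simp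
    then have "dim H + 1 = CARD('k) * CARD('n)" by (simp only: of_nat_eq_iff)
    then have "dim H = DIM(real^'n^'k) - 1" by simp
    then obtain h where h: "h \<noteq> 0" "H = {z. h \<bullet> z = 0}"
      using dim_eq_hyperplane[of H] H by (auto simp: span_eq_iff[THEN iffD2])
    have h_axis: "h \<bullet> axis r v = h $ r \<bullet> v" for v by (simp add: inner_axis)
    let ?p = "x - y $ r"
    have h_f: "h $ r \<bullet> w = 0" if "w \<in> parallel_space (f r)" for w
    proof -
      have "0 - axis r (- w) $ s \<in> parallel_space (f s)" for s
        using that by (simp add: axis_def)
      then have "axis r (- w) \<in> H" unfolding H_def meeting_def by blast
      then show ?thesis using h(2) h_axis by simp
    qed
    have const: "h $ r \<bullet> v = h $ r \<bullet> ?p" if "v \<in> f r" for v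
      using h_f[OF diff_in_parallel_space[OF that xf]] by (simp add: inner_diff_right)
    \<comment> \<open>Otherwise \<open>h\<close> would vanish on all directions of the transversal cells, that is, everywhere.\<close>
    have nonconst: "\<exists>v\<in>c r. h $ r \<bullet> v \<noteq> h $ r \<bullet> ?p"
    proof (rule ccontr)
      assume "\<not> ?thesis"
      then have h_c: "h $ r \<bullet> u = 0" if "u \<in> parallel_space (c r)" for u
        using inner_eq_0_parallel_space[of "c r" "h $ r" "h $ r \<bullet> ?p" u] that by blast
      have "h \<bullet> z = 0" for z
      proof -
        obtain \<delta> where \<delta>: "\<And>s. \<delta> - z $ s \<in> parallel_space (c s)"
          using cU unfolding meeting_def by blast
        have "\<delta> - (z + axis r (\<delta> - z $ r)) $ s \<in> parallel_space (f s)" for s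
          using \<delta>[of s] others[of s] by (cases "s = r") (auto simp: axis_def)
        then have "z + axis r (\<delta> - z $ r) \<in> H" unfolding H_def meeting_def by blast
        then show ?thesis using h(2) h_axis h_c[OF \<delta>[of r]] by (simp add: inner_add_right)
      qed
      from this[of h] show False using h(1) by simp
    qed
    show ?thesis
    proof (cases "h \<bullet> z = 0")
      case True
      then show ?thesis using stay h(2) by simp
    next
      case False
      have fr: "aff_dim (f r) = e r - 1" using def_r1(1) unfolding def_def by simp
      obtain v where v: "v \<in> c r" "h $ r \<bullet> v \<noteq> h $ r \<bullet> ?p" using nonconst by blast
      obtain g u where g: "g \<in> X r" "f r \<subseteq> g" "aff_dim g = e r" "u \<in> g" "(h $ r \<bullet> (u - ?p)) * (h \<bullet> z) < 0"
      proof (cases "h \<bullet> z > 0")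
        case True
        obtain g u where "g \<in> X r" "f r \<subseteq> g" "aff_dim g = e r" "u \<in> g" "h $ r \<bullet> u < h $ r \<bullet> ?p"
          using crossing[OF fX cX(1) fc fr cX(2) const v] by blast
        then show ?thesis using that True by (auto simp: inner_diff_right mult_less_0_iff)
      next
        case neg: False
        have const': "- h $ r \<bullet> w = - (h $ r \<bullet> ?p)" if "w \<in> f r" for w
          using const[OF that] by simp
        have v': "- h $ r \<bullet> v \<noteq> - (h $ r \<bullet> ?p)" using v(2) by simp
        obtain g u where "g \<in> X r" "f r \<subseteq> g" "aff_dim g = e r" "u \<in> g" "- h $ r \<bullet> u < - (h $ r \<bullet> ?p)"
          using crossing[OF fX cX(1) fc fr cX(2) const' v(1) v'] by blast
        then show ?thesis using that neg False by (auto simp: inner_diff_right mult_less_0_iff)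
      qed
      \<comment> \<open>The facet \<open>g\<close> lies on the side of the wall to which \<open>z\<close> points. Moving slot \<open>r\<close> into \<open>g\<close> by
        the right amount accounts for \<open>h \<bullet> z\<close>; the rest of \<open>z\<close> is a motion along the wall.\<close>
      define \<rho> where "\<rho> = (h \<bullet> z) / - (h $ r \<bullet> (u - ?p))"
      have nz: "h $ r \<bullet> (u - ?p) \<noteq> 0" using g(5) by auto
      have \<rho>: "\<rho> > 0" unfolding \<rho>_def using g(5) by (auto simp: divide_less_0_iff mult_less_0_iff)
      define z' where "z' = axis r (- \<rho> *\<^sub>R (u - ?p))"
      have hz': "h \<bullet> z' = h \<bullet> z" unfolding z'_def h_axis \<rho>_def using nz by simp
      let ?c = "c(r := g)"
      have fc': "f s \<subseteq> ?c s" for s using fc g(2) by simp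
      have HU: "H \<subseteq> meeting (\<lambda>s. parallel_space (?c s))"
        unfolding H_def by (intro meeting_mono parallel_space_mono fc')
      have sub: "subspace (meeting (\<lambda>s. parallel_space (?c s)))"
        by (intro subspace_meeting subspace_parallel_space)
      have "u - ?p \<in> parallel_space g" using g(2,4) xf[of r] by (intro diff_in_parallel_space) auto
      then have "0 - z' $ s \<in> parallel_space (?c s)" for s
        unfolding z'_def using subspace_scale[OF subspace_parallel_space, of "u - ?p" g \<rho>]
        by (simp add: axis_def)
      then have z'U: "z' \<in> meeting (\<lambda>s. parallel_space (?c s))" unfolding meeting_def by blast
      have "\<zeta> \<in> meeting (\<lambda>s. parallel_space (?c s))" for \<zeta>
      proof -
        let ?q = "(h \<bullet> \<zeta>) / (h \<bullet> z)"
        have "h \<bullet> (\<zeta> - ?q *\<^sub>R z') = 0" using False hz' by (simp add: inner_diff_right)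
        then have "\<zeta> - ?q *\<^sub>R z' \<in> H" using h(2) by simp
        then have "(\<zeta> - ?q *\<^sub>R z') + ?q *\<^sub>R z' \<in> meeting (\<lambda>s. parallel_space (?c s))"
          using HU by (intro subspace_add[OF sub] subspace_scale[OF sub] z'U) auto
        then show ?thesis by simp
      qed
      then have c'T: "?c \<in> transversal"
        unfolding transversal_def using cX g by auto
      have y': "y \<in> meeting ?c" unfolding meeting_def using xf fc' by blast
      have "z - z' \<in> H" using h(2) hz' by (simp add: inner_diff_right)
      then obtain \<delta> where \<delta>: "\<And>s. \<delta> - (z - z') $ s \<in> parallel_space (f s)"
        unfolding H_def meeting_def by auto
      have "\<forall>\<^sub>F t in at_right 0. (x - y $ s) + t *\<^sub>R (\<delta> - z $ s) \<in> ?c s" for s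
      proof (cases "s = r")
        case True
        have eq: "\<delta> - z $ r = (\<delta> - (z - z') $ r) + \<rho> *\<^sub>R (u - ?p)"
          unfolding z'_def by (simp add: axis_def)
        show ?thesis
          unfolding True fun_upd_same eq
          by (rule eventually_at_right_into_larger[OF polyhedron_imp_convex[OF cell(1)[OF g(1)]] g(2) f(2) \<delta> g(4) \<rho>])
      next
        case False
        then have "\<delta> - z $ s \<in> parallel_space (f s)" using \<delta>[of s] unfolding z'_def by (simp add: axis_def)
        from eventually_at_right_rel_interior[OF f(2) this] show ?thesis
          by eventually_elim (rule subsetD[OF fc'])
      qed
      from meeting_moves[OF this] show ?thesis using c'T y' by blast
    qed
  qed
qed

lemma finite_transversal: "finite transversal"
  by (rule finite_subset[OF _ finite_choice_functions[of X, OF finite_X]]) (auto simp: transversal_def)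

lemma interior_point:
  assumes c: "c \<in> transversal" and f: "\<And>s. f s face_of c s" "\<And>s. x - y $ s \<in> rel_interior (f s)"
    and dim: "int (CARD('k) * CARD('n)) - 1 \<le> int (dim (meeting (\<lambda>s. parallel_space (f s))))"
  shows "y \<in> interior (\<Union>(meeting ` transversal))"
proof (rule interior_finite_Union_polyhedra)
  show "finite (meeting ` transversal)" using finite_transversal by simp
  show "polyhedron P" if "P \<in> meeting ` transversal" for P
    using that polyhedron_meeting cell(1) unfolding transversal_def by auto
  show "\<exists>P\<in>meeting ` transversal. y \<in> P \<and> (\<exists>t>0. y + t *\<^sub>R z \<in> P)" for z
    using leave_in_every_direction[OF assms, of z] by blast
qed

text \<open>
  The frontier of the union of all transversal meetings lies in finitely many meetings of codimension
  at least two, by the previous lemma, so there is no frontier at all.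
\<close>

theorem transversal_meeting_covers:
  assumes "transversal \<noteq> {}"
  shows "\<exists>c\<in>transversal. y \<in> meeting c"
proof -
  let ?U = "\<Union>(meeting ` transversal)"
  let ?F = "{f. (\<forall>s. f s \<in> X s) \<and> int (dim (meeting (\<lambda>s. parallel_space (f s)))) + 2 \<le> int (CARD('k) * CARD('n))}"
  have "?U = UNIV"
  proof (rule closed_eq_UNIV_if_frontier_codim_2)
    show "closed ?U"
      using finite_transversal polyhedron_meeting cell(1) unfolding transversal_def
      by (intro closed_Union) (auto intro!: polyhedron_imp_closed)
    show "finite (meeting ` ?F)"
      by (rule finite_imageI, rule finite_subset[OF _ finite_choice_functions[of X, OF finite_X]]) auto
    show "aff_dim B + 2 \<le> int DIM(real^'n^'k)" if B: "B \<in> meeting ` ?F" for B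
    proof -
      obtain f where "B = meeting f"
          "int (dim (meeting (\<lambda>s. parallel_space (f s)))) + 2 \<le> int (CARD('k) * CARD('n))"
        using B by blast
      then show ?thesis using aff_dim_meeting_le[of f] by simp
    qed
    show "interior ?U \<noteq> {}"
    proof -
      obtain c where c: "c \<in> transversal" using assms by blast
      then have cX: "c s \<in> X s" for s unfolding transversal_def by simp
      have conv: "convex (c s)" for s by (rule polyhedron_imp_convex[OF cell(1)[OF cX]])
      have "\<exists>p. p \<in> rel_interior (c s)" for s
        using rel_interior_eq_empty[OF conv[of s]] cell(2)[OF cX[of s]] by blast
      then obtain p where p: "\<And>s. p s \<in> rel_interior (c s)" by metis
      have "(\<chi> s. - p s) \<in> interior ?U"
      proof (rule interior_point[OF c, of c 0])
        show "c s face_of c s" for s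
          by (rule face_of_refl[OF conv])
        show "int (CARD('k) * CARD('n)) - 1 \<le> int (dim (meeting (\<lambda>s. parallel_space (c s))))"
          using c unfolding transversal_def by simp
      qed (use p in simp)
      then show ?thesis by blast
    qed
    show "frontier ?U \<subseteq> \<Union>(meeting ` ?F)"
    proof
      fix y assume y: "y \<in> frontier ?U"
      then have "y \<in> ?U" "y \<notin> interior ?U"
        using \<open>closed ?U\<close> by (auto simp: frontier_def)
      then obtain c x where c: "c \<in> transversal" and x: "\<And>s. x - y $ s \<in> c s"
        unfolding meeting_def by auto
      then have cX: "c s \<in> X s" for s unfolding transversal_def by simp
      have "\<exists>F. F face_of c s \<and> x - y $ s \<in> rel_interior F" for s
        using exists_face_rel_interior[OF cell(1)[OF cX] x] by blast
      then obtain f where f: "\<And>s. f s face_of c s" "\<And>s. x - y $ s \<in> rel_interior (f s)" by metis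
      have "f s \<in> X s" for s
        by (rule face[OF cX f(1)]) (use f(2)[of s] rel_interior_subset in fastforce)
      moreover have "int (dim (meeting (\<lambda>s. parallel_space (f s)))) + 2 \<le> int (CARD('k) * CARD('n))"
        using interior_point[OF c f] \<open>y \<notin> interior ?U\<close> by fastforce
      moreover have "y \<in> meeting f"
        unfolding meeting_def using f(2) rel_interior_subset by blast
      ultimately show "y \<in> \<Union>(meeting ` ?F)" by blast
    qed
  qed
  then show ?thesis by auto
qed

end

section \<open>Coverings and stable intersections\<close>

definition cells_of_dim :: "int \<Rightarrow> (real^'n::finite) weighted_complex \<Rightarrow> (real^'n) set set" where
  "cells_of_dim e X = {\<sigma> \<in> cells X. aff_dim \<sigma> = e}"

text \<open>
  These properties pass to stable intersections by transversality alone. They do not say that there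
  are cells of dimension \<open>e\<close>; this is what coverings, below, are about.
\<close>

definition positive_complex :: "int \<Rightarrow> (real^'n::finite) weighted_complex \<Rightarrow> bool" where
  "positive_complex e X \<longleftrightarrow> finite (cells X) \<and>
     (\<forall>\<sigma>\<in>cells X. \<sigma> \<noteq> {} \<and> rational_polyhedron UNIV \<sigma> \<and> aff_dim \<sigma> \<le> e \<and>
        (aff_dim \<sigma> = e \<longrightarrow> 0 < weight X \<sigma>))"

lemma positive_complexD:
  assumes "positive_complex e X"
  shows "finite (cells X)" "\<sigma> \<in> cells X \<Longrightarrow> \<sigma> \<noteq> {}" "\<sigma> \<in> cells X \<Longrightarrow> rational_polyhedron UNIV \<sigma>"
    "\<sigma> \<in> cells X \<Longrightarrow> aff_dim \<sigma> \<le> e" "\<sigma> \<in> cells X \<Longrightarrow> aff_dim \<sigma> = e \<Longrightarrow> 0 < weight X \<sigma>"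
proof -
  show "finite (cells X)" using assms unfolding positive_complex_def by (rule conjunct1)
  have "\<forall>\<sigma>\<in>cells X. \<sigma> \<noteq> {} \<and> rational_polyhedron UNIV \<sigma> \<and> aff_dim \<sigma> \<le> e \<and>
        (aff_dim \<sigma> = e \<longrightarrow> 0 < weight X \<sigma>)"
    using assms unfolding positive_complex_def by (rule conjunct2)
  then show "\<sigma> \<in> cells X \<Longrightarrow> \<sigma> \<noteq> {}" "\<sigma> \<in> cells X \<Longrightarrow> rational_polyhedron UNIV \<sigma>"
    "\<sigma> \<in> cells X \<Longrightarrow> aff_dim \<sigma> \<le> e" "\<sigma> \<in> cells X \<Longrightarrow> aff_dim \<sigma> = e \<Longrightarrow> 0 < weight X \<sigma>"
    by blast+
qed

lemma aff_dim_Int_transversal: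
  fixes \<sigma> \<sigma>' :: "(real^'n::finite) set"
  assumes "\<sigma> \<inter> \<sigma>' \<noteq> {}" "span (parallel_space \<sigma> \<union> parallel_space \<sigma>') = UNIV"
  shows "aff_dim (\<sigma> \<inter> \<sigma>') \<le> aff_dim \<sigma> + aff_dim \<sigma>' - int CARD('n)"
proof -
  let ?A = "parallel_space \<sigma>" and ?B = "parallel_space \<sigma>'"
  have "{x + y | x y. x \<in> ?A \<and> y \<in> ?B} = UNIV"
    using assms(2) by (auto simp: span_Un span_eq_iff[THEN iffD2])
  then have "CARD('n) + dim (?A \<inter> ?B) = dim ?A + dim ?B"
    using dim_sums_Int[of ?A ?B] by simp
  moreover have "dim (parallel_space (\<sigma> \<inter> \<sigma>')) \<le> dim (?A \<inter> ?B)"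
    by (intro dim_subset) (simp add: parallel_space_mono)
  moreover have "\<sigma> \<noteq> {}" "\<sigma>' \<noteq> {}" using assms(1) by auto
  ultimately show ?thesis using assms(1) by (simp add: aff_dim_eq_dim_parallel_space)
qed

lemma positive_complex_stable_intersection:
  fixes X Y :: "(real^'n::finite) weighted_complex"
  assumes X: "positive_complex e X" and Y: "positive_complex e' Y"
  shows "positive_complex (e + e' - int CARD('n)) (stable_intersection UNIV X Y)"
  unfolding positive_complex_def
proof (intro conjI ballI impI)
  note XD = positive_complexD[OF X] and YD = positive_complexD[OF Y]
  let ?Z = "stable_intersection UNIV X Y"
  show "finite (cells ?Z)" by (rule finite_cells_stable_intersection[OF XD(1) YD(1)])
  fix L assume L: "L \<in> cells ?Z"
  obtain \<sigma> \<sigma>' where \<sigma>: "\<sigma> \<in> cells X" "\<sigma>' \<in> cells Y" "L = \<sigma> \<inter> \<sigma>'" "L \<noteq> {}"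
    "L = displaced_limit (SOME v. generic_displacement UNIV X Y v) \<sigma> \<sigma>'"
    "span (parallel_space \<sigma> \<union> parallel_space \<sigma>') = coord_space UNIV"
    by (rule stable_intersection_cellE[OF XD(1) YD(1) XD(3) YD(3) L])
  show "L \<noteq> {}" by (rule \<sigma>(4))
  show "rational_polyhedron UNIV L"
    unfolding \<sigma>(3) by (intro rational_polyhedron_Int XD(3) YD(3) \<sigma>(1,2))
  have dim: "aff_dim L \<le> aff_dim \<sigma> + aff_dim \<sigma>' - int CARD('n)"
    unfolding \<sigma>(3) using \<sigma>(3,4,6) by (intro aff_dim_Int_transversal) auto
  then show "aff_dim L \<le> e + e' - int CARD('n)" using XD(4)[OF \<sigma>(1)] YD(4)[OF \<sigma>(2)] by linarith
  assume "aff_dim L = e + e' - int CARD('n)"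
  then have top: "aff_dim \<sigma> = e" "aff_dim \<sigma>' = e'"
    using dim XD(4)[OF \<sigma>(1)] YD(4)[OF \<sigma>(2)] by linarith+
  have fac: "\<sigma> \<in> facets X" "\<sigma>' \<in> facets Y"
    using \<sigma>(1,2) top XD(4) YD(4) unfolding facets_def by auto
  let ?v = "SOME v. generic_displacement UNIV X Y v"
  let ?P = "{(\<sigma>, \<sigma>') \<in> facets X \<times> facets Y. displaced_limit ?v \<sigma> \<sigma>' = L}"
  let ?w = "\<lambda>(\<sigma>, \<sigma>'). weight X \<sigma> * weight Y \<sigma>' * cell_index UNIV \<sigma> \<sigma>'"
  have "finite ?P"
    by (rule finite_subset[of _ "cells X \<times> cells Y"]) (use XD(1) YD(1) in \<open>auto simp: facets_def\<close>)
  moreover have "(\<sigma>, \<sigma>') \<in> ?P" using fac \<sigma>(5) by simp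
  moreover have "0 < ?w (\<sigma>, \<sigma>')"
    using XD(5)[OF \<sigma>(1) top(1)] YD(5)[OF \<sigma>(2) top(2)] \<sigma>(6)
      cell_index_pos[OF XD(3)[OF \<sigma>(1)] YD(3)[OF \<sigma>(2)] XD(2)[OF \<sigma>(1)] YD(2)[OF \<sigma>(2)]] by simp
  ultimately have "0 < (\<Sum>p\<in>?P. ?w p)" by (intro sum_pos2) auto
  then show "0 < weight ?Z L"
    unfolding stable_intersection_def displaced_intersection_def by simp
qed

text \<open>
  However the members of the family are translated, their translates have a common point. As the
  codimensions add up to the dimension of the ambient space, cells of smaller dimension can have
  common points only for translations in a null set.
\<close>

definition covering :: "('k::finite \<Rightarrow> int) \<Rightarrow> ('k \<Rightarrow> (real^'n::finite) set set) \<Rightarrow> bool" where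
  "covering e T \<longleftrightarrow>
     (\<forall>s. finite (T s) \<and> (\<forall>\<sigma>\<in>T s. polyhedron \<sigma> \<and> \<sigma> \<noteq> {} \<and> aff_dim \<sigma> = e s)) \<and>
     (\<Sum>s\<in>UNIV. e s) + int CARD('n) = int (CARD('k) * CARD('n)) \<and>
     (\<forall>y :: real^'n^'k. \<exists>c. (\<forall>s. c s \<in> T s) \<and> y \<in> meeting c)"

lemma coveringD:
  fixes T :: "'k::finite \<Rightarrow> (real^'n::finite) set set"
  assumes "covering e T"
  shows "finite (T s)" "\<sigma> \<in> T s \<Longrightarrow> polyhedron \<sigma>" "\<sigma> \<in> T s \<Longrightarrow> \<sigma> \<noteq> {}" "\<sigma> \<in> T s \<Longrightarrow> aff_dim \<sigma> = e s"
    "(\<Sum>s\<in>UNIV. e s) + int CARD('n) = int (CARD('k) * CARD('n))"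
    "\<exists>c. (\<forall>s. c s \<in> T s) \<and> y \<in> meeting c"
proof -
  have T: "\<forall>s. finite (T s) \<and> (\<forall>\<sigma>\<in>T s. polyhedron \<sigma> \<and> \<sigma> \<noteq> {} \<and> aff_dim \<sigma> = e s)"
    using assms unfolding covering_def by (rule conjunct1)
  then show "finite (T s)" "\<sigma> \<in> T s \<Longrightarrow> polyhedron \<sigma>" "\<sigma> \<in> T s \<Longrightarrow> \<sigma> \<noteq> {}"
    "\<sigma> \<in> T s \<Longrightarrow> aff_dim \<sigma> = e s" by blast+
  show "(\<Sum>s\<in>UNIV. e s) + int CARD('n) = int (CARD('k) * CARD('n))"
    using assms unfolding covering_def by (elim conjE)
  show "\<exists>c. (\<forall>s. c s \<in> T s) \<and> y \<in> meeting c"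
    using assms unfolding covering_def by (elim conjE) (erule spec)
qed

text \<open>
  Translate the second of two slots by \<open>\<epsilon> v\<close> more than the first and let \<open>\<epsilon> \<rightarrow> 0\<close>. Finitely many
  cells occur, so some choice of cells works for \<open>\<epsilon> = 0\<close> and for a small positive \<open>\<epsilon>\<close>: the two
  chosen cells then meet in a cell of the stable intersection. This cell may have too small a
  dimension, but only for translations in a closed null set; the covering by the cells of full
  dimension then extends to all translations as it is closed.
\<close>

lemma covering_stable_intersection:
  fixes T :: "'k::finite \<Rightarrow> (real^'n::finite) set set" and X Y :: "(real^'n) weighted_complex"
  assumes cov: "covering e T" and st: "s \<noteq> t"
    and X: "positive_complex (e s) X" "T s = cells_of_dim (e s) X"
    and Y: "positive_complex (e t) Y" "T t = cells_of_dim (e t) Y"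
  shows "covering (e(s := e s + e t - int CARD('n), t := int CARD('n)))
     (T(s := cells_of_dim (e s + e t - int CARD('n)) (stable_intersection UNIV X Y), t := {UNIV}))"
    (is "covering ?e ?T")
proof -
  note T = coveringD[OF cov]
  note XD = positive_complexD[OF X(1)] and YD = positive_complexD[OF Y(1)]
  let ?Z = "stable_intersection UNIV X Y" and ?d = "e s + e t - int CARD('n)"
  let ?v = "SOME v. generic_displacement UNIV X Y v"
  note ZD = positive_complexD[OF positive_complex_stable_intersection[OF X(1) Y(1)]]
  \<comment> \<open>By dimension, the cells of \<open>?Z\<close> in \<open>B\<close> meet the other members for a null set of \<open>y\<close> only.\<close>
  define B where "B = T(s := {\<sigma> \<in> cells ?Z. aff_dim \<sigma> < ?d}, t := {UNIV})"
  have T': "finite (?T r)" "\<sigma> \<in> ?T r \<Longrightarrow> polyhedron \<sigma> \<and> \<sigma> \<noteq> {} \<and> aff_dim \<sigma> = ?e r" for r \<sigma>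
    using T(1-4) ZD(1-4) st by (auto simp: cells_of_dim_def rational_polyhedron_imp_polyhedron[OF ZD(3)] split: if_splits)
  have sum_e: "(\<Sum>r\<in>UNIV. ?e r) = (\<Sum>r\<in>UNIV. e r)"
  proof -
    have *: "(\<Sum>r\<in>UNIV. f r) = f s + (f t + (\<Sum>r\<in>UNIV - {s} - {t}. f r))" for f :: "'k \<Rightarrow> int"
      using st by (simp add: sum.remove[of UNIV s] sum.remove[of "UNIV - {s}" t])
    have "(\<Sum>r\<in>UNIV - {s} - {t}. ?e r) = (\<Sum>r\<in>UNIV - {s} - {t}. e r)"
      by (rule sum.cong) auto
    then show ?thesis unfolding *[of ?e] *[of e] using st by simp
  qed
  have covers: "y \<in> \<Union>(meeting ` {c. \<forall>r. c r \<in> ?T r}) \<union> \<Union>(meeting ` {c. \<forall>r. c r \<in> B r})"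
    for y :: "real^'n^'k"
  proof -
    define Y' where "Y' \<epsilon> = (\<chi> r. if r = t then y $ s + \<epsilon> *\<^sub>R ?v else y $ r)" for \<epsilon>
    have "continuous_on UNIV (\<lambda>\<epsilon>. if r = t then y $ s + \<epsilon> *\<^sub>R ?v else y $ r)" for r
      by (cases "r = t") (auto intro!: continuous_intros)
    then have contY': "continuous_on UNIV Y'"
      unfolding Y'_def by (rule continuous_on_vec_lambda)
    let ?C = "{c. \<forall>r. c r \<in> T r}"
    have finC: "finite ?C" by (rule finite_choice_functions[OF T(1)])
    have "\<forall>\<^sub>F \<epsilon> in at_right 0. \<exists>c\<in>?C. Y' \<epsilon> \<in> meeting c"
      using T(6) by (intro always_eventually) blast
    then have "\<exists>\<^sub>F \<epsilon> in at_right 0. \<exists>c\<in>?C. Y' \<epsilon> \<in> meeting c"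
      by (rule eventually_frequently[rotated]) simp
    from frequently_bex_finite[OF finC this]
    obtain c where c: "\<And>r. c r \<in> T r" and freq: "\<exists>\<^sub>F \<epsilon> in at_right 0. Y' \<epsilon> \<in> meeting c"
      by blast
    have poly: "polyhedron (meeting c)" by (rule polyhedron_meeting[OF T(2)[OF c]])
    have "closed (Y' -` meeting c)"
      using contY' by (intro continuous_closed_vimage[OF polyhedron_imp_closed[OF poly]])
        (simp add: continuous_on_eq_continuous_at)
    then have op: "open (- (Y' -` meeting c))" by (rule open_Compl)
    have "Y' 0 \<in> meeting c"
    proof (rule ccontr)
      assume "Y' 0 \<notin> meeting c"
      then have "\<forall>\<^sub>F \<epsilon> in nhds 0. \<epsilon> \<in> - (Y' -` meeting c)"
        by (intro eventually_nhds_in_open op) simp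
      then have "\<forall>\<^sub>F \<epsilon> in at_right 0. \<epsilon> \<in> - (Y' -` meeting c)"
        by (rule filter_leD[OF at_within_le_nhds])
      then show False using freq unfolding frequently_def by simp
    qed
    then obtain x0 where x0: "\<And>r. x0 - Y' 0 $ r \<in> c r" unfolding meeting_def by blast
    have "\<exists>\<^sub>F \<epsilon> in at_right 0. 0 < \<epsilon> \<and> Y' \<epsilon> \<in> meeting c"
      using frequently_eventually_conj[OF freq eventually_at_right_less] .
    from frequently_ex[OF this] obtain \<epsilon> where \<epsilon>: "\<epsilon> > 0" "Y' \<epsilon> \<in> meeting c" by blast
    then obtain x where x: "\<And>r. x - Y' \<epsilon> $ r \<in> c r" unfolding meeting_def by blast
    have cst: "c s \<in> cells X" "c t \<in> cells Y" using c X(2) Y(2) unfolding cells_of_dim_def by auto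
    have "x - y $ s \<in> c s" "x - y $ s - \<epsilon> *\<^sub>R ?v \<in> c t"
      using x[of s] x[of t] st unfolding Y'_def by (auto simp: algebra_simps)
    then have lim: "displaced_limit ?v (c s) (c t) = c s \<inter> c t"
      using T(2)[OF c] \<epsilon>(1)
      by (intro displaced_limit_eq_Int[of _ _ \<epsilon> "x - y $ s"] polyhedron_imp_closed polyhedron_imp_convex)
    have A: "x0 - y $ s \<in> c s \<inter> c t" using x0[of s] x0[of t] st unfolding Y'_def by simp
    have cellA: "c s \<inter> c t \<in> cells ?Z"
      unfolding stable_intersection_def displaced_intersection_def using lim A cst by force
    have "x0 - y $ r \<in> (c(s := c s \<inter> c t, t := UNIV)) r" for r
      using A x0[of r] unfolding Y'_def by auto
    then have "y \<in> meeting (c(s := c s \<inter> c t, t := UNIV))" unfolding meeting_def by blast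
    moreover have "(\<forall>r. (c(s := c s \<inter> c t, t := UNIV)) r \<in> ?T r) \<or> (\<forall>r. (c(s := c s \<inter> c t, t := UNIV)) r \<in> B r)"
    proof (cases "aff_dim (c s \<inter> c t) = ?d")
      case True
      then show ?thesis using cellA c st unfolding cells_of_dim_def by (intro disjI1) simp
    next
      case False
      then have "aff_dim (c s \<inter> c t) < ?d" using ZD(4)[OF cellA] by simp
      then show ?thesis using cellA c st unfolding B_def by (intro disjI2) simp
    qed
    ultimately show ?thesis by blast
  qed
  have "closed (\<Union>(meeting ` {c. \<forall>r. c r \<in> ?T r}))"
  proof (rule closed_Union)
    show "finite (meeting ` {c. \<forall>r. c r \<in> ?T r})"
      by (rule finite_imageI[OF finite_choice_functions[OF T'(1)]])
    show "\<forall>M\<in>meeting ` {c. \<forall>r. c r \<in> ?T r}. closed M"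
    proof
      fix M assume "M \<in> meeting ` {c. \<forall>r. c r \<in> ?T r}"
      then obtain c where c: "M = meeting c" "\<And>r. c r \<in> ?T r" by blast
      show "closed M"
        unfolding c(1) by (intro polyhedron_imp_closed polyhedron_meeting) (use T'(2)[OF c(2)] in blast)
    qed
  qed
  moreover have "negligible (\<Union>(meeting ` {c. \<forall>r. c r \<in> B r}))"
  proof (rule negligible_Union)
    have finB: "finite (B r)" for r unfolding B_def using T(1) ZD(1) by simp
    then show "finite (meeting ` {c. \<forall>r. c r \<in> B r})" using finite_choice_functions[of B] by simp
    fix M assume "M \<in> meeting ` {c. \<forall>r. c r \<in> B r}"
    then obtain c where M: "M = meeting c" and c: "\<And>r. c r \<in> B r" by blast
    have cne: "c r \<noteq> {}" for r
      using c[of r] T(3) ZD(2) unfolding B_def by (auto split: if_splits)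
    have le: "aff_dim (c r) \<le> ?e r" for r
      using c[of r] T(4)[of "c r" r] unfolding B_def by (auto split: if_splits)
    have lt: "aff_dim (c s) < ?e s" using c[of s] st unfolding B_def by auto
    have "(\<Sum>r\<in>UNIV. aff_dim (c r)) < (\<Sum>r\<in>UNIV. ?e r)"
    proof (rule sum_strict_mono_ex1)
      show "\<forall>r\<in>UNIV. aff_dim (c r) \<le> ?e r" using le by blast
      show "\<exists>r\<in>UNIV. aff_dim (c r) < ?e r" using lt by blast
    qed simp
    then have "int (dim (meeting (\<lambda>r. parallel_space (c r)))) < int (CARD('k) * CARD('n))"
      using dim_meeting_parallel_le[of c, OF cne] sum_e T(5) by linarith
    then have "aff_dim M < int DIM(real^'n^'k)" unfolding M using aff_dim_meeting_le[of c] by simp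
    then show "negligible M" using negligible_lower_aff_dim hull_subset negligible_subset by metis
  qed
  ultimately have "\<Union>(meeting ` {c. \<forall>r. c r \<in> ?T r}) = UNIV"
  proof -
    assume cl: "closed (\<Union>(meeting ` {c. \<forall>r. c r \<in> ?T r}))"
      and neg: "negligible (\<Union>(meeting ` {c. \<forall>r. c r \<in> B r}))"
    have "- \<Union>(meeting ` {c. \<forall>r. c r \<in> ?T r}) \<subseteq> \<Union>(meeting ` {c. \<forall>r. c r \<in> B r})" using covers by blast
    then have "negligible (- \<Union>(meeting ` {c. \<forall>r. c r \<in> ?T r}))" using neg negligible_subset by blast
    then have "- \<Union>(meeting ` {c. \<forall>r. c r \<in> ?T r}) = {}"
      using open_not_negligible open_Compl[OF cl] by blast
    then show ?thesis by blast
  qed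
  then have "\<exists>c. (\<forall>r. c r \<in> ?T r) \<and> y \<in> meeting c" for y by blast
  then show ?thesis unfolding covering_def using T' sum_e T(5) by simp
qed

section \<open>Rado's theorem\<close>

lemma dim_linear_image_plus_kernel:
  fixes f :: "'a::euclidean_space \<Rightarrow> 'b::euclidean_space"
  assumes f: "linear f" and S: "subspace S"
  shows "dim (f ` S) + dim {x \<in> S. f x = 0} = dim S"
proof -
  let ?K = "{x \<in> S. f x = 0}" and ?T = "{y \<in> S. \<forall>x\<in>{x \<in> S. f x = 0}. orthogonal x y}"
  have K: "subspace ?K" using S linear_add[OF f] linear_scale[OF f] linear_0[OF f]
    by (auto simp: subspace_def)
  have T: "subspace ?T" using S by (auto simp: subspace_def orthogonal_clauses)
  have dim: "dim ?T + dim ?K = dim S"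
    by (rule dim_subspace_orthogonal_to_vectors[OF K S]) auto
  have inj: "inj_on f ?T"
  proof (rule inj_onI)
    fix x y assume xy: "x \<in> ?T" "y \<in> ?T" "f x = f y"
    have d: "x - y \<in> ?T" by (rule subspace_diff[OF T xy(1,2)])
    then have "x - y \<in> ?K" using xy(3) linear_diff[OF f] by simp
    then have "orthogonal (x - y) (x - y)" using d by blast
    then show "x = y" by (simp add: orthogonal_self)
  qed
  have "f ` S = f ` ?T"
  proof
    show "f ` S \<subseteq> f ` ?T"
    proof
      fix z assume "z \<in> f ` S"
      then obtain x where x: "x \<in> S" "z = f x" by blast
      obtain y w where yw: "y \<in> span ?K" "\<And>w'. w' \<in> span ?K \<Longrightarrow> orthogonal w w'" "x = y + w"
        by (rule orthogonal_subspace_decomp_exists[of ?K x]) blast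
      have y: "y \<in> ?K" using yw(1) K by (simp add: span_eq_iff[THEN iffD2])
      then have "w \<in> S" using subspace_diff[OF S x(1), of y] yw(3) by simp
      moreover have "orthogonal k w" if "k \<in> ?K" for k
        using yw(2)[OF span_base[OF that]] by (simp add: orthogonal_commute)
      ultimately have "w \<in> ?T" by blast
      moreover have "f w = z" using y yw(3) x(2) linear_add[OF f] by simp
      ultimately show "z \<in> f ` ?T" by blast
    qed
  qed auto
  then have "dim (f ` S) = dim ?T"
    using dim_image_eq[OF f, of ?T] inj T by (simp add: span_eq_iff[THEN iffD2])
  then show ?thesis using dim by simp
qed

lemma dim_hyperplane_section:
  fixes A :: "'a::euclidean_space set"
  assumes A: "subspace A" and u: "u \<in> A" "a \<bullet> u \<noteq> 0"
  shows "dim {x \<in> A. a \<bullet> x = 0} + 1 = dim A"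
proof -
  have lin: "linear ((\<bullet>) a)" by (simp add: bounded_linear.linear bounded_linear_inner_right)
  have "(\<bullet>) a ` A = UNIV"
  proof -
    have "r = a \<bullet> ((r / (a \<bullet> u)) *\<^sub>R u)" for r using u by simp
    moreover have "(r / (a \<bullet> u)) *\<^sub>R u \<in> A" for r by (rule subspace_scale[OF A u(1)])
    ultimately show ?thesis by blast
  qed
  then show ?thesis using dim_linear_image_plus_kernel[OF lin A] by simp
qed

text \<open>
  Rado's theorem on independent transversals for sets \<open>E i\<close> of linear functionals on \<open>L\<close>, the
  \<open>i\<close>-th set being used \<open>n i\<close> times; the rank of the union of the \<open>E i\<close> for \<open>i \<in> I\<close> is the
  codimension of their common kernel. Choose one functional \<open>a \<in> E i\<close> and restrict everything to
  its kernel. The hypothesis survives if \<open>a\<close> does not vanish on the common kernel of any \<open>I\<close> with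
  \<open>i \<notin> I\<close> for which it is an equality. Such \<open>I\<close> are closed under unions by submodularity, so only the
  largest of them matters, and if all of \<open>E i\<close> vanished on its kernel, adding \<open>i\<close> to it would
  violate the hypothesis.
\<close>

lemma rado_linear_functionals:
  fixes E :: "'i \<Rightarrow> 'a::euclidean_space set"
  assumes "finite P" "subspace L"
    and "\<And>I. I \<subseteq> P \<Longrightarrow> dim {x \<in> L. \<forall>i\<in>I. \<forall>a\<in>E i. a \<bullet> x = 0} + (\<Sum>i\<in>I. n i) \<le> dim L"
  shows "\<exists>a :: 'i \<Rightarrow> nat \<Rightarrow> 'a. (\<forall>i\<in>P. \<forall>j\<in>{1..n i}. a i j \<in> E i) \<and>
           (\<forall>z. \<exists>x\<in>L. \<forall>i\<in>P. \<forall>j\<in>{1..n i}. a i j \<bullet> x = z i j)"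
  using assms(2,3)
proof (induction "\<Sum>i\<in>P. n i" arbitrary: n L)
  case 0
  then have "\<forall>i\<in>P. n i = 0" using \<open>finite P\<close> by simp
  then show ?case using subspace_0[OF 0(2)] by (intro exI[of _ "\<lambda>_ _. 0"]) auto
next
  case (Suc k)
  note L = Suc.prems(1)
  define K where "K I = {x \<in> L. \<forall>i\<in>I. \<forall>a\<in>E i. a \<bullet> x = 0}" for I
  have K: "subspace (K I)" for I
    using L unfolding K_def by (auto simp: subspace_def inner_add_right)
  have rank: "dim (K I) + (\<Sum>i\<in>I. n i) \<le> dim L" if "I \<subseteq> P" for I
    using Suc.prems(2)[OF that] unfolding K_def .
  have finI: "finite I" if "I \<subseteq> P" for I using that \<open>finite P\<close> finite_subset by blast
  have "(\<Sum>i\<in>P. n i) \<noteq> 0" using Suc.hyps(2) by simp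
  then obtain i where i: "i \<in> P" "0 < n i" using sum.not_neutral_contains_not_neutral by blast
  define tight where "tight = {I. I \<subseteq> P - {i} \<and> dim (K I) + (\<Sum>i\<in>I. n i) = dim L}"
  have Un: "I \<union> I' \<in> tight" if "I \<in> tight" "I' \<in> tight" for I I'
  proof -
    have sub: "I \<subseteq> P" "I' \<subseteq> P" "I \<inter> I' \<subseteq> P" "I \<union> I' \<subseteq> P" using that unfolding tight_def by auto
    have "K I \<inter> K I' = K (I \<union> I')" unfolding K_def by auto
    moreover have "{x + y | x y. x \<in> K I \<and> y \<in> K I'} \<subseteq> K (I \<inter> I')"
    proof -
      have "K I \<subseteq> K (I \<inter> I')" "K I' \<subseteq> K (I \<inter> I')" unfolding K_def by auto
      then show ?thesis using subspace_add[OF K] by blast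
    qed
    then have "dim {x + y | x y. x \<in> K I \<and> y \<in> K I'} \<le> dim (K (I \<inter> I'))" by (rule dim_subset)
    ultimately have "dim (K I) + dim (K I') \<le> dim (K (I \<inter> I')) + dim (K (I \<union> I'))"
      using dim_sums_Int[OF K[of I] K[of I']] by simp
    moreover have "(\<Sum>i\<in>I. n i) + (\<Sum>i\<in>I'. n i) = (\<Sum>i\<in>I \<union> I'. n i) + (\<Sum>i\<in>I \<inter> I'. n i)"
      by (rule sum.union_inter[OF finI[OF sub(1)] finI[OF sub(2)], symmetric])
    ultimately have "dim (K (I \<union> I')) + (\<Sum>i\<in>I \<union> I'. n i) = dim L"
      using rank[OF sub(3)] rank[OF sub(4)] that unfolding tight_def by simp
    then show ?thesis using that unfolding tight_def by auto
  qed
  have "tight \<subseteq> Pow P" unfolding tight_def by auto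
  then have fint: "finite tight" using \<open>finite P\<close> finite_subset by blast
  have empty: "{} \<in> tight" unfolding tight_def K_def by simp
  have "\<T> \<subseteq> tight \<Longrightarrow> \<Union>\<T> \<in> tight" if "finite \<T>" for \<T>
    using that
  proof (induction \<T>)
    case (insert I \<T>)
    then show ?case using Un[of I "\<Union>\<T>"] by simp
  qed (simp add: empty)
  from this[OF fint] have M: "\<Union>tight \<in> tight" by simp
  have "\<exists>a\<in>E i. \<exists>u\<in>K (\<Union>tight). a \<bullet> u \<noteq> 0"
  proof (rule ccontr)
    assume neg: "\<not> ?thesis"
    have "K (insert i (\<Union>tight)) = {x \<in> K (\<Union>tight). \<forall>a\<in>E i. a \<bullet> x = 0}"
      unfolding K_def by auto
    also have "\<dots> = K (\<Union>tight)" using neg by blast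
    finally have eq: "K (insert i (\<Union>tight)) = K (\<Union>tight)" .
    have M': "\<Union>tight \<subseteq> P - {i}" "dim (K (\<Union>tight)) + (\<Sum>i\<in>\<Union>tight. n i) = dim L"
      using M unfolding tight_def by blast+
    then have sub: "insert i (\<Union>tight) \<subseteq> P" and ni: "i \<notin> \<Union>tight" using i(1) by blast+
    have "(\<Sum>i\<in>insert i (\<Union>tight). n i) = n i + (\<Sum>i\<in>\<Union>tight. n i)"
      by (rule sum.insert[OF finI ni]) (use sub in blast)
    then show False using rank[OF sub] M'(2) i(2) unfolding eq by linarith
  qed
  then obtain a0 u where a0: "a0 \<in> E i" and u: "u \<in> K (\<Union>tight)" "a0 \<bullet> u \<noteq> 0" by blast
  define L' where "L' = {x \<in> L. a0 \<bullet> x = 0}"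
  define n' where "n' = n(i := n i - 1)"
  have uL: "u \<in> L" using u(1) unfolding K_def by simp
  have dimL': "dim L' + 1 = dim L" unfolding L'_def by (rule dim_hyperplane_section[OF L uL u(2)])
  have L': "subspace L'" using L unfolding L'_def by (auto simp: subspace_def inner_add_right)
  have sum_n': "(\<Sum>i\<in>I. n' i) + (if i \<in> I then 1 else 0) = (\<Sum>i\<in>I. n i)" if "finite I" for I
  proof (cases "i \<in> I")
    case True
    have "(\<Sum>l\<in>I - {i}. n' l) = (\<Sum>l\<in>I - {i}. n l)"
      unfolding n'_def by (rule sum.cong) auto
    then show ?thesis
      using True i(2) sum.remove[OF that True, of n] sum.remove[OF that True, of n']
      unfolding n'_def by simp
  next
    case False
    have "(\<Sum>l\<in>I. n' l) = (\<Sum>l\<in>I. n l)"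
      unfolding n'_def using False by (intro sum.cong) auto
    then show ?thesis using False by simp
  qed
  have rank': "dim {x \<in> L'. \<forall>i\<in>I. \<forall>a\<in>E i. a \<bullet> x = 0} + (\<Sum>i\<in>I. n' i) \<le> dim L'" if I: "I \<subseteq> P" for I
  proof -
    have eq: "{x \<in> L'. \<forall>i\<in>I. \<forall>a\<in>E i. a \<bullet> x = 0} = {x \<in> K I. a0 \<bullet> x = 0}" unfolding L'_def K_def by auto
    have le: "dim {x \<in> K I. a0 \<bullet> x = 0} \<le> dim (K I)" by (intro dim_subset) auto
    show ?thesis
    proof (cases "i \<in> I")
      case True
      then show ?thesis unfolding eq using le rank[OF I] dimL' sum_n'[OF finI[OF I]] by simp
    next
      case False
      then have n: "(\<Sum>i\<in>I. n' i) = (\<Sum>i\<in>I. n i)" using sum_n'[OF finI[OF I]] by simp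
      show ?thesis
      proof (cases "I \<in> tight")
        case True
        then have "K (\<Union>tight) \<subseteq> K I" unfolding K_def by blast
        then have "u \<in> K I" using u(1) by blast
        from dim_hyperplane_section[OF K this u(2)] show ?thesis
          unfolding eq n using rank[OF I] dimL' by simp
      next
        case nt: False
        then have "dim (K I) + (\<Sum>i\<in>I. n i) \<noteq> dim L" using I False unfolding tight_def by blast
        then show ?thesis unfolding eq n using le rank[OF I] dimL' by simp
      qed
    qed
  qed
  have "k = (\<Sum>i\<in>P. n' i)" using sum_n'[OF \<open>finite P\<close>] i(1) Suc.hyps(2) by simp
  from Suc.hyps(1)[OF this L' rank'] obtain a where
    a: "\<And>i j. i \<in> P \<Longrightarrow> j \<in> {1..n' i} \<Longrightarrow> a i j \<in> E i" and
    sol: "\<And>z. \<exists>x\<in>L'. \<forall>i\<in>P. \<forall>j\<in>{1..n' i}. a i j \<bullet> x = z i j" by metis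
  \<comment> \<open>The new functional takes the last place; its value is adjusted at the end, along \<open>u\<close>.\<close>
  define b where "b = a(i := (a i)(n i := a0))"
  have split: "i' \<in> P \<Longrightarrow> j \<in> {1..n i'} \<Longrightarrow> (i' = i \<and> j = n i) \<or> (j \<in> {1..n' i'} \<and> b i' j = a i' j)" for i' j
    unfolding n'_def b_def by auto
  have b_last: "b i (n i) = a0" unfolding b_def by simp
  show ?case
  proof (intro exI[of _ b] conjI ballI allI)
    fix i' j assume "i' \<in> P" "j \<in> {1..n i'}"
    then show "b i' j \<in> E i'" using split[of i' j] a a0 b_last by auto
  next
    fix z :: "'i \<Rightarrow> nat \<Rightarrow> real"
    let ?w = "(z i (n i) / (a0 \<bullet> u)) *\<^sub>R u"
    obtain x where x: "x \<in> L'" "\<And>i' j. i' \<in> P \<Longrightarrow> j \<in> {1..n' i'} \<Longrightarrow> a i' j \<bullet> x = z i' j - a i' j \<bullet> ?w"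
      using sol[of "\<lambda>i' j. z i' j - a i' j \<bullet> ?w"] by blast
    have "x + ?w \<in> L"
      using x(1) uL unfolding L'_def by (intro subspace_add[OF L] subspace_scale[OF L]) auto
    moreover have "b i' j \<bullet> (x + ?w) = z i' j" if ij: "i' \<in> P" "j \<in> {1..n i'}" for i' j
    proof -
      consider "i' = i" "j = n i" | "j \<in> {1..n' i'}" "b i' j = a i' j" using split[OF ij] by blast
      then show ?thesis
      proof cases
        case 1
        then show ?thesis using b_last x(1) u(2) unfolding L'_def by (simp add: inner_add_right)
      next
        case 2
        then show ?thesis using x(2)[OF ij(1) 2(1)] 2(2) by (simp add: inner_add_right)
      qed
    qed
    ultimately show "\<exists>x\<in>L. \<forall>i\<in>P. \<forall>j\<in>{1..n i}. b i j \<bullet> x = z i j" by blast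
  qed
qed

section \<open>Tropical varieties and divisors\<close>

lemma aff_dim_le_of_pure:
  assumes "pure_of_dim d (cells X)" "\<sigma> \<in> cells X"
  shows "aff_dim \<sigma> \<le> int d"
  using assms aff_dim_subset unfolding pure_of_dim_def by metis

lemma tropical_varietyD:
  assumes "tropical_variety J d X"
  shows "finite (cells X)" "\<sigma> \<in> cells X \<Longrightarrow> \<sigma> \<noteq> {}" "\<sigma> \<in> cells X \<Longrightarrow> rational_polyhedron J \<sigma>"
    "\<sigma> \<in> cells X \<Longrightarrow> F face_of \<sigma> \<Longrightarrow> F \<noteq> {} \<Longrightarrow> F \<in> cells X"
    "\<sigma> \<in> cells X \<Longrightarrow> aff_dim \<sigma> \<le> int d"
    "facets X = cells_of_dim (int d) X" 
    "\<sigma> \<in> cells X \<Longrightarrow> \<exists>\<sigma>'\<in>facets X. \<sigma> \<subseteq> \<sigma>'"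
    "\<sigma> \<in> facets X \<Longrightarrow> 0 < weight X \<sigma>"
    "balanced d X" "facets X \<noteq> {}"
proof -
  have cx: "rational_polyhedral_complex J (cells X)" and pure: "pure_of_dim d (cells X)"
    using assms unfolding tropical_variety_def by blast+
  show "\<sigma> \<in> facets X \<Longrightarrow> 0 < weight X \<sigma>" and "balanced d X"
    using assms unfolding tropical_variety_def by blast+
  show "finite (cells X)" using cx unfolding rational_polyhedral_complex_def by (elim conjE)
  have "\<forall>\<sigma>\<in>cells X. \<sigma> \<noteq> {} \<and> rational_polyhedron J \<sigma>"
    using cx unfolding rational_polyhedral_complex_def by (elim conjE)
  then show ne: "\<sigma> \<in> cells X \<Longrightarrow> \<sigma> \<noteq> {}" and "\<sigma> \<in> cells X \<Longrightarrow> rational_polyhedron J \<sigma>" for \<sigma> by blast+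
  have "\<forall>\<sigma>\<in>cells X. \<forall>F. F face_of \<sigma> \<and> F \<noteq> {} \<longrightarrow> F \<in> cells X"
    using cx unfolding rational_polyhedral_complex_def by (elim conjE)
  then show "\<sigma> \<in> cells X \<Longrightarrow> F face_of \<sigma> \<Longrightarrow> F \<noteq> {} \<Longrightarrow> F \<in> cells X" by blast
  show le: "\<sigma> \<in> cells X \<Longrightarrow> aff_dim \<sigma> \<le> int d" for \<sigma> by (rule aff_dim_le_of_pure[OF pure])
  have up: "\<exists>\<sigma>'\<in>cells X. \<sigma> \<subseteq> \<sigma>' \<and> aff_dim \<sigma>' = int d" if "\<sigma> \<in> cells X" for \<sigma>
    using pure that unfolding pure_of_dim_def by blast
  obtain \<sigma>\<^sub>0 where \<sigma>\<^sub>0: "\<sigma>\<^sub>0 \<in> cells X" "aff_dim \<sigma>\<^sub>0 = int d"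
    using pure up unfolding pure_of_dim_def by blast
  have "\<sigma> \<in> facets X \<longleftrightarrow> \<sigma> \<in> cells X \<and> aff_dim \<sigma> = int d" for \<sigma>
  proof
    assume "\<sigma> \<in> facets X"
    then have "\<sigma> \<in> cells X" "aff_dim \<sigma>\<^sub>0 \<le> aff_dim \<sigma>" using \<sigma>\<^sub>0(1) unfolding facets_def by auto
    then show "\<sigma> \<in> cells X \<and> aff_dim \<sigma> = int d" using le[of \<sigma>] \<sigma>\<^sub>0(2) by simp
  qed (use le in \<open>simp add: facets_def\<close>)
  then show fac: "facets X = cells_of_dim (int d) X" unfolding cells_of_dim_def by blast
  show "\<sigma> \<in> cells X \<Longrightarrow> \<exists>\<sigma>'\<in>facets X. \<sigma> \<subseteq> \<sigma>'"
    using up unfolding fac cells_of_dim_def by blast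
  show "facets X \<noteq> {}" using \<sigma>\<^sub>0 unfolding fac cells_of_dim_def by blast
qed

lemma positive_complex_tropical_variety:
  assumes "tropical_variety J d X"
  shows "positive_complex (int d) X"
proof -
  note X = tropical_varietyD[OF assms]
  have "0 < weight X \<sigma>" if "\<sigma> \<in> cells X" "aff_dim \<sigma> = int d" for \<sigma>
    by (rule X(8)) (use that in \<open>simp add: X(6) cells_of_dim_def\<close>)
  then show ?thesis
    unfolding positive_complex_def using X(1,2,5) rational_polyhedron_UNIV[OF X(3)] by simp
qed

text \<open>
  The primitive generators of the facets around \<open>\<tau>\<close> sum up, with positive weights, to a vector
  parallel to \<open>\<tau>\<close>, on which a functional that is constant on \<open>\<tau>\<close> vanishes. So if it is not zero on
  all generators, it is negative on one of them.
\<close>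

lemma weakly_balanced_complex_tropical_variety:
  assumes "tropical_variety J d X"
  shows "weakly_balanced_complex (int d) (cells X)"
proof -
  note X = tropical_varietyD[OF assms]
  have wb: "\<exists>\<sigma>'\<in>cells X. \<tau> \<subseteq> \<sigma>' \<and> aff_dim \<sigma>' = int d \<and> (\<exists>y\<in>\<sigma>'. a \<bullet> y < c)"
    if \<tau>: "\<tau> \<in> cells X" and \<sigma>: "\<sigma> \<in> cells X" "\<tau> \<subseteq> \<sigma>" "aff_dim \<tau> = int d - 1" "aff_dim \<sigma> = int d"
      and a: "\<forall>x\<in>\<tau>. a \<bullet> x = c" and y: "y \<in> \<sigma>" "a \<bullet> y \<noteq> c" for \<tau> \<sigma> a c y
  proof -
    obtain v where v: "\<And>\<sigma>. \<sigma> \<in> facets X \<Longrightarrow> \<tau> \<subseteq> \<sigma> \<Longrightarrow> primitive_generator \<sigma> \<tau> (v \<sigma>)"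
      and sum: "(\<Sum>\<sigma> | \<sigma> \<in> facets X \<and> \<tau> \<subseteq> \<sigma>. real (weight X \<sigma>) *\<^sub>R v \<sigma>) \<in> parallel_space \<tau>"
      using X(9) \<tau> \<sigma>(3) unfolding balanced_def by blast
    have zero: "a \<bullet> w = 0" if "w \<in> parallel_space \<tau>" for w
      by (rule inner_eq_0_parallel_space[of \<tau> a c]) (use a that in auto)
    let ?S = "{\<sigma>. \<sigma> \<in> facets X \<and> \<tau> \<subseteq> \<sigma>}"
    have finS: "finite ?S" using X(1) unfolding facets_def by simp
    have \<sigma>S: "\<sigma> \<in> ?S" using \<sigma> unfolding X(6) cells_of_dim_def by simp
    have "a \<bullet> v \<sigma> \<noteq> 0"
    proof
      assume 0: "a \<bullet> v \<sigma> = 0"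
      have lat: "parallel_lattice \<sigma> = {z + of_int k *\<^sub>R v \<sigma> | z k. z \<in> parallel_lattice \<tau>}"
        using v[of \<sigma>] \<sigma>S unfolding primitive_generator_def by blast
      have "parallel_lattice \<sigma> \<subseteq> {x. a \<bullet> x = 0}"
        unfolding lat using 0 zero by (auto simp: parallel_lattice_def inner_add_right)
      then have "parallel_space \<sigma> \<subseteq> {x. a \<bullet> x = 0}"
        unfolding span_parallel_lattice[OF X(3)[OF \<sigma>(1)] X(2)[OF \<sigma>(1)], symmetric]
        by (intro span_minimal subspace_hyperplane)
      moreover obtain x where x: "x \<in> \<tau>" using X(2)[OF \<tau>] by blast
      ultimately have "a \<bullet> (y - x) = 0" using diff_in_parallel_space[OF y(1), of x] \<sigma>(2) by auto
      then show False using y(2) a x by (simp add: inner_diff_right)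
    qed
    have "(\<Sum>\<sigma>\<in>?S. real (weight X \<sigma>) * (a \<bullet> v \<sigma>)) = 0"
      using zero[OF sum] by (simp add: inner_sum_right)
    have "\<exists>\<sigma>'\<in>?S. a \<bullet> v \<sigma>' < 0"
    proof (rule ccontr)
      assume "\<not> ?thesis"
      then have nn: "0 \<le> a \<bullet> v \<sigma>'" if "\<sigma>' \<in> ?S" for \<sigma>' using that by (meson not_less)
      have "0 < (\<Sum>\<sigma>\<in>?S. real (weight X \<sigma>) * (a \<bullet> v \<sigma>))"
      proof (rule sum_pos2[OF finS \<sigma>S])
        show "0 < real (weight X \<sigma>) * (a \<bullet> v \<sigma>)"
          using nn[OF \<sigma>S] \<open>a \<bullet> v \<sigma> \<noteq> 0\<close> X(8)[of \<sigma>] \<sigma>S by simp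
        show "0 \<le> real (weight X \<sigma>) * (a \<bullet> v \<sigma>)" if "\<sigma> \<in> ?S" for \<sigma> using nn[OF that] by simp
      qed
      then show False using \<open>(\<Sum>\<sigma>\<in>?S. real (weight X \<sigma>) * (a \<bullet> v \<sigma>)) = 0\<close> by simp
    qed
    then obtain \<sigma>' where \<sigma>': "\<sigma>' \<in> ?S" "a \<bullet> v \<sigma>' < 0" by blast
    then obtain x t where xt: "x \<in> \<tau>" "t > 0" "x + t *\<^sub>R v \<sigma>' \<in> \<sigma>'"
      using v[of \<sigma>'] unfolding primitive_generator_def by blast
    have "a \<bullet> (x + t *\<^sub>R v \<sigma>') < c"
      using a xt(1,2) \<sigma>'(2) by (simp add: inner_add_right mult_pos_neg)
    then show ?thesis using \<sigma>'(1) xt(3) unfolding X(6) cells_of_dim_def by blast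
  qed
  have "\<forall>\<sigma>\<in>cells X. polyhedron \<sigma> \<and> \<sigma> \<noteq> {} \<and> aff_dim \<sigma> \<le> int d"
    using X(2,5) rational_polyhedron_imp_polyhedron[OF X(3)] by simp
  moreover have "\<forall>\<sigma>\<in>cells X. \<forall>F. F face_of \<sigma> \<and> F \<noteq> {} \<longrightarrow> F \<in> cells X" using X(4) by simp
  moreover have "\<forall>\<tau>\<in>cells X. \<forall>\<sigma>\<in>cells X. \<tau> \<subseteq> \<sigma> \<and> aff_dim \<tau> = int d - 1 \<and> aff_dim \<sigma> = int d \<longrightarrow>
      (\<forall>a c. (\<forall>x\<in>\<tau>. a \<bullet> x = c) \<and> (\<exists>y\<in>\<sigma>. a \<bullet> y \<noteq> c) \<longrightarrow>
         (\<exists>\<sigma>'\<in>cells X. \<tau> \<subseteq> \<sigma>' \<and> aff_dim \<sigma>' = int d \<and> (\<exists>y\<in>\<sigma>'. a \<bullet> y < c)))"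
    by (intro ballI allI impI, elim conjE bexE) (rule wb)
  ultimately show ?thesis
    unfolding weakly_balanced_complex_def using X(1) by (intro conjI)
qed

lemma weakly_balanced_complex_UNIV: "weakly_balanced_complex (int CARD('n)) {UNIV :: (real^'n::finite) set}"
proof -
  have "F = UNIV" if "F face_of (UNIV :: (real^'n) set)" "F \<noteq> {}" for F
    using that face_of_affine_eq[OF affine_UNIV] by blast
  then show ?thesis unfolding weakly_balanced_complex_def by simp
qed

subsection \<open>Preimages under coordinate projections\<close>

lemma linear_coord_proj: "linear (coord_proj J)"
  unfolding coord_proj_def by (intro linearI) (auto simp: vec_eq_iff)

lemma coord_proj_in: "coord_proj J x \<in> coord_space J"
  unfolding coord_proj_def coord_space_def by simp

lemma coord_proj_id: "x \<in> coord_space J \<Longrightarrow> coord_proj J x = x"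
  unfolding coord_proj_def coord_space_def by (simp add: vec_eq_iff)

lemma coord_proj_idem [simp]: "coord_proj J (coord_proj J x) = coord_proj J x"
  by (rule coord_proj_id[OF coord_proj_in])

lemma coord_proj_adjoint: "a \<bullet> coord_proj J x = coord_proj J a \<bullet> x"
  unfolding coord_proj_def inner_vec_def by (auto intro!: sum.cong)

lemma dim_coord_space: "dim (coord_space J) = card J"
proof -
  let ?d = "(\<lambda>j. axis j (1::real)) ` J"
  have "coord_space J = {x. \<forall>i\<in>Basis. i \<notin> ?d \<longrightarrow> x \<bullet> i = 0}"
    unfolding coord_space_def Basis_vec_def by (auto simp: axis_eq_axis inner_axis image_iff)
  moreover have "?d \<subseteq> Basis" by (auto simp: Basis_vec_def)
  moreover have "card ?d = card J" by (intro card_image inj_onI) (simp add: axis_eq_axis)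
  ultimately show ?thesis using dim_substandard[of ?d] by simp
qed

lemma coord_proj_image_vimage:
  assumes "\<sigma> \<subseteq> coord_space J"
  shows "coord_proj J ` (coord_proj J -` \<sigma>) = \<sigma>"
proof
  have "x = coord_proj J x" if "x \<in> \<sigma>" for x using that assms coord_proj_id by fastforce
  then show "\<sigma> \<subseteq> coord_proj J ` (coord_proj J -` \<sigma>)" by force
qed auto

lemma parallel_space_subset_coord_space: "\<sigma> \<subseteq> coord_space J \<Longrightarrow> parallel_space \<sigma> \<subseteq> coord_space J"
  by (intro parallel_space_subset_subspace subspace_coord_space)
     (auto intro: subspace_diff[OF subspace_coord_space])

lemma parallel_space_vimage:
  assumes "\<sigma> \<subseteq> coord_space J" "\<sigma> \<noteq> {}"
  shows "parallel_space (coord_proj J -` \<sigma>) = coord_proj J -` parallel_space \<sigma>"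
proof
  note lin = linear_coord_proj[of J]
  show "parallel_space (coord_proj J -` \<sigma>) \<subseteq> coord_proj J -` parallel_space \<sigma>"
    by (rule parallel_space_subset_subspace[OF linear_subspace_vimage[OF lin subspace_parallel_space]])
       (auto simp: linear_diff[OF lin] intro: diff_in_parallel_space)
  show "coord_proj J -` parallel_space \<sigma> \<subseteq> parallel_space (coord_proj J -` \<sigma>)"
  proof
    fix w assume w: "w \<in> coord_proj J -` parallel_space \<sigma>"
    obtain x where x: "x \<in> \<sigma>" using assms(2) by blast
    have px: "coord_proj J x = x" using x assms(1) by (intro coord_proj_id) blast
    have sub: "\<sigma> \<subseteq> coord_proj J -` \<sigma>" using assms(1) coord_proj_id by force
    have "coord_proj J w \<in> parallel_space (coord_proj J -` \<sigma>)"
      using w parallel_space_mono[OF sub] by blast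
    moreover have "x + (w - coord_proj J w) \<in> coord_proj J -` \<sigma>"
      using x px by (simp add: linear_add[OF lin] linear_diff[OF lin])
    then have "(x + (w - coord_proj J w)) - x \<in> parallel_space (coord_proj J -` \<sigma>)"
      using x sub by (intro diff_in_parallel_space) auto
    ultimately have "coord_proj J w + ((x + (w - coord_proj J w)) - x) \<in> parallel_space (coord_proj J -` \<sigma>)"
      by (rule subspace_add[OF subspace_parallel_space])
    then show "w \<in> parallel_space (coord_proj J -` \<sigma>)" by simp
  qed
qed

lemma dim_vimage_coord_proj:
  fixes K :: "(real^'n::finite) set"
  assumes "subspace K" "K \<subseteq> coord_space J"
  shows "dim (coord_proj J -` K) + card J = dim K + CARD('n)"
proof -
  note lin = linear_coord_proj[of J]
  have "dim (coord_proj J ` (coord_proj J -` K)) + dim {x \<in> coord_proj J -` K. coord_proj J x = 0}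
      = dim (coord_proj J -` K)"
    by (rule dim_linear_image_plus_kernel[OF lin linear_subspace_vimage[OF lin assms(1)]])
  moreover have "{x \<in> coord_proj J -` K. coord_proj J x = 0} = coord_space (- J)"
  proof -
    have "coord_proj J x = 0 \<longleftrightarrow> x \<in> coord_space (- J)" for x
      by (auto simp: coord_proj_def coord_space_def vec_eq_iff)
    moreover have "x \<in> coord_proj J -` K" if "coord_proj J x = 0" for x
      using subspace_0[OF assms(1)] that by simp
    ultimately show ?thesis by blast
  qed
  ultimately have "dim K + card (- J) = dim (coord_proj J -` K)"
    using coord_proj_image_vimage[OF assms(2)] by (simp add: dim_coord_space)
  moreover have "card J + card (- J) = CARD('n)"
    using card_Un_disjoint[of J "- J"] by (simp add: Compl_partition)
  ultimately show ?thesis by simp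
qed

lemma aff_dim_vimage_coord_proj:
  fixes \<sigma> :: "(real^'n::finite) set"
  assumes "\<sigma> \<subseteq> coord_space J" "\<sigma> \<noteq> {}"
  shows "aff_dim (coord_proj J -` \<sigma>) = aff_dim \<sigma> + int CARD('n) - int (card J)"
proof -
  have "coord_proj J -` \<sigma> \<noteq> {}" using coord_proj_image_vimage[OF assms(1)] assms(2) by blast
  then show ?thesis
    using dim_vimage_coord_proj[OF subspace_parallel_space parallel_space_subset_coord_space[OF assms(1)]]
    by (simp add: aff_dim_eq_dim_parallel_space assms(2) parallel_space_vimage[OF assms])
qed

lemma rational_polyhedron_vimage_coord_proj:
  assumes "rational_polyhedron J \<sigma>"
  shows "rational_polyhedron UNIV (coord_proj J -` \<sigma>)"
proof -
  obtain F where F: "finite F" "\<forall>(a, c) \<in> F. \<forall>j. a $ j \<in> \<int>"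
      "\<sigma> = {x \<in> coord_space J. \<forall>(a, c) \<in> F. a \<bullet> x \<le> c}"
    using assms unfolding rational_polyhedron_def by auto
  let ?G = "(\<lambda>(a, c). (coord_proj J a, c)) ` F"
  have "coord_proj J -` \<sigma> = {x. \<forall>(a, c) \<in> ?G. a \<bullet> x \<le> c}"
    unfolding F(3) by (auto simp: coord_proj_in coord_proj_adjoint split_beta)
  moreover have "\<forall>(a, c) \<in> ?G. \<forall>j. a $ j \<in> \<int>"
    using F(2) by (auto simp: coord_proj_def)
  ultimately show ?thesis unfolding rational_polyhedron_UNIV_iff
    using F(1) by (intro exI[of _ ?G]) simp
qed

text \<open>
  A face of the preimage is invariant under the kernel of the projection: it contains the midpoint of
  the segment from \<open>x - k\<close> to \<open>x + k\<close>, hence its ends.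
\<close>

lemma face_of_vimage_coord_proj:
  assumes \<sigma>: "\<sigma> \<subseteq> coord_space J" and F: "F face_of (coord_proj J -` \<sigma>)"
  shows "coord_proj J ` F face_of \<sigma>" and "F = coord_proj J -` (coord_proj J ` F)"
proof -
  note lin = linear_coord_proj[of J]
  have Fsub: "F \<subseteq> coord_proj J -` \<sigma>" by (rule face_of_imp_subset[OF F])
  have add: "x + k \<in> F" if x: "x \<in> F" and k: "coord_proj J k = 0" for x k
  proof (cases "k = 0")
    case False
    have "x - k \<in> coord_proj J -` \<sigma>" "x + k \<in> coord_proj J -` \<sigma>"
      using x k Fsub by (auto simp: linear_add[OF lin] linear_diff[OF lin])
    moreover have "x \<in> open_segment (x - k) (x + k)"
    proof -
      have "x = (1 - 1 / 2) *\<^sub>R (x - k) + (1 / 2) *\<^sub>R (x + k)"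
        by (simp add: scaleR_diff_right scaleR_add_right flip: scaleR_add_left)
      moreover have "x - k \<noteq> x + k"
      proof
        assume "x - k = x + k"
        then have "2 *\<^sub>R k = 0" by (simp add: scaleR_2 algebra_simps)
        then show False using False by simp
      qed
      ultimately show ?thesis unfolding in_segment by (intro conjI exI[of _ "1/2"]) auto
    qed
    ultimately show ?thesis using F x unfolding face_of_def by blast
  qed (use x in simp)
  have proj: "coord_proj J x \<in> F" if "x \<in> F" for x
    using add[OF that, of "coord_proj J x - x"] by (simp add: linear_diff[OF lin])
  show "F = coord_proj J -` (coord_proj J ` F)"
  proof
    show "coord_proj J -` (coord_proj J ` F) \<subseteq> F"
    proof
      fix x assume "x \<in> coord_proj J -` (coord_proj J ` F)"
      then obtain y where y: "y \<in> F" "coord_proj J x = coord_proj J y" by auto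
      then show "x \<in> F" using add[OF y(1), of "x - y"] by (simp add: linear_diff[OF lin])
    qed
  qed auto
  show "coord_proj J ` F face_of \<sigma>"
    unfolding face_of_def
  proof (intro conjI ballI impI)
    show "coord_proj J ` F \<subseteq> \<sigma>" using Fsub by auto
    show "convex (coord_proj J ` F)"
      by (rule convex_linear_image[OF lin face_of_imp_convex[OF F]])
    fix a b x assume ab: "a \<in> \<sigma>" "b \<in> \<sigma>" and x: "x \<in> coord_proj J ` F" "x \<in> open_segment a b"
    have id: "coord_proj J a = a" "coord_proj J b = b" using ab \<sigma> by (auto intro: coord_proj_id)
    have "x \<in> F" using x(1) proj by blast
    then have "a \<in> F" "b \<in> F"
      using F x(2) ab id unfolding face_of_def by auto
    then show "a \<in> coord_proj J ` F" "b \<in> coord_proj J ` F" using id by force+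
  qed
qed

lemma cells_proj_preimage: "cells (proj_preimage J X) = (\<lambda>\<sigma>. coord_proj J -` \<sigma>) ` cells X"
  unfolding proj_preimage_def by simp

lemma weakly_balanced_complex_proj_preimage:
  fixes X :: "(real^'n::finite) weighted_complex"
  assumes wb: "weakly_balanced_complex e (cells X)" and sub: "\<And>\<sigma>. \<sigma> \<in> cells X \<Longrightarrow> rational_polyhedron J \<sigma>"
  shows "weakly_balanced_complex (e + int CARD('n) - int (card J)) (cells (proj_preimage J X))"
proof -
  let ?p = "coord_proj J" and ?e = "e + int CARD('n) - int (card J)"
  have in_J: "\<sigma> \<subseteq> coord_space J" if "\<sigma> \<in> cells X" for \<sigma>
    using sub[OF that] unfolding rational_polyhedron_def by auto
  have fin: "finite (cells X)" using wb unfolding weakly_balanced_complex_def by (elim conjE)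
  have "\<forall>\<sigma>\<in>cells X. polyhedron \<sigma> \<and> \<sigma> \<noteq> {} \<and> aff_dim \<sigma> \<le> e"
    using wb unfolding weakly_balanced_complex_def by (elim conjE)
  then have ne: "\<sigma> \<noteq> {}" and le: "aff_dim \<sigma> \<le> e" if "\<sigma> \<in> cells X" for \<sigma> using that by blast+
  have face: "\<forall>\<sigma>\<in>cells X. \<forall>F. F face_of \<sigma> \<and> F \<noteq> {} \<longrightarrow> F \<in> cells X"
    using wb unfolding weakly_balanced_complex_def by (elim conjE)
  have bal: "\<forall>\<tau>\<in>cells X. \<forall>\<sigma>\<in>cells X. \<tau> \<subseteq> \<sigma> \<and> aff_dim \<tau> = e - 1 \<and> aff_dim \<sigma> = e \<longrightarrow>
        (\<forall>a c. (\<forall>x\<in>\<tau>. a \<bullet> x = c) \<and> (\<exists>y\<in>\<sigma>. a \<bullet> y \<noteq> c) \<longrightarrow>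
           (\<exists>\<sigma>'\<in>cells X. \<tau> \<subseteq> \<sigma>' \<and> aff_dim \<sigma>' = e \<and> (\<exists>y\<in>\<sigma>'. a \<bullet> y < c)))"
    using wb unfolding weakly_balanced_complex_def by (elim conjE)
  have dim: "aff_dim (?p -` \<sigma>) = aff_dim \<sigma> + int CARD('n) - int (card J)" if "\<sigma> \<in> cells X" for \<sigma>
    by (rule aff_dim_vimage_coord_proj[OF in_J[OF that] ne[OF that]])
  have im: "?p ` (?p -` \<sigma>) = \<sigma>" if "\<sigma> \<in> cells X" for \<sigma>
    by (rule coord_proj_image_vimage[OF in_J[OF that]])
  show ?thesis
    unfolding weakly_balanced_complex_def
  proof (intro conjI)
    show "finite (cells (proj_preimage J X))" unfolding cells_proj_preimage using fin by simp
    show "\<forall>\<sigma>\<in>cells (proj_preimage J X). polyhedron \<sigma> \<and> \<sigma> \<noteq> {} \<and> aff_dim \<sigma> \<le> ?e"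
      unfolding cells_proj_preimage
    proof (intro ballI, elim imageE)
      fix \<mu> \<sigma> assume \<sigma>: "\<sigma> \<in> cells X" "\<mu> = ?p -` \<sigma>"
      have "\<mu> \<noteq> {}" using im[OF \<sigma>(1)] ne[OF \<sigma>(1)] \<sigma>(2) by blast
      then show "polyhedron \<mu> \<and> \<mu> \<noteq> {} \<and> aff_dim \<mu> \<le> ?e"
        using dim[OF \<sigma>(1)] le[OF \<sigma>(1)] \<sigma>(2)
          rational_polyhedron_imp_polyhedron[OF rational_polyhedron_vimage_coord_proj[OF sub[OF \<sigma>(1)]]] by simp
    qed
    show "\<forall>\<sigma>\<in>cells (proj_preimage J X). \<forall>F. F face_of \<sigma> \<and> F \<noteq> {} \<longrightarrow> F \<in> cells (proj_preimage J X)"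
      unfolding cells_proj_preimage
    proof (intro ballI allI impI, elim imageE conjE)
      fix \<mu> \<sigma> F assume \<sigma>: "\<sigma> \<in> cells X" "\<mu> = ?p -` \<sigma>" and F: "F face_of \<mu>" "F \<noteq> {}"
      note f = face_of_vimage_coord_proj[OF in_J[OF \<sigma>(1)] F(1)[unfolded \<sigma>(2)]]
      have "?p ` F \<in> cells X" using face \<sigma>(1) f(1) F(2) by blast
      then show "F \<in> (\<lambda>\<sigma>. ?p -` \<sigma>) ` cells X" using f(2) by blast
    qed
    show "\<forall>\<tau>\<in>cells (proj_preimage J X). \<forall>\<sigma>\<in>cells (proj_preimage J X).
        \<tau> \<subseteq> \<sigma> \<and> aff_dim \<tau> = ?e - 1 \<and> aff_dim \<sigma> = ?e \<longrightarrow>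
        (\<forall>a c. (\<forall>x\<in>\<tau>. a \<bullet> x = c) \<and> (\<exists>y\<in>\<sigma>. a \<bullet> y \<noteq> c) \<longrightarrow>
           (\<exists>\<sigma>'\<in>cells (proj_preimage J X). \<tau> \<subseteq> \<sigma>' \<and> aff_dim \<sigma>' = ?e \<and> (\<exists>y\<in>\<sigma>'. a \<bullet> y < c)))"
      unfolding cells_proj_preimage
    proof (intro ballI allI impI, elim imageE conjE bexE)
      fix \<tau>' \<sigma>' a c \<tau> \<sigma> y
      assume \<tau>: "\<tau> \<in> cells X" "\<tau>' = ?p -` \<tau>" and \<sigma>: "\<sigma> \<in> cells X" "\<sigma>' = ?p -` \<sigma>"
        and dims: "\<tau>' \<subseteq> \<sigma>'" "aff_dim \<tau>' = ?e - 1" "aff_dim \<sigma>' = ?e"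
        and a: "\<forall>x\<in>\<tau>'. a \<bullet> x = c" and y: "y \<in> \<sigma>'" "a \<bullet> y \<noteq> c"
      obtain x where x: "x \<in> \<tau>" using ne[OF \<tau>(1)] by blast
      have px: "?p x = x" using x in_J[OF \<tau>(1)] by (intro coord_proj_id) blast
      have sub': "\<sigma> \<subseteq> ?p -` \<sigma>" if "\<sigma> \<in> cells X" for \<sigma> using in_J[OF that] coord_proj_id by force
      have py: "a \<bullet> ?p y = a \<bullet> y"
      proof -
        have "x + (y - ?p y) \<in> \<tau>'"
          unfolding \<tau>(2) using x px by (simp add: linear_add[OF linear_coord_proj] linear_diff[OF linear_coord_proj])
        then have "a \<bullet> (x + (y - ?p y)) = a \<bullet> x"
          using a x sub'[OF \<tau>(1)] \<tau>(2) by auto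
        then show ?thesis by (simp add: inner_add_right inner_diff_right)
      qed
      have c1: "\<tau> \<subseteq> \<sigma>" using dims(1) im[OF \<tau>(1)] im[OF \<sigma>(1)] \<tau>(2) \<sigma>(2) by blast
      have c2: "aff_dim \<tau> = e - 1" "aff_dim \<sigma> = e"
        using dims(2,3) dim[OF \<tau>(1)] dim[OF \<sigma>(1)] \<tau>(2) \<sigma>(2) by simp_all
      have c3: "\<forall>x\<in>\<tau>. a \<bullet> x = c" using a \<tau>(2) sub'[OF \<tau>(1)] by blast
      have c4: "\<exists>y\<in>\<sigma>. a \<bullet> y \<noteq> c" using y \<sigma>(2) py by (intro bexI[of _ "?p y"]) auto
      have "\<exists>\<rho>\<in>cells X. \<tau> \<subseteq> \<rho> \<and> aff_dim \<rho> = e \<and> (\<exists>y\<in>\<rho>. a \<bullet> y < c)"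
        by (rule bal[THEN bspec, OF \<tau>(1), THEN bspec, OF \<sigma>(1), THEN mp, THEN spec, THEN spec, THEN mp])
           (intro conjI c1 c2 c3 c4)+
      then obtain \<rho> z where \<rho>: "\<rho> \<in> cells X" "\<tau> \<subseteq> \<rho>" "aff_dim \<rho> = e" "z \<in> \<rho>" "a \<bullet> z < c"
        by blast
      have "\<tau>' \<subseteq> ?p -` \<rho>" "aff_dim (?p -` \<rho>) = ?e" "z \<in> ?p -` \<rho>"
        using \<tau>(2) \<rho>(2) dim[OF \<rho>(1)] \<rho>(3) \<rho>(4) sub'[OF \<rho>(1)] by auto
      then show "\<exists>\<sigma>'\<in>(\<lambda>\<sigma>. ?p -` \<sigma>) ` cells X. \<tau>' \<subseteq> \<sigma>' \<and> aff_dim \<sigma>' = ?e \<and> (\<exists>y\<in>\<sigma>'. a \<bullet> y < c)"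
        using \<rho>(1,5) by blast
    qed
  qed
qed

lemma positive_complex_proj_preimage:
  fixes X :: "(real^'n::finite) weighted_complex"
  assumes "tropical_variety J d X"
  shows "positive_complex (int d + int CARD('n) - int (card J)) (proj_preimage J X)"
  unfolding positive_complex_def cells_proj_preimage
proof (intro conjI)
  note X = tropical_varietyD[OF assms]
  show "finite ((\<lambda>\<sigma>. coord_proj J -` \<sigma>) ` cells X)" using X(1) by simp
  show "\<forall>\<mu>\<in>(\<lambda>\<sigma>. coord_proj J -` \<sigma>) ` cells X. \<mu> \<noteq> {} \<and> rational_polyhedron UNIV \<mu> \<and>
      aff_dim \<mu> \<le> int d + int CARD('n) - int (card J) \<and>
      (aff_dim \<mu> = int d + int CARD('n) - int (card J) \<longrightarrow> 0 < weight (proj_preimage J X) \<mu>)"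
  proof (intro ballI, elim imageE)
    fix \<mu> \<sigma> assume \<sigma>: "\<mu> = coord_proj J -` \<sigma>" "\<sigma> \<in> cells X"
    have in_J: "\<sigma> \<subseteq> coord_space J" using X(3)[OF \<sigma>(2)] unfolding rational_polyhedron_def by auto
    have dim: "aff_dim \<mu> = aff_dim \<sigma> + int CARD('n) - int (card J)"
      unfolding \<sigma>(1) by (rule aff_dim_vimage_coord_proj[OF in_J X(2)[OF \<sigma>(2)]])
    have im: "coord_proj J ` \<mu> = \<sigma>" unfolding \<sigma>(1) by (rule coord_proj_image_vimage[OF in_J])
    have "weight (proj_preimage J X) \<mu> = weight X \<sigma>" unfolding proj_preimage_def using im by simp
    moreover have "aff_dim \<sigma> = int d \<Longrightarrow> 0 < weight X \<sigma>"
      using X(6,8) \<sigma>(2) unfolding cells_of_dim_def by blast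
    moreover have "rational_polyhedron UNIV \<mu>"
      unfolding \<sigma>(1) by (rule rational_polyhedron_vimage_coord_proj[OF X(3)[OF \<sigma>(2)]])
    moreover have "\<mu> \<noteq> {}" using im X(2)[OF \<sigma>(2)] by blast
    ultimately show "\<mu> \<noteq> {} \<and> rational_polyhedron UNIV \<mu> \<and>
      aff_dim \<mu> \<le> int d + int CARD('n) - int (card J) \<and>
      (aff_dim \<mu> = int d + int CARD('n) - int (card J) \<longrightarrow> 0 < weight (proj_preimage J X) \<mu>)"
      using dim X(5)[OF \<sigma>(2)] by simp
  qed
qed

section \<open>Positive divisors\<close>

text \<open>
  The line is cut out by the functionals from an integral basis of the orthogonal complement of \<open>u\<close>.
\<close>

lemma rational_polyhedron_span_integral:
  fixes u :: "real^'n::finite"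
  assumes u: "u \<in> coord_space J" "\<forall>j. u $ j \<in> \<int>" "u \<noteq> 0"
  shows "rational_polyhedron J (span {u})"
proof -
  let ?B = "{x. u \<bullet> x = 0 \<and> (\<forall>j. x $ j \<in> \<int>)}"
  have "rational_subspace {x. u \<bullet> x = 0}"
    unfolding rational_subspace_def using u(2) by (intro exI[of _ "{u}"]) auto
  from rational_subspace_span_integral[OF this] have spanB: "span ?B = {x. u \<bullet> x = 0}" by simp
  obtain C where C: "C \<subseteq> ?B" "independent C" "?B \<subseteq> span C"
    using maximal_independent_subset by blast
  have finC: "finite C" using C(2) independent_imp_finite by blast
  have spanC: "span C = {x. u \<bullet> x = 0}"
    using span_mono[OF C(1)] span_mono[OF C(3)] spanB unfolding span_span by blast
  let ?F = "(\<lambda>b. (b, 0)) ` C \<union> (\<lambda>b. (- b, 0)) ` C"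
  have iff: "x \<in> span {u} \<longleftrightarrow> (\<forall>b\<in>C. b \<bullet> x = 0)" for x
  proof
    assume "x \<in> span {u}"
    then obtain t where "x = t *\<^sub>R u" by (auto simp: span_singleton)
    then show "\<forall>b\<in>C. b \<bullet> x = 0" using C(1) by (auto simp: inner_commute)
  next
    assume x: "\<forall>b\<in>C. b \<bullet> x = 0"
    have perp: "w \<bullet> x = 0" if "u \<bullet> w = 0" for w
    proof -
      have "span C \<subseteq> {w. x \<bullet> w = 0}"
        by (rule span_minimal[OF _ subspace_hyperplane]) (use x in \<open>auto simp: inner_commute\<close>)
      then show ?thesis using that spanC by (auto simp: inner_commute)
    qed
    let ?y = "x - ((u \<bullet> x) / (u \<bullet> u)) *\<^sub>R u"
    have uy: "u \<bullet> ?y = 0" using u(3) by (simp add: inner_diff_right)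
    have "?y \<bullet> ?y = ?y \<bullet> x - ((u \<bullet> x) / (u \<bullet> u)) * (?y \<bullet> u)" by (simp add: inner_diff_right)
    also have "\<dots> = 0" using perp[OF uy] uy by (simp add: inner_commute)
    finally have "x = ((u \<bullet> x) / (u \<bullet> u)) *\<^sub>R u" by simp
    then show "x \<in> span {u}" by (metis span_base span_scale singletonI)
  qed
  have "span {u} \<subseteq> coord_space J"
    using u(1) by (intro span_minimal subspace_coord_space) simp
  then have "span {u} = {x \<in> coord_space J. \<forall>(a, c) \<in> ?F. a \<bullet> x \<le> c}"
    using iff by (fastforce simp: ball_Un intro: antisym)
  moreover have "\<forall>(a, c) \<in> ?F. \<forall>j. a $ j \<in> \<int>" using C(1) by auto
  ultimately show ?thesis unfolding rational_polyhedron_def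
    using finC by (intro exI[of _ ?F]) auto
qed

lemma tropical_curve_line:
  fixes u :: "real^'n::finite"
  assumes u: "u \<in> coord_space J" "\<forall>j. u $ j \<in> \<int>" "u \<noteq> 0"
  shows "tropical_curve J \<lparr>cells = {span {u}}, weight = \<lambda>_. 1\<rparr>"
proof -
  have face: "F = span {u}" if "F face_of span {u}" "F \<noteq> {}" for F
    using that face_of_affine_eq[OF subspace_imp_affine[OF subspace_span]] by blast
  have "span {u} face_of span {u}" by (rule face_of_refl[OF subspace_imp_convex[OF subspace_span]])
  moreover have dim: "aff_dim (span {u}) = 1"
    using u(3) by (simp add: aff_dim_subspace)
  moreover have "span {u} \<noteq> {}" using span_0 by blast
  ultimately show ?thesis
    unfolding tropical_curve_def tropical_variety_def rational_polyhedral_complex_def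
      pure_of_dim_def balanced_def
    using face rational_polyhedron_span_integral[OF assms] by auto
qed

text \<open>
  The divisor meets the rational lines, so no integral vector is parallel to all its facets. The
  vectors parallel to all facets form a rational subspace, which is therefore trivial.
\<close>

lemma positive_divisor_facets_separate:
  fixes \<Lambda> :: "(real^'n::finite) weighted_complex"
  assumes pos: "positive_divisor J \<Lambda>" and x: "x \<in> coord_space J" "\<And>\<mu>. \<mu> \<in> facets \<Lambda> \<Longrightarrow> x \<in> parallel_space \<mu>"
  shows "x = 0"
proof -
  obtain d where d: "Suc d = card J" "tropical_variety J d \<Lambda>"
    using pos unfolding positive_divisor_def tropical_divisor_def by blast
  note L = tropical_varietyD[OF d(2)]
  have fcells: "\<mu> \<in> cells \<Lambda>" if "\<mu> \<in> facets \<Lambda>" for \<mu> using that unfolding facets_def by simp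
  let ?K = "coord_space J \<inter> (\<Inter>\<mu>\<in>facets \<Lambda>. parallel_space \<mu>)"
  have "finite (facets \<Lambda>)" using L(1) unfolding facets_def by simp
  then have rat: "rational_subspace ?K"
    by (intro rational_subspace_Int rational_subspace_coord_space rational_subspace_INT)
       (assumption, rule rational_subspace_parallel_space[OF L(3)[OF fcells] L(2)[OF fcells]])
  have "u = 0" if uK: "u \<in> ?K" and int: "\<forall>j. u $ j \<in> \<int>" for u
  proof (rule ccontr)
    assume u0: "u \<noteq> 0"
    have uJ: "u \<in> coord_space J" using uK by simp
    let ?C = "\<lparr>cells = {span {u}}, weight = \<lambda>_. 1\<rparr> :: (real^'n) weighted_complex"
    let ?v = "SOME v. generic_displacement J \<Lambda> ?C v"
    have "0 < tropical_degree (stable_intersection J \<Lambda> ?C)"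
      using pos tropical_curve_line[OF uJ int u0] unfolding positive_divisor_def by blast
    then obtain A where A: "A \<in> facets (stable_intersection J \<Lambda> ?C)" "weight (stable_intersection J \<Lambda> ?C) A \<noteq> 0"
      unfolding tropical_degree_def by (metis less_numeral_extra(3) sum.neutral)
    have "A \<noteq> {}"
      using A(1) unfolding facets_def stable_intersection_def displaced_intersection_def by simp
    have w: "weight (stable_intersection J \<Lambda> ?C) A =
        (\<Sum>(\<sigma>, \<sigma>') \<in> {(\<sigma>, \<sigma>') \<in> facets \<Lambda> \<times> facets ?C. displaced_limit ?v \<sigma> \<sigma>' = A}.
           weight \<Lambda> \<sigma> * weight ?C \<sigma>' * cell_index J \<sigma> \<sigma>')"
      unfolding stable_intersection_def displaced_intersection_def by simp
    have "{(\<sigma>, \<sigma>') \<in> facets \<Lambda> \<times> facets ?C. displaced_limit ?v \<sigma> \<sigma>' = A} \<noteq> {}" (is "?P \<noteq> {}")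
    proof
      assume "?P = {}"
      then show False using A(2) unfolding w by (simp only: sum.empty)
    qed
    then obtain \<mu> l where \<mu>: "\<mu> \<in> facets \<Lambda>" "l \<in> facets ?C" "displaced_limit ?v \<mu> l = A" by blast
    have l: "l = span {u}" using \<mu>(2) unfolding facets_def by simp
    have "span (parallel_space \<mu> \<union> parallel_space l) = coord_space J"
    proof (rule stable_intersection_cells(2)[of \<Lambda> ?C])
      show "rational_polyhedron J \<sigma>" if "\<sigma> \<in> cells ?C" for \<sigma>
        using that rational_polyhedron_span_integral[OF uJ int u0] by simp
    qed (use L(1,3) fcells \<mu> l \<open>A \<noteq> {}\<close> in auto)
    moreover have "parallel_space l \<subseteq> parallel_space \<mu>"
    proof -
      have "span {u} \<subseteq> parallel_space \<mu>" using uK \<mu>(1) by (intro span_minimal) auto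
      moreover have "parallel_space l \<subseteq> span {u}"
        unfolding l by (intro parallel_space_subset_subspace) (auto intro: span_diff)
      ultimately show ?thesis by blast
    qed
    then have "span (parallel_space \<mu> \<union> parallel_space l) = parallel_space \<mu>"
      by (simp add: Un_absorb2 span_eq_iff[THEN iffD2])
    ultimately have "dim (parallel_space \<mu>) = card J" using dim_coord_space[of J] by simp
    moreover have "int (dim (parallel_space \<mu>)) = int d"
      using \<mu>(1) L(2,6) by (simp add: cells_of_dim_def flip: aff_dim_eq_dim_parallel_space)
    ultimately show False using d(1) by simp
  qed
  then have "{x \<in> ?K. \<forall>j. x $ j \<in> \<int>} \<subseteq> {0}" by blast
  from span_mono[OF this] have "?K \<subseteq> {0}" using rational_subspace_span_integral[OF rat] by simp
  then show ?thesis using x by blast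
qed

section \<open>Positivity of the multidegree implies the dimension inequalities\<close>

text \<open>
  Values of the functionals \<open>a k\<close> at a point of \<open>L\<close> can be prescribed arbitrarily; for finite \<open>S\<close> and
  subspaces \<open>L\<close> this means that the functionals are linearly independent on \<open>L\<close>.
\<close>

definition independent_on :: "'a::euclidean_space set \<Rightarrow> ('k \<Rightarrow> 'a) \<Rightarrow> 'k set \<Rightarrow> bool" where
  "independent_on L a S \<longleftrightarrow> (\<forall>z :: 'k \<Rightarrow> real. \<exists>x\<in>L. \<forall>k\<in>S. a k \<bullet> x = z k)"

lemma independent_on_imp_card_le_dim:
  fixes S :: "'k set"
  assumes "independent_on L a S" "finite S"
  shows "card S \<le> dim L"
proof -
  have "\<exists>x\<in>L. \<forall>k\<in>S. a k \<bullet> x = (if k = l then 1 else 0)" for l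
    using assms(1) unfolding independent_on_def by (rule spec[where x = "\<lambda>k. if k = l then 1 else 0"])
  then obtain x where x: "\<And>l. x l \<in> L" "\<And>k l. k \<in> S \<Longrightarrow> a k \<bullet> x l = (if k = l then 1 else 0)"
    by metis
  have inj: "inj_on x S"
  proof (rule inj_onI)
    fix k l assume kl: "k \<in> S" "l \<in> S" "x k = x l"
    then have "a k \<bullet> x k = a k \<bullet> x l" by simp
    then show "k = l" using x(2)[OF kl(1), of k] x(2)[OF kl(1), of l] by (simp split: if_splits)
  qed
  have "independent (x ` S)"
  proof (rule independent_if_scalars_zero)
    show "finite (x ` S)" using assms(2) by simp
    fix f :: "'a \<Rightarrow> real" and v assume sum: "(\<Sum>v\<in>x ` S. f v *\<^sub>R v) = 0" and v: "v \<in> x ` S"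
    obtain k where k: "k \<in> S" "v = x k" using v by blast
    have "0 = a k \<bullet> (\<Sum>l\<in>S. f (x l) *\<^sub>R x l)" using sum sum.reindex[OF inj, of "\<lambda>v. f v *\<^sub>R v"] by simp
    also have "\<dots> = (\<Sum>l\<in>S. f (x l) * (a k \<bullet> x l))" by (simp add: inner_sum_right)
    also have "\<dots> = (\<Sum>l\<in>S. if k = l then f (x l) else 0)"
      using x(2)[OF k(1)] by (intro sum.cong) auto
    also have "\<dots> = f (x k)" using k(1) assms(2) by simp
    finally show "f v = 0" using k(2) by simp
  qed
  moreover have "x ` S \<subseteq> L" using x(1) by blast
  ultimately have "card (x ` S) \<le> dim L" by (intro independent_card_le_dim)
  then show ?thesis using card_image[OF inj] by simp
qed

text \<open>
  The values of the functionals in \<open>T\<close> depend on the component in \<open>A\<close> only, and adding an element of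
  \<open>A\<close> does not change the values of the functionals in \<open>S\<close>.
\<close>

lemma independent_on_Un:
  assumes a: "independent_on L a S" and b: "independent_on UNIV a T"
    and A: "A \<subseteq> L" "\<And>k w. k \<in> S \<Longrightarrow> w \<in> A \<Longrightarrow> a k \<bullet> w = 0"
    and B: "\<And>k w. k \<in> T \<Longrightarrow> w \<in> B \<Longrightarrow> a k \<bullet> w = 0"
    and sub: "subspace L" "subspace A" "subspace B" "span (A \<union> B) = UNIV"
  shows "independent_on L a (S \<union> T)"
  unfolding independent_on_def
proof
  fix z :: "'b \<Rightarrow> real"
  obtain x where x: "x \<in> L" "\<And>k. k \<in> S \<Longrightarrow> a k \<bullet> x = z k"
    using a unfolding independent_on_def by blast
  obtain y where y: "\<And>k. k \<in> T \<Longrightarrow> a k \<bullet> y = z k - a k \<bullet> x"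
    using b unfolding independent_on_def by (drule_tac spec[of _ "\<lambda>k. z k - a k \<bullet> x"]) blast
  have "y \<in> span (A \<union> B)" using sub(4) by simp
  then obtain u w where uw: "u \<in> A" "w \<in> B" "y = u + w"
    unfolding span_Un using sub(2,3) by (auto simp: span_eq_iff[THEN iffD2])
  have "a k \<bullet> (x + u) = z k" if "k \<in> S \<union> T" for k
  proof (cases "k \<in> S")
    case True
    then show ?thesis using x(2) A(2) uw(1) by (simp add: inner_add_right)
  next
    case False
    then have "k \<in> T" using that by blast
    then show ?thesis using y[of k] B[of k w] uw(2,3) by (simp add: inner_add_right)
  qed
  moreover have "x + u \<in> L" using x(1) uw(1) A(1) by (intro subspace_add[OF sub(1)]) auto
  ultimately show "\<exists>x\<in>L. \<forall>k\<in>S \<union> T. a k \<bullet> x = z k" by blast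
qed

lemma independent_on_cong:
  assumes "independent_on L a S" "\<And>k. k \<in> S \<Longrightarrow> a k = b k"
  shows "independent_on L b S"
  using assms unfolding independent_on_def by simp

lemma positive_complex_whole_space:
  "positive_complex (int CARD('n)) (whole_space UNIV :: (real^'n::finite) weighted_complex)"
  unfolding positive_complex_def whole_space_def rational_polyhedron_UNIV_iff
  by (auto intro!: exI[of _ "{}"])

lemma positive_complex_stable_power:
  fixes D :: "(real^'n::finite) weighted_complex"
  assumes "positive_complex (int CARD('n) - 1) D"
  shows "positive_complex (int CARD('n) - int k) (stable_power UNIV D k)"
proof (induction k)
  case 0
  then show ?case using positive_complex_whole_space by simp
next
  case (Suc k)
  then show ?case using positive_complex_stable_intersection[OF Suc assms] by (simp add: algebra_simps)
qed

lemma positive_complex_cellE: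
  fixes X Y :: "(real^'n::finite) weighted_complex"
  assumes "positive_complex e X" "positive_complex e' Y" "A \<in> cells (stable_intersection UNIV X Y)"
  obtains \<sigma> \<sigma>' where "\<sigma> \<in> cells X" "\<sigma>' \<in> cells Y" "A = \<sigma> \<inter> \<sigma>'"
    "span (parallel_space \<sigma> \<union> parallel_space \<sigma>') = UNIV"
proof -
  note X = positive_complexD[OF assms(1)] and Y = positive_complexD[OF assms(2)]
  show ?thesis
    by (rule stable_intersection_cellE[OF X(1) Y(1) X(3) Y(3) assms(3)]) (use that in simp_all)
qed

text \<open>
  The cells whose intersection is a cell of a stable intersection are transversal; so the normals of
  the second are independent of those of the first, and the codimensions add up.
\<close>

lemma stable_power_cell_normals:
  fixes D :: "(real^'n::finite) weighted_complex"
  assumes D: "positive_complex (int CARD('n) - 1) D"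
    and normal: "\<And>\<mu>. \<mu> \<in> cells D \<Longrightarrow> \<exists>a\<in>V. a \<noteq> 0 \<and> (\<forall>w\<in>parallel_space \<mu>. a \<bullet> w = 0)"
    and A: "A \<in> cells (stable_power UNIV D k)"
  shows "\<exists>a. (\<forall>j\<in>{1..k}. a j \<in> V) \<and> independent_on UNIV a {1..k} \<and>
           (\<forall>j\<in>{1..k}. \<forall>w\<in>parallel_space A. a j \<bullet> w = 0)"
  using A
proof (induction k arbitrary: A)
  case 0
  then show ?case by (auto simp: independent_on_def)
next
  case (Suc k)
  then have "A \<in> cells (stable_intersection UNIV (stable_power UNIV D k) D)" by simp
  then obtain A' \<mu> where A': "A' \<in> cells (stable_power UNIV D k)" "\<mu> \<in> cells D" "A = A' \<inter> \<mu>"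
      "span (parallel_space A' \<union> parallel_space \<mu>) = UNIV"
    by (rule positive_complex_cellE[OF positive_complex_stable_power[OF D] D])
  obtain a where a: "\<forall>j\<in>{1..k}. a j \<in> V" "independent_on UNIV a {1..k}"
      "\<forall>j\<in>{1..k}. \<forall>w\<in>parallel_space A'. a j \<bullet> w = 0" using Suc.IH[OF A'(1)] by blast
  obtain b where b: "b \<in> V" "b \<noteq> 0" "\<forall>w\<in>parallel_space \<mu>. b \<bullet> w = 0" using normal[OF A'(2)] by blast
  define c where "c = a(Suc k := b)"
  have c_le: "c j = a j" if "j \<in> {1..k}" for j using that unfolding c_def by simp
  have c_Suc: "c (Suc k) = b" unfolding c_def by simp
  have S: "{1..Suc k} = {1..k} \<union> {Suc k}" by auto
  have sub: "parallel_space A \<subseteq> parallel_space A'" "parallel_space A \<subseteq> parallel_space \<mu>"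
    unfolding A'(3) by (auto intro: parallel_space_mono[THEN subsetD, rotated])
  have "independent_on UNIV c ({1..k} \<union> {Suc k})"
  proof (rule independent_on_Un[where A = "parallel_space A'" and B = "parallel_space \<mu>"])
    show "independent_on UNIV c {1..k}" by (rule independent_on_cong[OF a(2)]) (simp add: c_le)
    show "independent_on UNIV c {Suc k}"
      unfolding independent_on_def
    proof
      fix z :: "nat \<Rightarrow> real"
      have "c (Suc k) \<bullet> ((z (Suc k) / (b \<bullet> b)) *\<^sub>R b) = z (Suc k)" using b(2) c_Suc by simp
      then show "\<exists>x\<in>UNIV. \<forall>j\<in>{Suc k}. c j \<bullet> x = z j" by blast
    qed
  qed (use a(3) b(3) c_le c_Suc A'(4) in auto)
  moreover have "\<forall>j\<in>{1..Suc k}. c j \<in> V \<and> (\<forall>w\<in>parallel_space A. c j \<bullet> w = 0)"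
    unfolding S using a b c_le c_Suc sub by auto
  ultimately show ?case unfolding S by blast
qed

text \<open>The intersection in the definition of the multidegree, after the first \<open>k\<close> factors.\<close>

abbreviation iterated_intersection ::
    "(real^'n::finite) weighted_complex \<Rightarrow> (nat \<Rightarrow> (real^'n) weighted_complex) \<Rightarrow> (nat \<Rightarrow> nat) \<Rightarrow> nat \<Rightarrow>
     (real^'n) weighted_complex" where
  "iterated_intersection \<Gamma> D n k \<equiv>
     foldl (\<lambda>\<Delta> i. stable_intersection UNIV \<Delta> (stable_power UNIV (D i) (n i))) \<Gamma> [1..<Suc k]"

lemma upt_foldl_Suc: "foldl f x [1..<Suc (Suc k)] = f (foldl f x [1..<Suc k]) (Suc k)"
  by (simp add: upt_Suc_append)

lemma positive_complex_iterated:
  fixes \<Gamma> :: "(real^'n::finite) weighted_complex"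
  assumes \<Gamma>: "positive_complex (int d) \<Gamma>"
    and D: "\<And>i. i \<in> {1..k} \<Longrightarrow> positive_complex (int CARD('n) - 1) (D i)"
  shows "positive_complex (int d - (\<Sum>i=1..k. int (n i)))
     (iterated_intersection \<Gamma> D n k)"
  using D
proof (induction k)
  case (Suc k)
  have "positive_complex (int CARD('n) - int (n (Suc k))) (stable_power UNIV (D (Suc k)) (n (Suc k)))"
    by (rule positive_complex_stable_power) (use Suc.prems in simp)
  moreover have "positive_complex (int d - (\<Sum>i=1..k. int (n i)))
     (iterated_intersection \<Gamma> D n k)"
    using Suc by simp
  ultimately show ?case
    unfolding upt_foldl_Suc using positive_complex_stable_intersection by (fastforce simp: algebra_simps)
qed (use \<Gamma> in simp)

lemma iterated_cell_normals:
  fixes \<Gamma> :: "(real^'n::finite) weighted_complex"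
  assumes \<Gamma>: "positive_complex (int d) \<Gamma>"
    and D: "\<And>i. i \<in> {1..k} \<Longrightarrow> positive_complex (int CARD('n) - 1) (D i)"
    and normal: "\<And>i \<mu>. i \<in> {1..k} \<Longrightarrow> \<mu> \<in> cells (D i) \<Longrightarrow>
       \<exists>a\<in>V i. a \<noteq> 0 \<and> (\<forall>w\<in>parallel_space \<mu>. a \<bullet> w = 0)"
    and A: "A \<in> cells (iterated_intersection \<Gamma> D n k)"
  shows "\<exists>\<sigma>\<in>cells \<Gamma>. \<exists>a :: nat \<times> nat \<Rightarrow> real^'n.
     (\<forall>(i, j)\<in>(SIGMA i:{1..k}. {1..n i}). a (i, j) \<in> V i) \<and>
     independent_on (parallel_space \<sigma>) a (SIGMA i:{1..k}. {1..n i}) \<and>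
     (\<forall>q\<in>(SIGMA i:{1..k}. {1..n i}). \<forall>w\<in>parallel_space A. a q \<bullet> w = 0) \<and>
     parallel_space A \<subseteq> parallel_space \<sigma>"
  using D normal A
proof (induction k arbitrary: A)
  case 0
  then have "A \<in> cells \<Gamma>" by simp
  then show ?case
    by (intro bexI[of _ A] exI[of _ "\<lambda>_. 0"]) (auto simp: independent_on_def intro: exI[of _ 0])
next
  case (Suc k)
  let ?X = "iterated_intersection \<Gamma> D n k"
  let ?S = "\<lambda>k. SIGMA i:{1..k}. {1..n i}"
  have D': "positive_complex (int CARD('n) - 1) (D (Suc k))" using Suc.prems(1) by simp
  have A: "A \<in> cells (stable_intersection UNIV ?X (stable_power UNIV (D (Suc k)) (n (Suc k))))"
    using Suc.prems(3) unfolding upt_foldl_Suc .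
  have X: "positive_complex (int d - (\<Sum>i=1..k. int (n i))) ?X"
    by (rule positive_complex_iterated[OF \<Gamma>]) (use Suc.prems(1) in simp)
  obtain A' M where A': "A' \<in> cells ?X" "M \<in> cells (stable_power UNIV (D (Suc k)) (n (Suc k)))"
      "A = A' \<inter> M" "span (parallel_space A' \<union> parallel_space M) = UNIV"
    by (rule positive_complex_cellE[OF X positive_complex_stable_power[OF D'] A])
  have "\<exists>\<sigma>\<in>cells \<Gamma>. \<exists>a :: nat \<times> nat \<Rightarrow> real^'n.
     (\<forall>(i, j)\<in>?S k. a (i, j) \<in> V i) \<and> independent_on (parallel_space \<sigma>) a (?S k) \<and>
     (\<forall>q\<in>?S k. \<forall>w\<in>parallel_space A'. a q \<bullet> w = 0) \<and> parallel_space A' \<subseteq> parallel_space \<sigma>"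
    by (rule Suc.IH) (use Suc.prems A'(1) in simp_all)
  then obtain \<sigma> a where \<sigma>: "\<sigma> \<in> cells \<Gamma>" and a: "\<And>i j. (i, j) \<in> ?S k \<Longrightarrow> a (i, j) \<in> V i"
      "independent_on (parallel_space \<sigma>) a (?S k)"
      "\<And>q w. q \<in> ?S k \<Longrightarrow> w \<in> parallel_space A' \<Longrightarrow> a q \<bullet> w = 0"
      "parallel_space A' \<subseteq> parallel_space \<sigma>" by blast
  obtain b where b: "\<forall>j\<in>{1..n (Suc k)}. b j \<in> V (Suc k)" "independent_on UNIV b {1..n (Suc k)}"
      "\<forall>j\<in>{1..n (Suc k)}. \<forall>w\<in>parallel_space M. b j \<bullet> w = 0"
    using stable_power_cell_normals[OF D' _ A'(2), of "V (Suc k)"] Suc.prems(2)[of "Suc k"] by auto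
  define c where "c = (\<lambda>(i, j). if i = Suc k then b j else a (i, j))"
  let ?T = "Pair (Suc k) ` {1..n (Suc k)}"
  have S: "?S (Suc k) = ?S k \<union> ?T" by (auto simp: le_Suc_eq)
  have c_S: "c q = a q" if "q \<in> ?S k" for q using that unfolding c_def by (cases q) auto
  have c_T: "c (Suc k, j) = b j" for j unfolding c_def by simp
  have sub: "parallel_space A \<subseteq> parallel_space A'" "parallel_space A \<subseteq> parallel_space M"
    unfolding A'(3) by (auto intro: parallel_space_mono[THEN subsetD, rotated])
  have "independent_on (parallel_space \<sigma>) c (?S k \<union> ?T)"
  proof (rule independent_on_Un[where A = "parallel_space A'" and B = "parallel_space M"])
    show "independent_on (parallel_space \<sigma>) c (?S k)" by (rule independent_on_cong[OF a(2)]) (simp only: c_S)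
    show "independent_on UNIV c ?T"
      unfolding independent_on_def
    proof
      fix z :: "nat \<times> nat \<Rightarrow> real"
      obtain x where "\<forall>j\<in>{1..n (Suc k)}. b j \<bullet> x = z (Suc k, j)"
        using b(2) unfolding independent_on_def by (drule_tac spec[of _ "\<lambda>j. z (Suc k, j)"]) blast
      then show "\<exists>x\<in>UNIV. \<forall>q\<in>?T. c q \<bullet> x = z q" using c_T by auto
    qed
    show "c q \<bullet> w = 0" if "q \<in> ?S k" "w \<in> parallel_space A'" for q w
      using a(3)[OF that] c_S[OF that(1)] by simp
    show "c q \<bullet> w = 0" if "q \<in> ?T" "w \<in> parallel_space M" for q w
      using b(3) that c_T by auto
  qed (use a(4) A'(4) in auto)
  moreover have "c (i, j) \<in> V i \<and> (\<forall>w\<in>parallel_space A. c (i, j) \<bullet> w = 0)"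
    if q: "(i, j) \<in> ?S k \<union> ?T" for i j
  proof (cases "(i, j) \<in> ?S k")
    case True
    then show ?thesis using a(1,3) c_S[OF True] sub(1) by auto
  next
    case False
    then have "i = Suc k" "j \<in> {1..n (Suc k)}" using q by auto
    then show ?thesis using b(1,3) c_T sub(2) by auto
  qed
  then have "(\<forall>(i, j)\<in>?S k \<union> ?T. c (i, j) \<in> V i) \<and>
      (\<forall>q\<in>?S k \<union> ?T. \<forall>w\<in>parallel_space A. c q \<bullet> w = 0)" by blast
  moreover have "parallel_space A \<subseteq> parallel_space \<sigma>" using sub(1) a(4) by blast
  ultimately show ?case unfolding S using \<sigma> by blast
qed

lemma exists_normal:
  fixes \<Lambda> :: "(real^'n::finite) weighted_complex"
  assumes \<Lambda>: "tropical_variety J d \<Lambda>" "Suc d = card J" and \<mu>: "\<mu> \<in> cells (proj_preimage J \<Lambda>)"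
  shows "\<exists>a\<in>coord_space J. a \<noteq> 0 \<and> (\<forall>w\<in>parallel_space \<mu>. a \<bullet> w = 0)"
proof -
  note L = tropical_varietyD[OF \<Lambda>(1)]
  obtain \<sigma> where \<sigma>: "\<sigma> \<in> cells \<Lambda>" "\<mu> = coord_proj J -` \<sigma>" using \<mu> unfolding cells_proj_preimage by blast
  have in_J: "\<sigma> \<subseteq> coord_space J" using L(3)[OF \<sigma>(1)] unfolding rational_polyhedron_def by auto
  have "int (dim (parallel_space \<sigma>)) \<le> int d"
    using L(5)[OF \<sigma>(1)] aff_dim_eq_dim_parallel_space[OF L(2)[OF \<sigma>(1)]] by simp
  then have "parallel_space \<sigma> \<noteq> coord_space J" using dim_coord_space[of J] \<Lambda>(2) by auto
  then have "span (parallel_space \<sigma>) \<subset> span (coord_space J)"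
    using parallel_space_subset_coord_space[OF in_J]
    by (simp add: span_eq_iff[THEN iffD2] subspace_coord_space psubset_eq)
  then obtain a where a: "a \<noteq> 0" "a \<in> span (coord_space J)" "\<And>y. y \<in> span (parallel_space \<sigma>) \<Longrightarrow> orthogonal a y"
    using orthogonal_to_subspace_exists_gen by blast
  have aJ: "a \<in> coord_space J" using a(2) by (simp add: span_eq_iff[THEN iffD2] subspace_coord_space)
  have "a \<bullet> w = 0" if w: "w \<in> parallel_space \<mu>" for w
  proof -
    have "coord_proj J w \<in> parallel_space \<sigma>"
      using w unfolding \<sigma>(2) parallel_space_vimage[OF in_J L(2)[OF \<sigma>(1)]] by simp
    then have "a \<bullet> coord_proj J w = 0" using a(3)[OF span_base] unfolding orthogonal_def by blast
    then show ?thesis using coord_proj_adjoint[of a J w] coord_proj_id[OF aJ] by simp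
  qed
  then show ?thesis using a(1) aJ by blast
qed

lemma aff_dim_coord_proj:
  "\<sigma> \<noteq> {} \<Longrightarrow> aff_dim (coord_proj J ` \<sigma>) = int (dim (coord_proj J ` parallel_space \<sigma>))"
  by (simp add: aff_dim_eq_dim_parallel_space parallel_space_linear_image[OF linear_coord_proj])

text \<open>
  A functional that depends on the coordinates in \<open>J\<close> only takes the same value at a point and at its
  projection.
\<close>

lemma independent_on_coord_proj:
  fixes L :: "(real^'n::finite) set"
  assumes "independent_on L a S" "T \<subseteq> S" "\<And>q. q \<in> T \<Longrightarrow> a q \<in> coord_space J"
  shows "independent_on (coord_proj J ` L) a T"
  unfolding independent_on_def
proof
  fix z :: "'a \<Rightarrow> real"
  obtain x where x: "x \<in> L" "\<And>k. k \<in> S \<Longrightarrow> a k \<bullet> x = z k"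
    using assms(1) unfolding independent_on_def by blast
  have "a k \<bullet> coord_proj J x = z k" if k: "k \<in> T" for k
    using x(2)[of k] assms(2) k coord_proj_adjoint[of "a k" J x] coord_proj_id[OF assms(3)[OF k]] by auto
  then show "\<exists>y\<in>coord_proj J ` L. \<forall>k\<in>T. a k \<bullet> y = z k" using x(1) by blast
qed

lemma coord_space_mono: "J \<subseteq> J' \<Longrightarrow> coord_space J \<subseteq> coord_space J'"
  unfolding coord_space_def by blast

lemma tropical_degree_pos_iff:
  assumes "positive_complex 0 X"
  shows "0 < tropical_degree X \<longleftrightarrow> cells X \<noteq> {}"
proof
  assume "0 < tropical_degree X"
  then show "cells X \<noteq> {}" unfolding tropical_degree_def facets_def by (auto intro: ccontr)
next
  assume "cells X \<noteq> {}"
  then obtain \<sigma> where \<sigma>: "\<sigma> \<in> cells X" by blast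
  have dim0: "aff_dim \<tau> = 0" if "\<tau> \<in> cells X" for \<tau>
  proof -
    have "0 \<le> aff_dim \<tau>" using aff_dim_eq_dim_parallel_space[OF positive_complexD(2)[OF assms that]] by simp
    then show ?thesis using positive_complexD(4)[OF assms that] by simp
  qed
  then have fac: "facets X = cells X" unfolding facets_def by auto
  have "0 < weight X \<sigma>" by (rule positive_complexD(5)[OF assms \<sigma> dim0[OF \<sigma>]])
  then show "0 < tropical_degree X"
    unfolding tropical_degree_def fac using positive_complexD(1)[OF assms] \<sigma> by (intro sum_pos2) auto
qed

lemma exists_facet_if_iterated_nonempty:
  fixes \<Gamma> :: "(real^'n::finite) weighted_complex" and b :: "'n \<Rightarrow> nat"
  assumes \<Gamma>: "tropical_variety UNIV d \<Gamma>"
    and \<Lambda>: "\<And>i. i \<in> {1..p} \<Longrightarrow> tropical_divisor (blocks b {i}) (\<Lambda> i)"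
    and ne: "cells (iterated_intersection \<Gamma> (\<lambda>i. proj_preimage (blocks b {i}) (\<Lambda> i)) n p) \<noteq> {}"
  shows "\<exists>\<sigma>\<in>facets \<Gamma>. \<forall>I\<subseteq>{1..p}. int (\<Sum>i\<in>I. n i) \<le> aff_dim (coord_proj (blocks b I) ` \<sigma>)"
proof -
  let ?D = "\<lambda>i. proj_preimage (blocks b {i}) (\<Lambda> i)" and ?V = "\<lambda>i. coord_space (blocks b {i})"
  have "\<exists>e. Suc e = card (blocks b {i}) \<and> tropical_variety (blocks b {i}) e (\<Lambda> i)" if "i \<in> {1..p}" for i
    using \<Lambda>[OF that] unfolding tropical_divisor_def .
  then obtain e where e: "\<And>i. i \<in> {1..p} \<Longrightarrow> Suc (e i) = card (blocks b {i})"
      "\<And>i. i \<in> {1..p} \<Longrightarrow> tropical_variety (blocks b {i}) (e i) (\<Lambda> i)" by metis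
  have D: "positive_complex (int CARD('n) - 1) (?D i)" if i: "i \<in> {1..p}" for i
  proof -
    have "int (e i) + int CARD('n) - int (card (blocks b {i})) = int CARD('n) - 1"
      using e(1)[OF i] by linarith
    then show ?thesis using positive_complex_proj_preimage[OF e(2)[OF i]] by (simp only:)
  qed
  obtain A where A: "A \<in> cells (iterated_intersection \<Gamma> ?D n p)" using ne by blast
  let ?S = "\<lambda>I. SIGMA i:I. {1..n i}"
  have "\<exists>\<sigma>\<in>cells \<Gamma>. \<exists>a :: nat \<times> nat \<Rightarrow> real^'n. (\<forall>(i, j)\<in>?S {1..p}. a (i, j) \<in> ?V i) \<and>
     independent_on (parallel_space \<sigma>) a (?S {1..p}) \<and>
     (\<forall>q\<in>?S {1..p}. \<forall>w\<in>parallel_space A. a q \<bullet> w = 0) \<and> parallel_space A \<subseteq> parallel_space \<sigma>"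
    by (rule iterated_cell_normals[OF positive_complex_tropical_variety[OF \<Gamma>] D _ A])
       (use exists_normal[OF e(2,1)] in blast)+
  then obtain \<sigma> and a :: "nat \<times> nat \<Rightarrow> real^'n" where \<sigma>: "\<sigma> \<in> cells \<Gamma>"
    and a: "\<And>i j. (i, j) \<in> ?S {1..p} \<Longrightarrow> a (i, j) \<in> ?V i" "independent_on (parallel_space \<sigma>) a (?S {1..p})"
    by blast
  obtain \<sigma>' where \<sigma>': "\<sigma>' \<in> facets \<Gamma>" "\<sigma> \<subseteq> \<sigma>'" using tropical_varietyD(7)[OF \<Gamma> \<sigma>] by blast
  have "int (\<Sum>i\<in>I. n i) \<le> aff_dim (coord_proj (blocks b I) ` \<sigma>')" if I: "I \<subseteq> {1..p}" for I
  proof -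
    have finI: "finite I" using I finite_subset by blast
    have mem: "a q \<in> coord_space (blocks b I)" if q: "q \<in> ?S I" for q
    proof -
      obtain i j where ij: "q = (i, j)" "i \<in> I" "j \<in> {1..n i}" using q by blast
      have "a q \<in> ?V i" unfolding ij(1) by (rule a(1)) (use ij(2,3) I in blast)
      moreover have "blocks b {i} \<subseteq> blocks b I" using ij(2) unfolding blocks_def by auto
      ultimately show ?thesis using coord_space_mono by blast
    qed
    have "independent_on (coord_proj (blocks b I) ` parallel_space \<sigma>) a (?S I)"
      by (rule independent_on_coord_proj[OF a(2) _ mem]) (use I in blast)+
    then have "card (?S I) \<le> dim (coord_proj (blocks b I) ` parallel_space \<sigma>)"
      by (rule independent_on_imp_card_le_dim) (use finI in simp)
    then have "(\<Sum>i\<in>I. n i) \<le> dim (coord_proj (blocks b I) ` parallel_space \<sigma>)"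
      using finI by simp
    then have "int (\<Sum>i\<in>I. n i) \<le> aff_dim (coord_proj (blocks b I) ` \<sigma>)"
      unfolding aff_dim_coord_proj[OF tropical_varietyD(2)[OF \<Gamma> \<sigma>]] by (simp only: of_nat_le_iff)
    also have "\<dots> \<le> aff_dim (coord_proj (blocks b I) ` \<sigma>')" using \<sigma>'(2) by (intro aff_dim_subset) auto
    finally show ?thesis .
  qed
  then show ?thesis using \<sigma>'(1) by blast
qed

section \<open>The dimension inequalities imply positivity of the multidegree\<close>

text \<open>
  Slots are addressed through an injection \<open>\<phi>\<close> of an index set \<open>I\<close>; the slots that are left over are
  filled with a default value.
\<close>

definition spread :: "('i \<Rightarrow> 'k) \<Rightarrow> 'i set \<Rightarrow> 'b \<Rightarrow> ('i \<Rightarrow> 'b) \<Rightarrow> 'k \<Rightarrow> 'b" where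
  "spread \<phi> I x F r = (if r \<in> \<phi> ` I then F (inv_into I \<phi> r) else x)"

lemma spread_at: "inj_on \<phi> I \<Longrightarrow> q \<in> I \<Longrightarrow> spread \<phi> I x F (\<phi> q) = F q"
  unfolding spread_def by simp

lemma spread_outside: "r \<notin> \<phi> ` I \<Longrightarrow> spread \<phi> I x F r = x"
  unfolding spread_def by simp

lemma spread_upd:
  assumes "inj_on \<phi> I" "q \<in> I"
  shows "(spread \<phi> I x F)(\<phi> q := y) = spread \<phi> I x (F(q := y))"
proof
  fix r
  show "((spread \<phi> I x F)(\<phi> q := y)) r = spread \<phi> I x (F(q := y)) r"
    using assms inv_into_f_eq[OF assms(1)] inv_into_into[of r \<phi> I] f_inv_into_f[of r \<phi> I]
    unfolding spread_def by auto
qed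

lemma spread_cong: "(\<And>q. q \<in> I \<Longrightarrow> F q = G q) \<Longrightarrow> spread \<phi> I x F = spread \<phi> I x G"
  unfolding spread_def by (auto simp: inv_into_into)

lemma sum_spread:
  fixes \<phi> :: "'i \<Rightarrow> 'k::finite" and F :: "'i \<Rightarrow> int"
  assumes "inj_on \<phi> I" "finite I"
  shows "(\<Sum>r\<in>UNIV. spread \<phi> I x F r) = (\<Sum>q\<in>I. F q) + (int CARD('k) - int (card I)) * x"
proof -
  have "(\<Sum>r\<in>UNIV. spread \<phi> I x F r) = (\<Sum>r\<in>\<phi> ` I. spread \<phi> I x F r) + (\<Sum>r\<in>- (\<phi> ` I). spread \<phi> I x F r)"
    using sum.union_disjoint[of "\<phi> ` I" "- (\<phi> ` I)" "spread \<phi> I x F"] by (simp add: Compl_partition)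
  also have "(\<Sum>r\<in>\<phi> ` I. spread \<phi> I x F r) = (\<Sum>q\<in>I. F q)"
    unfolding sum.reindex[OF assms(1)] by (intro sum.cong) (simp_all add: spread_at[OF assms(1)])
  also have "(\<Sum>r\<in>- (\<phi> ` I). spread \<phi> I x F r) = (\<Sum>r\<in>- (\<phi> ` I). x)"
    by (rule sum.cong) (auto simp: spread_def)
  also have "\<dots> = int (card (- (\<phi> ` I))) * x" by simp
  also have "int (card (- (\<phi> ` I))) = int CARD('k) - int (card I)"
  proof -
    have "card (\<phi> ` I) + card (- (\<phi> ` I)) = CARD('k)"
      using card_Un_disjoint[of "\<phi> ` I" "- (\<phi> ` I)"] by (simp add: Compl_partition)
    then show ?thesis using card_image[OF assms(1)] by simp
  qed
  finally show ?thesis .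
qed

text \<open>
  By \<open>positive_divisor_facets_separate\<close> the facet normals of a positive divisor span the space in
  which it lies. This is expressed through their common kernel, since Rado's theorem is applied to
  kernels.
\<close>

lemma facet_normals_kernel:
  fixes \<Lambda> :: "(real^'n::finite) weighted_complex"
  assumes pos: "positive_divisor J \<Lambda>"
  shows "(\<forall>a\<in>{a. \<exists>\<mu>\<in>cells_of_dim (int CARD('n) - 1) (proj_preimage J \<Lambda>). parallel_space \<mu> = {x. a \<bullet> x = 0}}. a \<bullet> x = 0)
     \<longleftrightarrow> coord_proj J x = 0"
    (is "(\<forall>a\<in>?E. a \<bullet> x = 0) \<longleftrightarrow> _")
proof -
  obtain d where d: "Suc d = card J" "tropical_variety J d \<Lambda>"
    using pos unfolding positive_divisor_def tropical_divisor_def by blast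
  note L = tropical_varietyD[OF d(2)]
  have in_J: "\<sigma> \<subseteq> coord_space J" if "\<sigma> \<in> cells \<Lambda>" for \<sigma>
    using L(3)[OF that] unfolding rational_polyhedron_def by auto
  show ?thesis
  proof
    assume x: "\<forall>a\<in>?E. a \<bullet> x = 0"
    have "coord_proj J x \<in> parallel_space \<mu>" if \<mu>: "\<mu> \<in> facets \<Lambda>" for \<mu>
    proof -
      let ?M = "coord_proj J -` \<mu>"
      have c: "\<mu> \<in> cells \<Lambda>" "aff_dim \<mu> = int d" using \<mu> unfolding L(6) cells_of_dim_def by auto
      have dimM: "aff_dim ?M = int CARD('n) - 1"
        using aff_dim_vimage_coord_proj[OF in_J L(2)] c d(1) by force
      have neM: "?M \<noteq> {}" using coord_proj_image_vimage[OF in_J[OF c(1)]] L(2)[OF c(1)] by blast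
      have "int (dim (parallel_space ?M)) = int CARD('n) - 1"
        using aff_dim_eq_dim_parallel_space[OF neM] dimM by simp
      then have "dim (parallel_space ?M) = DIM(real^'n) - 1" by simp
      then obtain a where a: "span (parallel_space ?M) = {x. a \<bullet> x = 0}"
        using dim_eq_hyperplane by blast
      then have a': "parallel_space ?M = {x. a \<bullet> x = 0}" by (simp add: span_eq_iff[THEN iffD2])
      have "?M \<in> cells_of_dim (int CARD('n) - 1) (proj_preimage J \<Lambda>)"
        unfolding cells_of_dim_def cells_proj_preimage using c(1) dimM by blast
      then have "a \<bullet> x = 0" using x a' by blast
      then have "x \<in> parallel_space ?M" using a' by blast
      then show ?thesis using parallel_space_vimage[OF in_J[OF c(1)] L(2)[OF c(1)]] by blast
    qed
    then show "coord_proj J x = 0"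
      by (intro positive_divisor_facets_separate[OF pos] coord_proj_in)
  next
    assume x: "coord_proj J x = 0"
    show "\<forall>a\<in>?E. a \<bullet> x = 0"
    proof
      fix a assume "a \<in> ?E"
      then obtain \<mu> where \<mu>: "\<mu> \<in> cells (proj_preimage J \<Lambda>)" "parallel_space \<mu> = {x. a \<bullet> x = 0}"
        unfolding cells_of_dim_def by blast
      then obtain \<sigma> where \<sigma>: "\<sigma> \<in> cells \<Lambda>" "\<mu> = coord_proj J -` \<sigma>" unfolding cells_proj_preimage by blast
      have "x \<in> parallel_space \<mu>"
        unfolding \<sigma>(2) parallel_space_vimage[OF in_J[OF \<sigma>(1)] L(2)[OF \<sigma>(1)]] using x by simp
      then show "a \<bullet> x = 0" using \<mu>(2) by blast
    qed
  qed
qed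

lemma positive_divisorD:
  fixes \<Lambda> :: "(real^'n::finite) weighted_complex"
  assumes "positive_divisor J \<Lambda>"
  shows "positive_complex (int CARD('n) - 1) (proj_preimage J \<Lambda>)"
    and "weakly_balanced_complex (int CARD('n) - 1) (cells (proj_preimage J \<Lambda>))"
proof -
  obtain d where d: "Suc d = card J" "tropical_variety J d \<Lambda>"
    using assms unfolding positive_divisor_def tropical_divisor_def by blast
  have e: "int d + int CARD('n) - int (card J) = int CARD('n) - 1" using d(1) by linarith
  show "positive_complex (int CARD('n) - 1) (proj_preimage J \<Lambda>)"
    using positive_complex_proj_preimage[OF d(2)] unfolding e .
  show "weakly_balanced_complex (int CARD('n) - 1) (cells (proj_preimage J \<Lambda>))"
    using weakly_balanced_complex_proj_preimage[OF weakly_balanced_complex_tropical_variety[OF d(2)] tropical_varietyD(3)[OF d(2)]]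
    unfolding e .
qed

text \<open>
  Slot \<open>(0, 0)\<close> holds \<open>\<Gamma>\<close>; slot \<open>(i, 0)\<close> holds the power of the divisor \<open>D i\<close> formed so far, at first
  the whole space; slots \<open>(i, 1), \<dots>, (i, n i)\<close> hold the copies of \<open>D i\<close> still to be intersected.
\<close>

definition slots :: "nat \<Rightarrow> (nat \<Rightarrow> nat) \<Rightarrow> (nat \<times> nat) set" where
  "slots p n = insert (0, 0) (SIGMA i:{1..p}. {0..n i})"

lemma finite_slots: "finite (slots p n)"
  unfolding slots_def by simp

lemma card_slots: "card (slots p n) = Suc (p + (\<Sum>i=1..p. n i))"
proof -
  have "(0, 0) \<notin> (SIGMA i:{1..p}. {0..n i})" by simp
  then have "card (slots p n) = Suc (card (SIGMA i:{1..p}. {0..n i}))" unfolding slots_def by simp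
  also have "card (SIGMA i:{1..p}. {0..n i}) = (\<Sum>i=1..p. Suc (n i))" by simp
  finally show ?thesis by (simp add: sum_Suc)
qed

lemma sum_slots:
  fixes F :: "nat \<times> nat \<Rightarrow> int"
  shows "(\<Sum>q\<in>slots p n. F q) = F (0, 0) + (\<Sum>i=1..p. F (i, 0) + (\<Sum>j=1..n i. F (i, j)))"
proof -
  have "(0, 0) \<notin> (SIGMA i:{1..p}. {0..n i})" by simp
  then have "(\<Sum>q\<in>slots p n. F q) = F (0, 0) + (\<Sum>q\<in>(SIGMA i:{1..p}. {0..n i}). F q)"
    unfolding slots_def by simp
  also have "(\<Sum>q\<in>(SIGMA i:{1..p}. {0..n i}). F q) = (\<Sum>i=1..p. \<Sum>j=0..n i. F (i, j))"
    by (simp add: sum.Sigma)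
  also have "\<dots> = (\<Sum>i=1..p. F (i, 0) + (\<Sum>j=1..n i. F (i, j)))"
    by (intro sum.cong refl) (simp add: sum.atLeast_Suc_atMost)
  finally show ?thesis .
qed

text \<open>The slots after \<open>l i\<close> copies of each \<open>D i\<close> have been intersected.\<close>

definition power_dims :: "int \<Rightarrow> int \<Rightarrow> (nat \<Rightarrow> nat) \<Rightarrow> nat \<times> nat \<Rightarrow> int" where
  "power_dims N d l = (\<lambda>(i, j). if i = 0 then d else if j = 0 then N - int (l i)
      else if j \<le> l i then N else N - 1)"

definition power_cells :: "(real^'n::finite) weighted_complex \<Rightarrow> int \<Rightarrow>
    (nat \<Rightarrow> (real^'n) weighted_complex) \<Rightarrow> (nat \<Rightarrow> nat) \<Rightarrow> nat \<times> nat \<Rightarrow> (real^'n) set set" where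
  "power_cells \<Gamma> d D l = (\<lambda>(i, j). if i = 0 then cells_of_dim d \<Gamma>
      else if j = 0 then cells_of_dim (int CARD('n) - int (l i)) (stable_power UNIV (D i) (l i))
      else if j \<le> l i then {UNIV} else cells_of_dim (int CARD('n) - 1) (D i))"

lemma covering_powers:
  fixes \<phi> :: "nat \<times> nat \<Rightarrow> 'k::finite" and \<Gamma> :: "(real^'n::finite) weighted_complex"
  assumes inj: "inj_on \<phi> (slots p n)"
    and D: "\<And>i. i \<in> {1..p} \<Longrightarrow> positive_complex (int CARD('n) - 1) (D i)"
    and start: "covering (spread \<phi> (slots p n) (int CARD('n)) (power_dims (int CARD('n)) d (\<lambda>_. 0)))
       (spread \<phi> (slots p n) {UNIV} (power_cells \<Gamma> d D (\<lambda>_. 0)))"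
    and l: "\<And>i. i \<in> {1..p} \<Longrightarrow> l i \<le> n i" "\<And>i. i \<notin> {1..p} \<Longrightarrow> l i = 0"
  shows "covering (spread \<phi> (slots p n) (int CARD('n)) (power_dims (int CARD('n)) d l))
     (spread \<phi> (slots p n) {UNIV} (power_cells \<Gamma> d D l))"
  using l
proof (induction "\<Sum>i=1..p. l i" arbitrary: l)
  case 0
  then have "l i = 0" for i by (cases "i \<in> {1..p}") auto
  then have "l = (\<lambda>_. 0)" by blast
  then show ?case using start by simp
next
  case (Suc k)
  let ?N = "int CARD('n)"
  have "(\<Sum>i=1..p. l i) \<noteq> 0" using Suc.hyps(2) by linarith
  then obtain i where i: "i \<in> {1..p}" "l i \<noteq> 0" using sum.not_neutral_contains_not_neutral by blast
  define l' where "l' = l(i := l i - 1)"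
  have li: "l i = Suc (l' i)" and l'_other: "\<And>i'. i' \<noteq> i \<Longrightarrow> l' i' = l i'" using i(2) unfolding l'_def by auto
  have "(\<Sum>i=1..p. l i) = Suc (\<Sum>i=1..p. l' i)"
  proof -
    have "(\<Sum>i'\<in>{1..p} - {i}. l i') = (\<Sum>i'\<in>{1..p} - {i}. l' i')" by (rule sum.cong) (auto simp: l'_other)
    then show ?thesis
      using li sum.remove[OF finite_atLeastAtMost i(1), of l] sum.remove[OF finite_atLeastAtMost i(1), of l'] by simp
  qed
  then have k: "k = (\<Sum>i=1..p. l' i)" using Suc.hyps(2) by simp
  have IH: "covering (spread \<phi> (slots p n) ?N (power_dims ?N d l')) (spread \<phi> (slots p n) {UNIV} (power_cells \<Gamma> d D l'))"
  proof (rule Suc.hyps(1)[OF k])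
    show "l' i' \<le> n i'" if "i' \<in> {1..p}" for i'
      using Suc.prems(1)[OF that] unfolding l'_def by (cases "i' = i") auto
    show "l' i' = 0" if "i' \<notin> {1..p}" for i'
      using Suc.prems(2)[OF that] unfolding l'_def by (cases "i' = i") auto
  qed
  have q: "(i, 0) \<in> slots p n" "(i, l i) \<in> slots p n" using i Suc.prems(1)[OF i(1)] unfolding slots_def by auto
  have ne: "\<phi> (i, 0) \<noteq> \<phi> (i, l i)" using inj_on_eq_iff[OF inj q] i(2) by simp
  have i0: "i \<noteq> 0" using i(1) by simp
  have dims: "power_dims ?N d l' (i, 0) = ?N - int (l' i)" "power_dims ?N d l' (i, l i) = ?N - 1"
    using i0 li unfolding power_dims_def by auto
  have cls: "power_cells \<Gamma> d D l' (i, 0) = cells_of_dim (?N - int (l' i)) (stable_power UNIV (D i) (l' i))"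
     "power_cells \<Gamma> d D l' (i, l i) = cells_of_dim (?N - 1) (D i)"
    using i0 li unfolding power_cells_def by auto
  have "covering ((spread \<phi> (slots p n) ?N (power_dims ?N d l'))(\<phi> (i, 0) := ?N - int (l' i) + (?N - 1) - ?N, \<phi> (i, l i) := ?N))
     ((spread \<phi> (slots p n) {UNIV} (power_cells \<Gamma> d D l'))(\<phi> (i, 0) :=
        cells_of_dim (?N - int (l' i) + (?N - 1) - ?N) (stable_intersection UNIV (stable_power UNIV (D i) (l' i)) (D i)),
        \<phi> (i, l i) := {UNIV}))"
    using covering_stable_intersection[OF IH ne, of "stable_power UNIV (D i) (l' i)" "D i"]
    unfolding spread_at[OF inj q(1)] spread_at[OF inj q(2)] dims cls
    using positive_complex_stable_power[OF D[OF i(1)]] D[OF i(1)] by simp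
  moreover have "(power_dims ?N d l')((i, 0) := ?N - int (l' i) + (?N - 1) - ?N, (i, l i) := ?N) = power_dims ?N d l"
  proof
    fix q
    show "((power_dims ?N d l')((i, 0) := ?N - int (l' i) + (?N - 1) - ?N, (i, l i) := ?N)) q = power_dims ?N d l q"
      using i0 li l'_other[of "fst q"] unfolding power_dims_def by (cases q) auto
  qed
  moreover have "(power_cells \<Gamma> d D l')((i, 0) :=
        cells_of_dim (?N - int (l' i) + (?N - 1) - ?N) (stable_intersection UNIV (stable_power UNIV (D i) (l' i)) (D i)),
        (i, l i) := {UNIV}) = power_cells \<Gamma> d D l"
  proof
    fix q
    show "((power_cells \<Gamma> d D l')((i, 0) :=
        cells_of_dim (?N - int (l' i) + (?N - 1) - ?N) (stable_intersection UNIV (stable_power UNIV (D i) (l' i)) (D i)),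
        (i, l i) := {UNIV})) q = power_cells \<Gamma> d D l q"
      using i0 li l'_other[of "fst q"] unfolding power_cells_def by (cases q) (auto simp: algebra_simps)
  qed
  ultimately show ?case
    unfolding spread_upd[OF inj q(1)] spread_upd[OF inj q(2)] by simp
qed

text \<open>The slots after the first \<open>k\<close> powers have been intersected with \<open>\<Gamma>\<close>.\<close>

definition product_dims :: "int \<Rightarrow> int \<Rightarrow> (nat \<Rightarrow> nat) \<Rightarrow> nat \<Rightarrow> nat \<times> nat \<Rightarrow> int" where
  "product_dims N d n k = (\<lambda>(i, j). if i = 0 then d - (\<Sum>i=1..k. int (n i))
      else if j = 0 \<and> k < i then N - int (n i) else N)"

definition product_cells :: "(real^'n::finite) weighted_complex \<Rightarrow> int \<Rightarrow>
    (nat \<Rightarrow> (real^'n) weighted_complex) \<Rightarrow> (nat \<Rightarrow> nat) \<Rightarrow> nat \<Rightarrow> nat \<times> nat \<Rightarrow> (real^'n) set set" where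
  "product_cells \<Gamma> d D n k = (\<lambda>(i, j). if i = 0 then cells_of_dim (d - (\<Sum>i=1..k. int (n i)))
         (iterated_intersection \<Gamma> D n k)
      else if j = 0 \<and> k < i then cells_of_dim (int CARD('n) - int (n i)) (stable_power UNIV (D i) (n i))
      else {UNIV})"

lemma covering_products:
  fixes \<phi> :: "nat \<times> nat \<Rightarrow> 'k::finite" and \<Gamma> :: "(real^'n::finite) weighted_complex"
  assumes inj: "inj_on \<phi> (slots p n)"
    and \<Gamma>: "positive_complex (int d) \<Gamma>"
    and D: "\<And>i. i \<in> {1..p} \<Longrightarrow> positive_complex (int CARD('n) - 1) (D i)"
    and start: "covering (spread \<phi> (slots p n) (int CARD('n)) (product_dims (int CARD('n)) (int d) n 0))
       (spread \<phi> (slots p n) {UNIV} (product_cells \<Gamma> (int d) D n 0))"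
    and "k \<le> p"
  shows "covering (spread \<phi> (slots p n) (int CARD('n)) (product_dims (int CARD('n)) (int d) n k))
     (spread \<phi> (slots p n) {UNIV} (product_cells \<Gamma> (int d) D n k))"
  using \<open>k \<le> p\<close>
proof (induction k)
  case 0
  then show ?case using start by simp
next
  case (Suc k)
  let ?N = "int CARD('n)" and ?d = "\<lambda>k. int d - (\<Sum>i=1..k. int (n i))"
  let ?X = "iterated_intersection \<Gamma> D n k"
  let ?Y = "stable_power UNIV (D (Suc k)) (n (Suc k))"
  have q: "(0, 0) \<in> slots p n" "(Suc k, 0) \<in> slots p n" using Suc.prems unfolding slots_def by auto
  have ne: "\<phi> (0, 0) \<noteq> \<phi> (Suc k, 0)" using inj_on_eq_iff[OF inj q] by simp
  have dims: "product_dims ?N (int d) n k (0, 0) = ?d k" "product_dims ?N (int d) n k (Suc k, 0) = ?N - int (n (Suc k))"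
    unfolding product_dims_def by auto
  have cls: "product_cells \<Gamma> (int d) D n k (0, 0) = cells_of_dim (?d k) ?X"
     "product_cells \<Gamma> (int d) D n k (Suc k, 0) = cells_of_dim (?N - int (n (Suc k))) ?Y"
    unfolding product_cells_def by auto
  have X: "positive_complex (?d k) ?X"
    by (rule positive_complex_iterated[OF \<Gamma>]) (use D Suc.prems in simp)
  have Y: "positive_complex (?N - int (n (Suc k))) ?Y"
    by (rule positive_complex_stable_power[OF D]) (use Suc.prems in simp)
  have IH: "covering (spread \<phi> (slots p n) ?N (product_dims ?N (int d) n k))
     (spread \<phi> (slots p n) {UNIV} (product_cells \<Gamma> (int d) D n k))" using Suc by simp
  have dk: "?d k + (?N - int (n (Suc k))) - ?N = ?d (Suc k)" by simp
  have "covering ((spread \<phi> (slots p n) ?N (product_dims ?N (int d) n k))(\<phi> (0, 0) := ?d (Suc k), \<phi> (Suc k, 0) := ?N))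
     ((spread \<phi> (slots p n) {UNIV} (product_cells \<Gamma> (int d) D n k))(\<phi> (0, 0) :=
        cells_of_dim (?d (Suc k)) (stable_intersection UNIV ?X ?Y), \<phi> (Suc k, 0) := {UNIV}))"
    using covering_stable_intersection[OF IH ne, of ?X ?Y]
    unfolding spread_at[OF inj q(1)] spread_at[OF inj q(2)] dims cls dk
    using X Y by blast
  moreover have "((product_dims ?N (int d) n k)((0, 0) := ?d (Suc k), (Suc k, 0) := ?N)) q = product_dims ?N (int d) n (Suc k) q"
    if "q \<in> slots p n" for q
    using that unfolding product_dims_def slots_def by (auto split: if_splits)
  then have "spread \<phi> (slots p n) ?N ((product_dims ?N (int d) n k)((0, 0) := ?d (Suc k), (Suc k, 0) := ?N))
      = spread \<phi> (slots p n) ?N (product_dims ?N (int d) n (Suc k))" by (rule spread_cong)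
  moreover have "((product_cells \<Gamma> (int d) D n k)((0, 0) := cells_of_dim (?d (Suc k)) (stable_intersection UNIV ?X ?Y),
        (Suc k, 0) := {UNIV})) q = product_cells \<Gamma> (int d) D n (Suc k) q"
    if "q \<in> slots p n" for q
    using that unfolding product_cells_def slots_def by (auto simp: upt_foldl_Suc simp del: upt_Suc One_nat_def split: if_splits)
  then have "spread \<phi> (slots p n) {UNIV} ((product_cells \<Gamma> (int d) D n k)((0, 0) :=
        cells_of_dim (?d (Suc k)) (stable_intersection UNIV ?X ?Y), (Suc k, 0) := {UNIV}))
      = spread \<phi> (slots p n) {UNIV} (product_cells \<Gamma> (int d) D n (Suc k))" by (rule spread_cong)
  ultimately show ?case
    unfolding spread_upd[OF inj q(1)] spread_upd[OF inj q(2)] by simp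
qed

text \<open>
  The common kernel of the facet normals of the divisors with index in \<open>I\<close> is the kernel of the
  projection to these factors. Rank and nullity turn the bound on the dimension of the image of \<open>\<sigma>\<close>
  into the hypothesis of Rado's theorem.
\<close>

lemma exists_transversal_facets:
  fixes \<Gamma> :: "(real^'n::finite) weighted_complex" and b :: "'n \<Rightarrow> nat"
  assumes \<sigma>: "\<sigma> \<noteq> {}"
    and \<Lambda>: "\<And>i. i \<in> {1..p} \<Longrightarrow> positive_divisor (blocks b {i}) (\<Lambda> i)"
    and le: "\<And>I. I \<subseteq> {1..p} \<Longrightarrow> int (\<Sum>i\<in>I. n i) \<le> aff_dim (coord_proj (blocks b I) ` \<sigma>)"
  shows "\<exists>\<mu> a. (\<forall>i\<in>{1..p}. \<forall>j\<in>{1..n i}.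
        \<mu> i j \<in> cells_of_dim (int CARD('n) - 1) (proj_preimage (blocks b {i}) (\<Lambda> i)) \<and>
        parallel_space (\<mu> i j) = {x. a i j \<bullet> x = 0}) \<and>
      (\<forall>z. \<exists>x\<in>parallel_space \<sigma>. \<forall>i\<in>{1..p}. \<forall>j\<in>{1..n i}. a i j \<bullet> x = z i j)"
proof -
  let ?L = "parallel_space \<sigma>"
  define E where "E i = {a. \<exists>\<mu>\<in>cells_of_dim (int CARD('n) - 1) (proj_preimage (blocks b {i}) (\<Lambda> i)).
      parallel_space \<mu> = {x. a \<bullet> x = 0}}" for i
  have rank: "dim {x \<in> ?L. \<forall>i\<in>I. \<forall>a\<in>E i. a \<bullet> x = 0} + (\<Sum>i\<in>I. n i) \<le> dim ?L" if I: "I \<subseteq> {1..p}" for I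
  proof -
    have "(\<forall>i\<in>I. \<forall>a\<in>E i. a \<bullet> x = 0) \<longleftrightarrow> coord_proj (blocks b I) x = 0" for x
    proof -
      have "(\<forall>i\<in>I. \<forall>a\<in>E i. a \<bullet> x = 0) \<longleftrightarrow> (\<forall>i\<in>I. coord_proj (blocks b {i}) x = 0)"
        unfolding E_def using facet_normals_kernel[OF \<Lambda>] I by (intro ball_cong refl) blast
      also have "\<dots> \<longleftrightarrow> coord_proj (blocks b I) x = 0"
        unfolding coord_proj_def blocks_def by (auto simp: vec_eq_iff)
      finally show ?thesis .
    qed
    then have "dim {x \<in> ?L. \<forall>i\<in>I. \<forall>a\<in>E i. a \<bullet> x = 0} = dim {x \<in> ?L. coord_proj (blocks b I) x = 0}"
      by (simp only:)
    moreover have "(\<Sum>i\<in>I. n i) \<le> dim (coord_proj (blocks b I) ` ?L)"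
      using le[OF I] unfolding aff_dim_coord_proj[OF \<sigma>] by (simp only: of_nat_le_iff)
    ultimately show ?thesis
      using dim_linear_image_plus_kernel[OF linear_coord_proj subspace_parallel_space, of "blocks b I" \<sigma>] by linarith
  qed
  obtain a :: "nat \<Rightarrow> nat \<Rightarrow> real^'n" where a: "\<forall>i\<in>{1..p}. \<forall>j\<in>{1..n i}. a i j \<in> E i"
      "\<forall>z. \<exists>x\<in>?L. \<forall>i\<in>{1..p}. \<forall>j\<in>{1..n i}. a i j \<bullet> x = z i j"
    using rado_linear_functionals[OF finite_atLeastAtMost subspace_parallel_space rank] by blast
  have "\<exists>\<mu>. i \<in> {1..p} \<longrightarrow> j \<in> {1..n i} \<longrightarrow>
      \<mu> \<in> cells_of_dim (int CARD('n) - 1) (proj_preimage (blocks b {i}) (\<Lambda> i)) \<and>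
      parallel_space \<mu> = {x. a i j \<bullet> x = 0}" for i j
    using a(1) unfolding E_def by blast
  then obtain \<mu> where "\<And>i j. i \<in> {1..p} \<longrightarrow> j \<in> {1..n i} \<longrightarrow>
      \<mu> i j \<in> cells_of_dim (int CARD('n) - 1) (proj_preimage (blocks b {i}) (\<Lambda> i)) \<and>
      parallel_space (\<mu> i j) = {x. a i j \<bullet> x = 0}" by metis
  then show ?thesis using a(2) by (intro exI[of _ \<mu>] exI[of _ a]) blast
qed

text \<open>
  The given facets and the whole spaces are transversal: a translation of them is undone by first
  moving to the translate of \<open>\<sigma>\<close>, and then within it, by a vector on which the functionals \<open>a\<close> take
  the values that are left.
\<close>

lemma covering_start:
  fixes \<phi> :: "nat \<times> nat \<Rightarrow> 'k::finite" and \<Gamma> :: "(real^'n::finite) weighted_complex"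
  assumes inj: "inj_on \<phi> (slots p n)"
    and \<Gamma>: "weakly_balanced_complex (int d) (cells \<Gamma>)" "(\<Sum>i=1..p. n i) = d"
    and D: "\<And>i. i \<in> {1..p} \<Longrightarrow> weakly_balanced_complex (int CARD('n) - 1) (cells (D i))"
    and \<sigma>: "\<sigma> \<in> cells_of_dim (int d) \<Gamma>"
    and \<mu>: "\<And>i j. i \<in> {1..p} \<Longrightarrow> j \<in> {1..n i} \<Longrightarrow> \<mu> i j \<in> cells_of_dim (int CARD('n) - 1) (D i)"
      "\<And>i j. i \<in> {1..p} \<Longrightarrow> j \<in> {1..n i} \<Longrightarrow> parallel_space (\<mu> i j) = {x. a i j \<bullet> x = 0}"
    and a: "\<And>z. \<exists>x\<in>parallel_space \<sigma>. \<forall>i\<in>{1..p}. \<forall>j\<in>{1..n i}. a i j \<bullet> x = z i j"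
  shows "covering (spread \<phi> (slots p n) (int CARD('n)) (power_dims (int CARD('n)) (int d) (\<lambda>_. 0)))
       (spread \<phi> (slots p n) {UNIV} (power_cells \<Gamma> (int d) D (\<lambda>_. 0)))"
proof -
  let ?N = "int CARD('n)" and ?I = "slots p n"
  define e where "e = spread \<phi> ?I ?N (power_dims ?N (int d) (\<lambda>_. 0))"
  define X where "X = spread \<phi> ?I {UNIV :: (real^'n) set}
      (\<lambda>(i, j). if i = 0 then cells \<Gamma> else if j = 0 then {UNIV} else cells (D i))"
  define c where "c = spread \<phi> ?I UNIV (\<lambda>(i, j). if i = 0 then \<sigma> else if j = 0 then UNIV else \<mu> i j)"
  have slot: "P" if "r \<notin> \<phi> ` ?I \<Longrightarrow> P" "r = \<phi> (0, 0) \<Longrightarrow> P"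
      "\<And>i. i \<in> {1..p} \<Longrightarrow> r = \<phi> (i, 0) \<Longrightarrow> P" "\<And>i j. i \<in> {1..p} \<Longrightarrow> j \<in> {1..n i} \<Longrightarrow> r = \<phi> (i, j) \<Longrightarrow> P" for r P
  proof (cases "r \<in> \<phi> ` ?I")
    case True
    then obtain i j where ij: "(i, j) \<in> ?I" "r = \<phi> (i, j)" by auto
    then consider "i = 0" "j = 0" | "i \<in> {1..p}" "j = 0" | "i \<in> {1..p}" "j \<in> {1..n i}"
      unfolding slots_def by fastforce
    then show P using that(2-4) ij(2) by cases auto
  qed (use that(1) in blast)
  have 00: "(0, 0) \<in> ?I" unfolding slots_def by simp
  have i0: "(i, 0) \<in> ?I" if "i \<in> {1..p}" for i using that unfolding slots_def by simp
  have ij: "(i, j) \<in> ?I" if "i \<in> {1..p}" "j \<in> {1..n i}" for i j using that unfolding slots_def by simp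
  note at = spread_at[OF inj 00] spread_at[OF inj i0] spread_at[OF inj ij]
  have out: "e r = ?N" "X r = {UNIV}" "c r = UNIV" if "r \<notin> \<phi> ` ?I" for r
    unfolding e_def X_def c_def by (simp_all add: spread_outside[OF that])
  have at_\<Gamma>: "e (\<phi> (0, 0)) = int d" "X (\<phi> (0, 0)) = cells \<Gamma>" "c (\<phi> (0, 0)) = \<sigma>"
    unfolding e_def X_def c_def at power_dims_def by simp_all
  have at_W: "e (\<phi> (i, 0)) = ?N" "X (\<phi> (i, 0)) = {UNIV}" "c (\<phi> (i, 0)) = UNIV" if "i \<in> {1..p}" for i
    unfolding e_def X_def c_def at(2)[OF that] power_dims_def using that by simp_all
  have at_D: "e (\<phi> (i, j)) = ?N - 1" "X (\<phi> (i, j)) = cells (D i)" "c (\<phi> (i, j)) = \<mu> i j"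
    if "i \<in> {1..p}" "j \<in> {1..n i}" for i j
    unfolding e_def X_def c_def at(3)[OF that] power_dims_def using that by simp_all
  have "(\<Sum>r\<in>UNIV. e r) = (\<Sum>q\<in>?I. power_dims ?N (int d) (\<lambda>_. 0) q) + (int CARD('k) - int (card ?I)) * ?N"
    unfolding e_def by (rule sum_spread[OF inj finite_slots])
  also have "(\<Sum>q\<in>?I. power_dims ?N (int d) (\<lambda>_. 0) q) = int d + (\<Sum>i=1..p. ?N + int (n i) * (?N - 1))"
    unfolding sum_slots power_dims_def by simp
  also have "(\<Sum>i=1..p. ?N + int (n i) * (?N - 1)) = int p * ?N + (\<Sum>i=1..p. int (n i)) * (?N - 1)"
    by (simp add: sum.distrib sum_distrib_right)
  also have "(\<Sum>i=1..p. int (n i)) = int d" using \<Gamma>(2) by (metis of_nat_sum)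
  also have "int (card ?I) = 1 + int p + int d" unfolding card_slots \<Gamma>(2) by simp
  finally have sum_e: "(\<Sum>r\<in>UNIV. e r) + ?N = int (CARD('k) * CARD('n))" by (simp add: algebra_simps)
  interpret weakly_balanced_family X e
  proof
    show "weakly_balanced_complex (e r) (X r)" for r
      by (rule slot[of r]) (simp_all add: out at_\<Gamma> at_W at_D \<Gamma>(1) D weakly_balanced_complex_UNIV)
  qed (rule sum_e)
  have dimU: "aff_dim (UNIV :: (real^'n) set) = ?N" by simp
  have "c \<in> transversal"
    unfolding transversal_def
  proof (intro CollectI conjI allI)
    show "c r \<in> X r" for r
      by (rule slot[of r]) (use \<sigma> \<mu>(1) in \<open>simp_all add: out at_\<Gamma> at_W at_D cells_of_dim_def\<close>)
    show "aff_dim (c r) = e r" for r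
      by (rule slot[of r]) (use \<sigma> \<mu>(1) in \<open>simp_all add: out at_\<Gamma> at_W at_D cells_of_dim_def\<close>)
    have "y \<in> meeting (\<lambda>r. parallel_space (c r))" for y :: "real^'n^'k"
    proof -
      let ?g = "y $ \<phi> (0, 0)"
      obtain x where x: "x \<in> parallel_space \<sigma>"
          "\<And>i j. i \<in> {1..p} \<Longrightarrow> j \<in> {1..n i} \<Longrightarrow> a i j \<bullet> x = a i j \<bullet> (y $ \<phi> (i, j) - ?g)"
        using a[of "\<lambda>i j. a i j \<bullet> (y $ \<phi> (i, j) - ?g)"] by blast
      have "(?g + x) - y $ r \<in> parallel_space (c r)" for r
      proof (rule slot[of r])
        fix i j assume "i \<in> {1..p}" "j \<in> {1..n i}" "r = \<phi> (i, j)"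
        then show "(?g + x) - y $ r \<in> parallel_space (c r)"
          using x(2)[of i j] by (simp add: at_D \<mu>(2) inner_add_right inner_diff_right)
      qed (use x(1) in \<open>simp_all add: out at_\<Gamma> at_W\<close>)
      then show ?thesis unfolding meeting_def by blast
    qed
    then show "meeting (\<lambda>r. parallel_space (c r)) = UNIV" by blast
  qed
  then have cov: "\<exists>c\<in>transversal. y \<in> meeting c" for y by (intro transversal_meeting_covers) blast
  have Xe: "spread \<phi> ?I {UNIV} (power_cells \<Gamma> (int d) D (\<lambda>_. 0)) r = {\<tau> \<in> X r. aff_dim \<tau> = e r}" for r
  proof (rule slot[of r])
    assume r: "r \<notin> \<phi> ` ?I"
    show ?thesis unfolding out[OF r] spread_outside[OF r] using dimU by auto
  next
    assume r: "r = \<phi> (0, 0)"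
    show ?thesis unfolding r at_\<Gamma> at power_cells_def by (simp add: cells_of_dim_def)
  next
    fix i assume i: "i \<in> {1..p}" "r = \<phi> (i, 0)"
    show ?thesis
      unfolding i(2) at_W[OF i(1)] at(2)[OF i(1)] power_cells_def using i(1) dimU
      by (auto simp: cells_of_dim_def whole_space_def)
  next
    fix i j assume i: "i \<in> {1..p}" "j \<in> {1..n i}" "r = \<phi> (i, j)"
    show ?thesis
      unfolding i(3) at_D[OF i(1,2)] at(3)[OF i(1,2)] power_cells_def using i(1,2)
      by (simp add: cells_of_dim_def)
  qed
  show ?thesis
    unfolding covering_def e_def[symmetric] Xe
  proof (intro conjI allI ballI)
    show "finite {\<tau> \<in> X r. aff_dim \<tau> = e r}" for r using finite_X by simp
    show "\<exists>c. (\<forall>r. c r \<in> {\<tau> \<in> X r. aff_dim \<tau> = e r}) \<and> y \<in> meeting c" for y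
      using cov[of y] unfolding transversal_def by blast
    fix \<tau> r assume "\<tau> \<in> {\<tau> \<in> X r. aff_dim \<tau> = e r}"
    then have \<tau>: "\<tau> \<in> X r" "aff_dim \<tau> = e r" by simp_all
    show "polyhedron \<tau>" "\<tau> \<noteq> {}" "aff_dim \<tau> = e r"
      by (rule cell(1)[OF \<tau>(1)], rule cell(2)[OF \<tau>(1)], rule \<tau>(2))
  qed (rule sum_e)
qed

lemma iterated_nonempty_if_exists_facet:
  fixes \<Gamma> :: "(real^'n::finite) weighted_complex" and b :: "'n \<Rightarrow> nat"
  assumes \<Gamma>: "tropical_variety UNIV d \<Gamma>" "(\<Sum>i=1..p. n i) = d" and p: "p \<le> CARD('n)"
    and \<Lambda>: "\<And>i. i \<in> {1..p} \<Longrightarrow> positive_divisor (blocks b {i}) (\<Lambda> i)"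
    and \<sigma>: "\<sigma> \<in> facets \<Gamma>" "\<And>I. I \<subseteq> {1..p} \<Longrightarrow> int (\<Sum>i\<in>I. n i) \<le> aff_dim (coord_proj (blocks b I) ` \<sigma>)"
  shows "cells (iterated_intersection \<Gamma> (\<lambda>i. proj_preimage (blocks b {i}) (\<Lambda> i)) n p) \<noteq> {}"
proof -
  let ?D = "\<lambda>i. proj_preimage (blocks b {i}) (\<Lambda> i)" and ?N = "int CARD('n)"
  have \<sigma>d: "\<sigma> \<in> cells_of_dim (int d) \<Gamma>" using \<sigma>(1) tropical_varietyD(6)[OF \<Gamma>(1)] by simp
  then have "\<sigma> \<in> cells \<Gamma>" "aff_dim \<sigma> = int d" unfolding cells_of_dim_def by auto
  then have \<sigma>_ne: "\<sigma> \<noteq> {}" and "d \<le> CARD('n)"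
    using tropical_varietyD(2)[OF \<Gamma>(1)] aff_dim_le_DIM[of \<sigma>] by auto
  \<comment> \<open>The \<open>1 + p + d\<close> slots fit into a type with \<open>1 + 2 N\<close> elements, for the ambient dimension \<open>N\<close>.\<close>
  then have "card (slots p n) \<le> CARD(('n + 'n) option)"
    unfolding card_slots \<Gamma>(2) using p by simp
  then obtain \<phi> :: "nat \<times> nat \<Rightarrow> ('n + 'n) option" where \<phi>: "inj_on \<phi> (slots p n)"
    using card_le_inj[OF finite_slots finite] by blast
  from exists_transversal_facets[OF \<sigma>_ne, of p b \<Lambda> n, OF \<Lambda> \<sigma>(2)]
  obtain \<mu> a where \<mu>: "\<And>i j. i \<in> {1..p} \<Longrightarrow> j \<in> {1..n i} \<Longrightarrow> \<mu> i j \<in> cells_of_dim (?N - 1) (?D i)"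
      "\<And>i j. i \<in> {1..p} \<Longrightarrow> j \<in> {1..n i} \<Longrightarrow> parallel_space (\<mu> i j) = {x. a i j \<bullet> x = 0}"
      "\<And>z. \<exists>x\<in>parallel_space \<sigma>. \<forall>i\<in>{1..p}. \<forall>j\<in>{1..n i}. a i j \<bullet> x = z i j"
    by blast
  have start: "covering (spread \<phi> (slots p n) ?N (power_dims ?N (int d) (\<lambda>_. 0)))
       (spread \<phi> (slots p n) {UNIV} (power_cells \<Gamma> (int d) ?D (\<lambda>_. 0)))"
    by (rule covering_start[OF \<phi> weakly_balanced_complex_tropical_variety[OF \<Gamma>(1)] \<Gamma>(2) positive_divisorD(2)[OF \<Lambda>] \<sigma>d \<mu>])
  define l where "l i = (if i \<in> {1..p} then n i else 0)" for i
  have "covering (spread \<phi> (slots p n) ?N (power_dims ?N (int d) l))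
       (spread \<phi> (slots p n) {UNIV} (power_cells \<Gamma> (int d) ?D l))"
    by (rule covering_powers[OF \<phi> positive_divisorD(1)[OF \<Lambda>] start]) (auto simp: l_def)
  moreover have "spread \<phi> (slots p n) ?N (power_dims ?N (int d) l) = spread \<phi> (slots p n) ?N (product_dims ?N (int d) n 0)"
    by (rule spread_cong) (auto simp: power_dims_def product_dims_def slots_def l_def)
  moreover have "spread \<phi> (slots p n) {UNIV} (power_cells \<Gamma> (int d) ?D l)
      = spread \<phi> (slots p n) {UNIV} (product_cells \<Gamma> (int d) ?D n 0)"
    by (rule spread_cong) (auto simp: power_cells_def product_cells_def slots_def l_def)
  ultimately have "covering (spread \<phi> (slots p n) ?N (product_dims ?N (int d) n p))
     (spread \<phi> (slots p n) {UNIV} (product_cells \<Gamma> (int d) ?D n p))"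
    using covering_products[where D = ?D and k = p,
        OF \<phi> positive_complex_tropical_variety[OF \<Gamma>(1)] positive_divisorD(1)[OF \<Lambda>]] by simp
  from coveringD(6)[OF this] obtain c where
    "\<And>r. c r \<in> spread \<phi> (slots p n) {UNIV} (product_cells \<Gamma> (int d) ?D n p) r" by blast
  moreover have "(0, 0) \<in> slots p n" unfolding slots_def by simp
  ultimately have "c (\<phi> (0, 0)) \<in> product_cells \<Gamma> (int d) ?D n p (0, 0)"
    using spread_at[OF \<phi>] by metis
  then show ?thesis unfolding product_cells_def cells_of_dim_def by auto
qed

theorem theorem3p5:
  fixes p d :: nat and m n :: "nat \<Rightarrow> nat" and b :: "'n::finite \<Rightarrow> nat"
    and \<Gamma> :: "(real^'n) weighted_complex" and \<Lambda> :: "nat \<Rightarrow> (real^'n) weighted_complex"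
  assumes "1 \<le> p"
    and "\<forall>i\<in>{1..p}. 0 < m i"
    and "\<forall>j. b j \<in> {1..p}"
    and "\<forall>i\<in>{1..p}. card (blocks b {i}) = m i"
    and "tropical_variety UNIV d \<Gamma>"
    and "\<forall>i\<in>{1..p}. positive_divisor (blocks b {i}) (\<Lambda> i)"
    and "(\<Sum>i=1..p. n i) = d"
  shows "0 < tropical_multidegree p b \<Lambda> n \<Gamma> \<longleftrightarrow>
    (\<exists>\<sigma>\<in>facets \<Gamma>. \<forall>I\<subseteq>{1..p}.
        int (\<Sum>i\<in>I. n i) \<le> aff_dim (coord_proj (blocks b I) ` \<sigma>))"
proof -
  let ?D = "\<lambda>i. proj_preimage (blocks b {i}) (\<Lambda> i)"
  let ?Z = "iterated_intersection \<Gamma> ?D n p"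
  have \<Lambda>: "positive_divisor (blocks b {i}) (\<Lambda> i)" if "i \<in> {1..p}" for i using assms(6) that by blast
  have "positive_complex (int d - (\<Sum>i=1..p. int (n i))) ?Z"
    by (rule positive_complex_iterated[OF positive_complex_tropical_variety[OF assms(5)] positive_divisorD(1)[OF \<Lambda>]])
  moreover have "int d - (\<Sum>i=1..p. int (n i)) = 0" using assms(7) by (metis diff_self of_nat_sum)
  ultimately have "positive_complex 0 ?Z" by (simp only:)
  then have deg: "0 < tropical_multidegree p b \<Lambda> n \<Gamma> \<longleftrightarrow> cells ?Z \<noteq> {}"
    unfolding tropical_multidegree_def by (rule tropical_degree_pos_iff)
  have p: "p \<le> CARD('n)"
  proof -
    have "{1..p} \<subseteq> range b"
    proof
      fix i assume i: "i \<in> {1..p}"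
      then have "0 < card (blocks b {i})" using assms(2,4) by simp
      then have "blocks b {i} \<noteq> {}" by (metis card.empty less_numeral_extra(3))
      then show "i \<in> range b" unfolding blocks_def by blast
    qed
    then have "card {1..p} \<le> card (range b)" by (intro card_mono) auto
    also have "\<dots> \<le> CARD('n)" by (rule card_image_le) simp
    finally show ?thesis by simp
  qed
  show ?thesis
    unfolding deg
  proof
    assume "cells ?Z \<noteq> {}"
    then show "\<exists>\<sigma>\<in>facets \<Gamma>. \<forall>I\<subseteq>{1..p}. int (\<Sum>i\<in>I. n i) \<le> aff_dim (coord_proj (blocks b I) ` \<sigma>)"
      using \<Lambda> by (intro exists_facet_if_iterated_nonempty[OF assms(5)]) (simp_all add: positive_divisor_def)
  next
    assume "\<exists>\<sigma>\<in>facets \<Gamma>. \<forall>I\<subseteq>{1..p}. int (\<Sum>i\<in>I. n i) \<le> aff_dim (coord_proj (blocks b I) ` \<sigma>)"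
    then obtain \<sigma> where \<sigma>: "\<sigma> \<in> facets \<Gamma>"
        "\<And>I. I \<subseteq> {1..p} \<Longrightarrow> int (\<Sum>i\<in>I. n i) \<le> aff_dim (coord_proj (blocks b I) ` \<sigma>)" by blast
    show "cells ?Z \<noteq> {}"
      by (rule iterated_nonempty_if_exists_facet[OF assms(5,7) p \<Lambda> \<sigma>])
  qed
qed

end
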